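(* Assume the setting of case (a) or case (b) in the context, with $Q=Q(P)=\mathcal{L}(X_1-X_2)\in\mathcal{Q}$, and let $J=J_Q$, $H_1(x):=\mathbb{E}J(x-X_1)$, $H_2(x,y):=J(x-y)-H_1(x)-H_1(y)$. Fix an integer $d\ge1$. Let $\Pi^{(1)},\dots,\Pi^{(d)}$ be independent random permutations of $\{1,\dots,n\}$, each uniformly distributed, independent of $(X_i)_{i\ge1}$, and let $\hat Q^{(\ell)}_{n,1}:=n^{-1}\sum_{i=1}^n\delta^{\rm s}_{X_{\Pi^{(\ell)}(i+1)}-X_{\Pi^{(\ell)}(i)}}$ with $\Pi^{(\ell)}(n+1):=\Pi^{(\ell)}(1)$. Then for each $1\le\ell\le d$, \[ \boldsymbol{\Sigma}(\hat Q^{(\ell)}_{n,1})=\boldsymbol{\Sigma}(Q)+2\int H_1\,d\hat P_n+M^{(\ell)}_{n,1}+o_p(n^{-1/2}),\quad M^{(\ell)}_{n,1}:=n^{-1}\sum_{i=1}^nH_2(X_{\Pi^{(\ell)}(i)},X_{\Pi^{(\ell)}(i+1)}). \] Moreover \[ \sqrt n\Bigl(\int H_1\,d\hat P_n,\,M^{(1)}_{n,1},\dots,M^{(d)}_{n,1}\Bigr)\to_{\mathcal L}(\boldsymbol{G}_1,\boldsymbol{G}_2^{(1)},\dots,\boldsymbol{G}_2^{(d)}) \] with independent random matrices, where $\boldsymbol{G}_1$ is centered Gaussian in $\mathbb{R}^{q\times q}_{\rm sym}$ with $\mathbb{E}\langle A,\boldsymbol{G}_1\rangle^2=\mathbb{E}\langle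 A,H_1(X_1)\rangle^2$ and each $\boldsymbol{G}_2^{(\ell)}$ is centered Gaussian with $\mathbb{E}\langle A,\boldsymbol{G}_2^{(\ell)}\rangle^2=\mathbb{E}\langle A,H_2(X_1,X_2)\rangle^2$ for all $A\in\mathbb{R}^{q\times q}_{\rm sym}$. In particular, with $\boldsymbol{G}_2$ distributed as $\boldsymbol{G}_2^{(1)}$ and independent of $\boldsymbol{G}_1$, \[ \sqrt n\Bigl(d^{-1}\sum_{\ell=1}^d\boldsymbol{\Sigma}(\hat Q^{(\ell)}_{n,1})-\boldsymbol{\Sigma}(Q)\Bigr)\to_{\mathcal L}2\boldsymbol{G}_1+d^{-1/2}\boldsymbol{G}_2 \quad (n\to\infty). \]
   Context: Notation: $\mathbb{R}^{q\times q}_{\rm sym}$ is the space of symmetric $q\times q$ matrices, $\mathbb{R}^{q\times q}_{\rm sym,+}$ its subset of positive definite matrices; $\langle M,N\rangle=\mathrm{tr}(M^\top N)$ and $\|M\|$ is the Frobenius norm. $\delta_z$ is the Dirac measure at $z$ and $\delta^{\rm s}_z:=\frac12(\delta_z+\delta_{-z})$. $X_1,X_2,\dots$ are i.i.d. with distribution $P$ on $\mathbb{R}^q$ and $\hat P_n:=n^{-1}\sum_{i=1}^n\delta_{X_i}$. $\to_{\mathcal L}$ denotes convergence in distribution, $o_p(a_n)$ a term $R_n$ with $R_n/a_n\to0$ in probability. Estimators $\boldsymbol{\Sigma}(\hat Q)$ are defined on the event $\hat Q\in\mathcal{Q}$ (arbitrarily otherwise). Case (a): $\mathcal{Q}$ is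 a family of probability distributions on $\mathbb{R}^q$ which is open in the topology of weak convergence, and $\boldsymbol{\Sigma}:\mathcal{Q}\to\mathbb{R}^{q\times q}_{\rm sym,+}$ satisfies: (linear equivariance) for every nonsingular $B\in\mathbb{R}^{q\times q}$ and $Q\in\mathcal{Q}$, the law $Q^B$ of $BY$, $Y\sim Q$, lies in $\mathcal{Q}$ and $\boldsymbol{\Sigma}(Q^B)=B\boldsymbol{\Sigma}(Q)B^\top$; (differentiability) for each $Q\in\mathcal{Q}$ there is a bounded, measurable, even function $J=J_Q:\mathbb{R}^q\to\mathbb{R}^{q\times q}_{\rm sym}$ with $\int J\,dQ=0$ such that for $\check Q\in\mathcal{Q}$, $\boldsymbol{\Sigma}(\check Q)=\boldsymbol{\Sigma}(Q)+\int J\,d\check Q+o(\|\int J\,d\check Q\|)$ as $\check Q\to Q$ weakly. Case (b) (Tyler's functional): $P$ has no atoms; $\mathcal{Q}=\mathcal{Q}_0$ is the set of distributions $Q$ on $\mathbb{R}^q$ with $Q(\{0\})=0$ and $Q(\mathbb{W})<\dim(\mathbb{W})/q$ for every linear subspace $\mathbb{W}$ with $1\le\dim\mathbb{W}<q$; $\boldsymbol{\Sigma}(Q)=\boldsymbol{\Sigma}_0(Q)$ is the unique minimizer over $\{\Sigma\in\mathbb{R}^{q\times q}_{\rm sym,+}:\det\Sigma=1\}$ of $L_0(\Sigma,Q)=q\int\log\bigl(y^\top\Sigma^{-1}y/y^\top y\bigr)Q(dy)+\log\det\Sigma$; it has the differentiability property that for each $Q\in\mathcal{Q}_0$ there is a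 bounded, continuous, even $J=J_Q:\mathbb{R}^q\setminus\{0\}\to\mathbb{R}^{q\times q}_{\rm sym}$ with $\int J\,dQ=0$ and $\boldsymbol{\Sigma}_0(\check Q)=\boldsymbol{\Sigma}_0(Q)+\int J\,d\check Q+o(\|\int J\,d\check Q\|)$ as $\check Q\to Q$ weakly, $\check Q\in\mathcal{Q}_0$; one sets $J(0):=0$. *)

theory Defs
  imports "HOL-Probability.Probability"
begin

type_synonym 'q mat = "real^'q^'q"

definition symm :: "real^'q^'q \<Rightarrow> bool" where
  "symm A \<longleftrightarrow> transpose A = A"

definition posdef :: "real^'q^'q \<Rightarrow> bool" where
  "posdef A \<longleftrightarrow> symm A \<and> (\<forall>x. x \<noteq> 0 \<longrightarrow> 0 < x \<bullet> (A *v x))"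

definition probdist :: "(real^'q) measure \<Rightarrow> bool" where
  "probdist Q \<longleftrightarrow> prob_space Q \<and> sets Q = sets (borel :: (real^'q) measure)"

definition weak_conv :: "(nat \<Rightarrow> 'a::metric_space measure) \<Rightarrow> 'a measure \<Rightarrow> bool" where
  "weak_conv Qs Q \<longleftrightarrow>
     (\<forall>f::'a \<Rightarrow> real. continuous_on UNIV f \<and> bounded (range f) \<longrightarrow>
        (\<lambda>n. integral\<^sup>L (Qs n) f) \<longlonglongrightarrow> integral\<^sup>L Q f)"

text \<open>Openness in the (metrizable) topology of weak convergence, sequential form.\<close>
definition weakly_open :: "(real^'q) measure set \<Rightarrow> bool" where
  "weakly_open \<QQ> \<longleftrightarrow> (\<forall>Q\<in>\<QQ>. probdist Q) \<and>
     (\<forall>Q\<in>\<QQ>. \<forall>Qs. (\<forall>n. probdist (Qs n)) \<and> weak_conv Qs Q \<longrightarrow>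
        eventually (\<lambda>n. Qs n \<in> \<QQ>) sequentially)"

definition lin_image :: "real^'q^'q \<Rightarrow> (real^'q) measure \<Rightarrow> (real^'q) measure" where
  "lin_image B Q = distr Q borel (\<lambda>y. B *v y)"

definition is_deriv ::
  "(real^'q) measure set \<Rightarrow> ((real^'q) measure \<Rightarrow> real^'q^'q) \<Rightarrow> (real^'q) measure
     \<Rightarrow> (real^'q \<Rightarrow> real^'q^'q) \<Rightarrow> bool" where
  "is_deriv \<QQ> \<Sigma> Q J \<longleftrightarrow>
     bounded (range J) \<and> J \<in> borel_measurable borel \<and> (\<forall>x. J (-x) = J x) \<and>
     (\<forall>x. symm (J x)) \<and> integral\<^sup>L Q J = 0 \<and>
     (\<forall>Qs. (\<forall>n. Qs n \<in> \<QQ>) \<and> weak_conv Qs Q \<longrightarrow>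
        (\<forall>\<epsilon>>0. eventually (\<lambda>n. norm (\<Sigma> (Qs n) - \<Sigma> Q - integral\<^sup>L (Qs n) J)
                 \<le> \<epsilon> * norm (integral\<^sup>L (Qs n) J)) sequentially))"

definition case_a :: "(real^'q) measure set \<Rightarrow> ((real^'q) measure \<Rightarrow> real^'q^'q) \<Rightarrow> bool" where
  "case_a \<QQ> \<Sigma> \<longleftrightarrow> weakly_open \<QQ> \<and> (\<forall>Q\<in>\<QQ>. posdef (\<Sigma> Q)) \<and>
     (\<forall>B Q. invertible B \<and> Q \<in> \<QQ> \<longrightarrow>
        lin_image B Q \<in> \<QQ> \<and> \<Sigma> (lin_image B Q) = B ** \<Sigma> Q ** transpose B) \<and>
     (\<forall>Q\<in>\<QQ>. \<exists>J. is_deriv \<QQ> \<Sigma> Q J)"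

definition Q0 :: "(real^'q) measure set" where
  "Q0 = {Q. probdist Q \<and> emeasure Q {0} = 0 \<and>
          (\<forall>W. subspace W \<and> 1 \<le> dim W \<and> dim W < CARD('q) \<longrightarrow>
               measure Q W < real (dim W) / real CARD('q))}"

definition L0 :: "real^'q^'q \<Rightarrow> (real^'q) measure \<Rightarrow> real" where
  "L0 S Q = real CARD('q) * (\<integral>y. ln ((y \<bullet> (matrix_inv S *v y)) / (y \<bullet> y)) \<partial>Q)
            + ln (det S)"

definition tyler :: "(real^'q) measure \<Rightarrow> real^'q^'q" where
  "tyler Q = (THE S. posdef S \<and> det S = 1 \<and>
               (\<forall>S'. posdef S' \<and> det S' = 1 \<and> S' \<noteq> S \<longrightarrow> L0 S Q < L0 S' Q))"

definition perms :: "nat \<Rightarrow> (nat \<Rightarrow> nat) set" where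
  "perms n = {p. p permutes {1..n}}"

definition sample :: "(real^'q) measure \<Rightarrow> 'd::finite itself \<Rightarrow> nat \<Rightarrow>
    ((nat \<Rightarrow> real^'q) \<times> ('d \<Rightarrow> nat \<Rightarrow> nat)) measure" where
  "sample P _ n = (\<Pi>\<^sub>M i\<in>{1..n}. P) \<Otimes>\<^sub>M
                  (\<Pi>\<^sub>M l\<in>(UNIV::'d set). measure_pmf (pmf_of_set (perms n)))"

definition nxt :: "nat \<Rightarrow> nat \<Rightarrow> nat" where
  "nxt n i = (if i = n then 1 else i + 1)"

definition sym_emp :: "nat \<Rightarrow> (nat \<Rightarrow> real^'q) \<Rightarrow> (real^'q) measure" where
  "sym_emp n z = distr (measure_pmf (pmf_of_multiset
       (image_mset z (mset_set {1..n}) + image_mset (\<lambda>i. - z i) (mset_set {1..n}))))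
     borel (\<lambda>x. x)"

definition Qhat :: "nat \<Rightarrow> (nat \<Rightarrow> real^'q) \<Rightarrow> (nat \<Rightarrow> nat) \<Rightarrow> (real^'q) measure" where
  "Qhat n xs p = sym_emp n (\<lambda>i. xs (p (nxt n i)) - xs (p i))"

definition diff_law :: "(real^'q) measure \<Rightarrow> (real^'q) measure" where
  "diff_law P = distr (P \<Otimes>\<^sub>M P) borel (\<lambda>(x, y). x - y)"

definition H1 :: "(real^'q) measure \<Rightarrow> (real^'q \<Rightarrow> real^'q^'q) \<Rightarrow> real^'q \<Rightarrow> real^'q^'q" where
  "H1 P J x = (\<integral>y. J (x - y) \<partial>P)"

definition H2 :: "(real^'q) measure \<Rightarrow> (real^'q \<Rightarrow> real^'q^'q) \<Rightarrow> real^'q \<Rightarrow> real^'q \<Rightarrow> real^'q^'q" where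
  "H2 P J x y = J (x - y) - H1 P J x - H1 P J y"

text \<open>R_n = o_p(1) (via outer probability, so no measurability of R_n is required).\<close>
definition op_zero :: "(nat \<Rightarrow> 'w measure) \<Rightarrow> (nat \<Rightarrow> 'w \<Rightarrow> 'b::real_normed_vector) \<Rightarrow> bool" where
  "op_zero M R \<longleftrightarrow> (\<forall>\<epsilon>>0. \<exists>A. (\<forall>n. A n \<in> sets (M n) \<and>
        {\<omega> \<in> space (M n). \<epsilon> < norm (R n \<omega>)} \<subseteq> A n) \<and>
        (\<lambda>n. measure (M n) (A n)) \<longlonglongrightarrow> 0)"

definition conv_distr :: "(nat \<Rightarrow> 'w measure) \<Rightarrow> (nat \<Rightarrow> 'w \<Rightarrow> 'b::metric_space) \<Rightarrow> 'b measure \<Rightarrow> bool" where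
  "conv_distr M Y L \<longleftrightarrow> prob_space L \<and> sets L = sets borel \<and>
     (\<forall>n. Y n \<in> borel_measurable (M n)) \<and>
     (\<forall>f::'b \<Rightarrow> real. continuous_on UNIV f \<and> bounded (range f) \<longrightarrow>
        (\<lambda>n. \<integral>\<omega>. f (Y n \<omega>) \<partial>M n) \<longlonglongrightarrow> (\<integral>y. f y \<partial>L))"

definition normal_law :: "real \<Rightarrow> real measure" where
  "normal_law v = (if v = 0 then return borel 0 else density lborel (normal_density 0 (sqrt v)))"

definition centered_gaussian_sym :: "(real^'q^'q) measure \<Rightarrow> (real^'q^'q \<Rightarrow> real) \<Rightarrow> bool" where
  "centered_gaussian_sym G v \<longleftrightarrow> prob_space G \<and> sets G = sets borel \<and>
     (AE x in G. symm x) \<and>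
     (\<forall>A. symm A \<longrightarrow> distr G borel (\<lambda>x. A \<bullet> x) = normal_law (v A))"

end

theory Submission
  imports Defs "HOL-Real_Asymp.Real_Asymp"
begin

text \<open>
  Conditionally on the permutations, a linear combination of the entries of
  \<open>\<surd>n (\<integral> H\<^sub>1 dP\<^sub>n, M\<^sup>1, \<dots>, M\<^sup>d)\<close> is a sum of \<open>O(n)\<close> bounded centered terms, each
  depending on one or two of the independent observations, and every observation enters at most
  \<open>1 + 2d\<close> terms. Stein's method in the form of Tikhomirov, i.e. a differential equation for the
  characteristic function, gives a normal approximation with error \<open>O(n\<^sup>-\<^sup>1\<^sup>/\<^sup>2)\<close> that is
  uniform in the permutations. Since \<open>H\<^sub>2\<close> is degenerate, the conditional variance differs from its limit
  only through edges shared by two cycles, and two independent random Hamiltonian cycles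
  share a bounded expected number of edges.

  The remainder is deterministic near \<open>Q\<close>: convergence of integrals of countably many test functions
  determines weak convergence, so differentiability gives a bound by \<open>\<epsilon> \<parallel>\<integral> J dQ'\<parallel>\<close> once finitely many
  of these integrals are close, and these as well as \<open>\<surd>n \<integral> J dQ'\<close> are controlled by second moments.
\<close>

section \<open>Weak convergence on Euclidean spaces\<close>

text \<open>Differentiability speaks of sequences inside the domain, while the estimators are
  evaluated at random measures, so membership in the domain has to follow from closeness to
  \<open>Q\<close>. In case (a) openness gives this. \<open>Q0\<close> is not weakly open, because
  an atom at 0 of vanishing mass is invisible in a weak limit; it is open only among measures
  without such an atom. The symmetrised empirical measures have none almost surely, since
  \<open>Q\<close> has none. Both cases thus enter through one admissibility condition.

  An error bound with explicit constants, unlike a limit theorem for each sequence of permutations,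
  can be integrated over the permutations; as the limiting variance is the same for all of them,
  nothing of the conditioning survives. Independence of the limit components needs no separate
  argument: covariances between different components are zero or stem from rare shared edges, so the
  limiting characteristic function factors. The limiting covariances may be singular, hence the
  Gaussian laws are built from sums of squares and not from densities.\<close>

lemma algebra_polynomial_comp:
  fixes A :: "('a \<Rightarrow> real) set" and p :: "real \<Rightarrow> real"
  assumes add: "\<And>f g. f \<in> A \<Longrightarrow> g \<in> A \<Longrightarrow> (\<lambda>x. f x + g x) \<in> A"
    and mult: "\<And>f g. f \<in> A \<Longrightarrow> g \<in> A \<Longrightarrow> (\<lambda>x. f x * g x) \<in> A"
    and const: "\<And>c. (\<lambda>x. c) \<in> A"
    and g: "g \<in> A" and p: "real_polynomial_function p"
  shows "(\<lambda>x. p (g x)) \<in> A"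
  using p
proof (induction rule: real_polynomial_function.induct)
  case (linear f)
  have "f y = f 1 * y" for y
    using linear.scaleR[OF bounded_linear.linear[OF linear], of y 1] by (simp add: mult.commute)
  then show ?case using mult[OF const[of "f 1"] g] by (metis (no_types, lifting) ext)
qed (auto intro: add mult const)

text \<open>Stone-Weierstrass controls an approximant on \<open>K\<close> only, and outside it may
  be large. Composing it with a polynomial close to a clamp on its bounded range restores the global
  bound without leaving the algebra.\<close>

lemma bounded_algebra_approx:
  fixes A :: "('a::euclidean_space \<Rightarrow> real) set"
  assumes add: "\<And>f g. f \<in> A \<Longrightarrow> g \<in> A \<Longrightarrow> (\<lambda>x. f x + g x) \<in> A"
    and mult: "\<And>f g. f \<in> A \<Longrightarrow> g \<in> A \<Longrightarrow> (\<lambda>x. f x * g x) \<in> A"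
    and const: "\<And>c. (\<lambda>x. c) \<in> A"
    and sep: "\<And>x y. x \<noteq> y \<Longrightarrow> \<exists>g\<in>A. g x \<noteq> g y"
    and cont: "\<And>g. g \<in> A \<Longrightarrow> continuous_on UNIV g"
    and bdd: "\<And>g. g \<in> A \<Longrightarrow> bounded (range g)"
    and f: "continuous_on UNIV f" "\<And>x. \<bar>f x\<bar> \<le> B" and K: "compact K" and e: "0 < e"
  shows "\<exists>h\<in>A. (\<forall>x\<in>K. \<bar>f x - h x\<bar> \<le> e) \<and> (\<forall>x. \<bar>h x\<bar> \<le> B + e)"
proof -
  have "\<exists>g. g \<in> A \<and> (\<forall>x\<in>K. \<bar>f x - g x\<bar> < e/2)"
  proof (rule Stone_Weierstrass_HOL[OF K])
    show "continuous_on K f" using f continuous_on_subset by blast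
      show "continuous_on K g" if "g \<in> A" for g using cont[OF that] continuous_on_subset by blast
    show "\<exists>g. g \<in> A \<and> g x \<noteq> g y" if "x \<in> K \<and> y \<in> K \<and> x \<noteq> y" for x y using sep[of x y] that by blast
  qed (use add mult const e in auto)
  then obtain g where g: "g \<in> A" "\<And>x. x \<in> K \<Longrightarrow> \<bar>f x - g x\<bar> < e/2" by blast
  obtain C where C: "\<And>x. \<bar>g x\<bar> \<le> C" using bdd[OF g(1)] by (auto simp: bounded_iff)
  \<comment> \<open>The clamp to \<open>[-B, B]\<close>. It never moves a number away from a value
    of \<open>f\<close>, so the approximation on \<open>K\<close> survives.\<close>
  define cl where "cl u = max (-B) (min B u)" for u :: real
  have "continuous_on {-C..C} cl" unfolding cl_def by (intro continuous_intros)
  then obtain p where p: "real_polynomial_function p" "\<And>u. u \<in> {-C..C} \<Longrightarrow> \<bar>cl u - p u\<bar> < e/2"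
    using Stone_Weierstrass_real_polynomial_function[of "{-C..C}" cl "e/2"] e by auto
  have B: "0 \<le> B" using f(2)[of 0] by linarith
  have pg: "\<bar>cl (g x) - p (g x)\<bar> < e/2" for x using p(2)[of "g x"] C[of x] by (simp add: abs_le_iff)
  show ?thesis
  proof (intro bexI[where x = "\<lambda>x. p (g x)"] conjI ballI allI)
    show "(\<lambda>x. p (g x)) \<in> A" using algebra_polynomial_comp[OF add mult const g(1) p(1)] .
    fix x
    have "\<bar>cl (g x)\<bar> \<le> B" using B by (auto simp: cl_def max_def min_def abs_le_iff)
    then show "\<bar>p (g x)\<bar> \<le> B + e" using pg[of x] e by linarith
  next
    fix x assume "x \<in> K"
    then have "\<bar>f x - cl (g x)\<bar> < e/2" using g(2)[of x] f(2)[of x] by (auto simp: cl_def max_def min_def abs_le_iff)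
    then show "\<bar>f x - p (g x)\<bar> \<le> e" using pg[of x] by linarith
  qed
qed

lemma borel_measurable_continuous_cong:
  fixes f :: "'a::topological_space \<Rightarrow> 'b::topological_space"
  assumes "sets M = sets borel" "continuous_on UNIV f"
  shows "f \<in> borel_measurable M"
  unfolding measurable_cong_sets[OF assms(1) refl] using assms(2) by (rule borel_measurable_continuous_onI)

lemma integrable_bounded_continuous:
  fixes f :: "'a::euclidean_space \<Rightarrow> real"
  assumes "prob_space M" "sets M = sets borel" "continuous_on UNIV f" "bounded (range f)"
  shows "integrable M f"
proof -
  interpret prob_space M by fact
  obtain B where "\<And>x. norm (f x) \<le> B" using assms(4) by (auto simp: bounded_iff)
  moreover have "f \<in> borel_measurable M"
    using borel_measurable_continuous_cong assms by blast
  ultimately show ?thesis by (intro integrable_const_bound[of _ B]) auto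
qed

text \<open>Tightness confines the comparison of \<open>f\<close> with an element of the algebra to
  a compact set; on the complement the uniform bound on both functions is multiplied by a small
  mass.\<close>

lemma weak_conv_of_algebra:
  fixes A :: "('a::euclidean_space \<Rightarrow> real) set"
  assumes add: "\<And>f g. f \<in> A \<Longrightarrow> g \<in> A \<Longrightarrow> (\<lambda>x. f x + g x) \<in> A"
    and mult: "\<And>f g. f \<in> A \<Longrightarrow> g \<in> A \<Longrightarrow> (\<lambda>x. f x * g x) \<in> A"
    and const: "\<And>c. (\<lambda>x. c) \<in> A"
    and sep: "\<And>x y. x \<noteq> y \<Longrightarrow> \<exists>g\<in>A. g x \<noteq> g y"
    and cont: "\<And>g. g \<in> A \<Longrightarrow> continuous_on UNIV g"
    and bdd: "\<And>g. g \<in> A \<Longrightarrow> bounded (range g)"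
    and prob: "\<And>n. prob_space (\<mu> n)" "prob_space \<nu>"
    and sets: "\<And>n. sets (\<mu> n) = sets borel" "sets \<nu> = sets borel"
    and tight: "\<And>e. 0 < e \<Longrightarrow> \<exists>K. compact K \<and> measure \<nu> (-K) \<le> e \<and> eventually (\<lambda>n. measure (\<mu> n) (-K) \<le> e) sequentially"
    and conv: "\<And>g. g \<in> A \<Longrightarrow> (\<lambda>n. integral\<^sup>L (\<mu> n) g) \<longlonglongrightarrow> integral\<^sup>L \<nu> g"
  shows "weak_conv \<mu> \<nu>"
  unfolding weak_conv_def
proof safe
  fix f :: "'a \<Rightarrow> real" assume f: "continuous_on UNIV f" "bounded (range f)"
  obtain B0 where B0: "\<And>x. norm (f x) \<le> B0" using f(2) by (auto simp: bounded_iff)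
  define B where "B = max B0 1"
  have B: "\<And>x. \<bar>f x\<bar> \<le> B" "B > 0" using B0 by (auto simp: B_def max_def intro: order_trans)
  show "(\<lambda>n. integral\<^sup>L (\<mu> n) f) \<longlonglongrightarrow> integral\<^sup>L \<nu> f"
    unfolding tendsto_iff
  proof safe
    fix r :: real assume r: "r > 0"
    define e where "e = min 1 (r / 12)"
    have e: "0 < e" "e \<le> 1" "e \<le> r / 12" using r by (auto simp: e_def)
    \<comment> \<open>Off \<open>K\<close> the difference of \<open>f\<close> and \<open>h\<close>
      is at most \<open>B + (B + e)\<close>, hence at most \<open>2 * B + 1\<close>; with this
      \<open>d\<close> the complement contributes at most \<open>e\<close>. The three comparisons
      then add up to less than \<open>5 * e\<close>, which is below \<open>r\<close>.\<close>
    define d where "d = e / (2 * B + 1)"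
    have d: "0 < d" using e B by (auto simp: d_def)
    obtain K where K: "compact K" "measure \<nu> (-K) \<le> d" "eventually (\<lambda>n. measure (\<mu> n) (-K) \<le> d) sequentially"
      using tight[OF d] by blast
    obtain h where h: "h \<in> A" "\<And>x. x \<in> K \<Longrightarrow> \<bar>f x - h x\<bar> \<le> e" "\<And>x. \<bar>h x\<bar> \<le> B + e"
      using bounded_algebra_approx[OF add mult const sep cont bdd f(1) B(1) K(1) e(1)] by blast
    have key: "\<bar>integral\<^sup>L N f - integral\<^sup>L N h\<bar> \<le> 2 * e"
      if N: "prob_space N" "sets N = sets borel" "measure N (-K) \<le> d" for N
    proof -
      interpret N: prob_space N by fact
      note [measurable_cong] = N(2)
      have sp: "space N = UNIV" using sets_eq_imp_space_eq[OF N(2)] by simp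
      have i: "integrable N f" "integrable N h"
        using integrable_bounded_continuous[OF N(1,2)] f h(1) cont bdd by auto
      have Km: "-K \<in> sets N" using compact_imp_closed[OF K(1)] N(2) by (auto)
      have ii: "integrable N (indicator (-K) :: 'a \<Rightarrow> real)" using Km by (simp add: N.emeasure_finite less_top[symmetric])
      have "\<bar>integral\<^sup>L N f - integral\<^sup>L N h\<bar> = \<bar>\<integral>x. f x - h x \<partial>N\<bar>" using i by simp
      also have "\<dots> \<le> (\<integral>x. \<bar>f x - h x\<bar> \<partial>N)" by (rule integral_abs_bound)
      also have "\<dots> \<le> (\<integral>x. e + (2 * B + 1) * indicator (-K) x \<partial>N)"
      proof (rule integral_mono)
        show "integrable N (\<lambda>x. e + (2 * B + 1) * indicator (-K) x)" using ii by auto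
        show "integrable N (\<lambda>x. \<bar>f x - h x\<bar>)" using i by auto
        fix x
        show "\<bar>f x - h x\<bar> \<le> e + (2 * B + 1) * indicator (-K) x"
        proof (cases "x \<in> K")
          case True then show ?thesis using h(2)[of x] by simp
        next
          case False then show ?thesis using h(3)[of x] B(1)[of x] e by simp
        qed
      qed
      also have "\<dots> = e + (2 * B + 1) * measure N (-K)" using ii N.prob_space sp by simp
      also have "\<dots> \<le> e + (2 * B + 1) * d" using N(3) B by (intro add_left_mono mult_left_mono) auto
      also have "\<dots> = 2 * e" using B by (simp add: d_def)
      finally show ?thesis .
    qed
    have "eventually (\<lambda>n. dist (integral\<^sup>L (\<mu> n) h) (integral\<^sup>L \<nu> h) < e) sequentially"
      using conv[OF h(1)] e(1) by (auto simp: tendsto_iff)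
    with K(3) show "eventually (\<lambda>n. dist (integral\<^sup>L (\<mu> n) f) (integral\<^sup>L \<nu> f) < r) sequentially"
    proof eventually_elim
      case (elim n)
      have "\<bar>integral\<^sup>L (\<mu> n) f - integral\<^sup>L (\<mu> n) h\<bar> \<le> 2 * e" "\<bar>integral\<^sup>L \<nu> f - integral\<^sup>L \<nu> h\<bar> \<le> 2 * e"
        using key elim K prob sets by auto
      then show ?case using elim(2) e r unfolding dist_real_def by linarith
    qed
  qed
qed

section \<open>Tightness from continuous cutoffs\<close>

text \<open>For \<open>T \<ge> 0\<close> a continuous trapezoid, equal to 1 up to absolute value
  \<open>T\<close> and to 0 from \<open>T + 1\<close> on. Tails are thereby measured with functions
  that weak convergence can test.\<close>

definition cutoff :: "real \<Rightarrow> real \<Rightarrow> real" where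
  "cutoff T u = max 0 (min 1 (T + 1 - \<bar>u\<bar>))"

lemma cutoff_abs: "\<bar>cutoff T u\<bar> \<le> 1"
  by (auto simp: cutoff_def)

lemma continuous_on_cutoff [continuous_intros]:
  "continuous_on S f \<Longrightarrow> continuous_on S (\<lambda>x. cutoff T (f x))"
  unfolding cutoff_def by (intro continuous_intros)

lemma bounded_cutoff: "bounded (range (\<lambda>x. cutoff T (f x)))"
  unfolding bounded_iff using cutoff_abs[of T] by (intro exI[of _ 1]) auto

text \<open>The indicator of the tail beyond \<open>T + 1\<close> lies below
  \<open>1 - cutoff T\<close>. The integral of the latter is small under the limit for large
  \<open>T\<close>, and convergence of the integrals passes this on to the sequence.
  \<open>N\<close> will be a coordinate or the norm.\<close>

lemma eventually_small_tail:
  fixes N :: "'a::euclidean_space \<Rightarrow> real"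
  assumes prob: "\<And>n. prob_space (\<mu> n)" "prob_space \<nu>"
    and sets: "\<And>n. sets (\<mu> n) = sets borel" "sets \<nu> = sets borel"
    and N: "continuous_on UNIV N"
    and conv: "\<And>T::nat. (\<lambda>n. \<integral>x. cutoff T (N x) \<partial>\<mu> n) \<longlonglongrightarrow> (\<integral>x. cutoff T (N x) \<partial>\<nu>)"
    and e: "0 < e"
  shows "\<exists>T. measure \<nu> {x. T < \<bar>N x\<bar>} \<le> e \<and> eventually (\<lambda>n. measure (\<mu> n) {x. T < \<bar>N x\<bar>} \<le> e) sequentially"
proof -
  interpret v: prob_space \<nu> by fact
  have Nm: "N \<in> borel_measurable borel" using N by (rule borel_measurable_continuous_onI)
  have "(\<lambda>T::nat. \<integral>x. cutoff T (N x) \<partial>\<nu>) \<longlonglongrightarrow> (\<integral>x. 1 \<partial>\<nu>)"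
  proof (rule integral_dominated_convergence[where w = "\<lambda>_. 1"])
    show "AE x in \<nu>. (\<lambda>T::nat. cutoff T (N x)) \<longlonglongrightarrow> 1"
    proof (rule AE_I2)
      fix x
      obtain k :: nat where "\<bar>N x\<bar> \<le> k" using real_arch_simple by blast
      have "eventually (\<lambda>T::nat. cutoff T (N x) = 1) sequentially"
        using eventually_ge_at_top[of k] by eventually_elim (use \<open>\<bar>N x\<bar> \<le> k\<close> in \<open>auto simp: cutoff_def\<close>)
      then show "(\<lambda>T::nat. cutoff T (N x)) \<longlonglongrightarrow> 1" by (rule tendsto_eventually)
    qed
    show "(\<lambda>x. cutoff (real T) (N x)) \<in> borel_measurable \<nu>" for T
      by (intro borel_measurable_continuous_cong sets continuous_on_cutoff N)
    show "AE x in \<nu>. norm (cutoff (real T) (N x)) \<le> 1" for T using cutoff_abs by simp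
  qed auto
  then have "eventually (\<lambda>T::nat. (\<integral>x. cutoff T (N x) \<partial>\<nu>) > 1 - e) sequentially"
    using e by (intro order_tendstoD) (auto simp: v.prob_space)
  then obtain T :: nat where T: "(\<integral>x. cutoff T (N x) \<partial>\<nu>) > 1 - e" by (meson eventually_happens' sequentially_bot)
  have key: "measure M {x. T + 1 < \<bar>N x\<bar>} \<le> 1 - (\<integral>x. cutoff T (N x) \<partial>M)"
    if M: "prob_space M" "sets M = sets borel" for M
  proof -
    interpret M: prob_space M by fact
    have sp: "space M = UNIV" using sets_eq_imp_space_eq[OF M(2)] by simp
    have i: "integrable M (\<lambda>x. cutoff T (N x))"
      by (intro integrable_bounded_continuous M continuous_intros N bounded_cutoff)
    have S: "{x. T + 1 < \<bar>N x\<bar>} \<in> sets M" using Nm unfolding M(2) by measurable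
    have "measure M {x. T + 1 < \<bar>N x\<bar>} = (\<integral>x. indicator {x. T + 1 < \<bar>N x\<bar>} x \<partial>M)" using S by simp
    also have "\<dots> \<le> (\<integral>x. 1 - cutoff T (N x) \<partial>M)"
    proof (rule integral_mono)
      show "integrable M (indicator {x. T + 1 < \<bar>N x\<bar>} :: 'a \<Rightarrow> real)" using S by (simp add: M.emeasure_finite less_top[symmetric])
    qed (use i in \<open>auto simp: cutoff_def indicator_def\<close>)
    also have "\<dots> = 1 - (\<integral>x. cutoff T (N x) \<partial>M)" using i M.prob_space sp by simp
    finally show ?thesis .
  qed
  have "eventually (\<lambda>n. (\<integral>x. cutoff T (N x) \<partial>\<mu> n) > 1 - e) sequentially"
    using conv[of T] T by (rule order_tendstoD)
  then have "eventually (\<lambda>n. measure (\<mu> n) {x. T + 1 < \<bar>N x\<bar>} \<le> e) sequentially"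
  proof eventually_elim
    case (elim n) then show ?case using key[OF prob(1) sets(1), of n] by linarith
  qed
  moreover have "measure \<nu> {x. T + 1 < \<bar>N x\<bar>} \<le> e" using key[OF prob(2) sets(2)] T by linarith
  ultimately show ?thesis by (intro exI[of _ "real (T + 1)"] conjI)
qed

section \<open>Classes of test functions that determine weak convergence\<close>

inductive_set lin_hull :: "('a \<Rightarrow> real) set \<Rightarrow> ('a \<Rightarrow> real) set" for G where
  base: "g \<in> G \<Longrightarrow> (\<lambda>x. c * g x) \<in> lin_hull G"
| add: "f \<in> lin_hull G \<Longrightarrow> g \<in> lin_hull G \<Longrightarrow> (\<lambda>x. f x + g x) \<in> lin_hull G"

lemma lin_hull_incl: "g \<in> G \<Longrightarrow> g \<in> lin_hull G"
  using lin_hull.base[of g G 1] by simp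

lemma lin_hull_mult_const: "f \<in> lin_hull G \<Longrightarrow> (\<lambda>x. c * f x) \<in> lin_hull G"
proof (induction rule: lin_hull.induct)
  case (base g b) then show ?case using lin_hull.base[of g G "c * b"] by (simp add: mult.assoc)
next
  case (add f g) then show ?case using lin_hull.add[OF add.IH] by (simp add: distrib_left)
qed

text \<open>By bilinearity, closure under products needs checking on generators only; a product of
  generators may itself be a linear combination, as it is for cosines.\<close>

lemma lin_hull_mult:
  assumes G: "\<And>f g. f \<in> G \<Longrightarrow> g \<in> G \<Longrightarrow> (\<lambda>x. f x * g x) \<in> lin_hull G"
    and "f \<in> lin_hull G" "g \<in> lin_hull G"
  shows "(\<lambda>x. f x * g x) \<in> lin_hull G"
  using assms(2)
proof (induction rule: lin_hull.induct)
  case (base f c)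
  from assms(3) have "(\<lambda>x. f x * g x) \<in> lin_hull G"
  proof (induction rule: lin_hull.induct)
    case (base g b)
    then show ?case using lin_hull_mult_const[OF G[OF \<open>f \<in> G\<close> base], of b] by (simp add: mult.left_commute)
  next
    case (add h g) then show ?case using lin_hull.add[OF add.IH] by (simp add: distrib_left)
  qed
  then show ?case using lin_hull_mult_const[of "\<lambda>x. f x * g x" G c] by (simp add: mult.assoc)
next
  case (add f h) then show ?case using lin_hull.add[OF add.IH] by (simp add: distrib_right)
qed

lemma weak_conv_of_generators:
  fixes G :: "('a::euclidean_space \<Rightarrow> real) set"
  assumes mult: "\<And>f g. f \<in> G \<Longrightarrow> g \<in> G \<Longrightarrow> (\<lambda>x. f x * g x) \<in> lin_hull G"
    and one: "(\<lambda>x. 1) \<in> G"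
    and sep: "\<And>x y. x \<noteq> y \<Longrightarrow> \<exists>g\<in>G. g x \<noteq> g y"
    and cont: "\<And>g. g \<in> G \<Longrightarrow> continuous_on UNIV g"
    and bdd: "\<And>g. g \<in> G \<Longrightarrow> bounded (range g)"
    and prob: "\<And>n. prob_space (\<mu> n)" "prob_space \<nu>"
    and sets: "\<And>n. sets (\<mu> n) = sets borel" "sets \<nu> = sets borel"
    and tight: "\<And>e. 0 < e \<Longrightarrow> \<exists>K. compact K \<and> measure \<nu> (-K) \<le> e \<and> eventually (\<lambda>n. measure (\<mu> n) (-K) \<le> e) sequentially"
    and conv: "\<And>g. g \<in> G \<Longrightarrow> (\<lambda>n. integral\<^sup>L (\<mu> n) g) \<longlonglongrightarrow> integral\<^sup>L \<nu> g"
  shows "weak_conv \<mu> \<nu>"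
proof (rule weak_conv_of_algebra[where A = "lin_hull G"])
  have cb: "continuous_on UNIV g \<and> bounded (range g)" if "g \<in> lin_hull G" for g
    using that
  proof (induction rule: lin_hull.induct)
    case (base g c)
    obtain B where B: "\<And>x. norm (g x) \<le> B" using bdd[OF base] by (auto simp: bounded_iff)
    have "bounded (range (\<lambda>x. c * g x))" unfolding bounded_iff
      by (rule exI[of _ "\<bar>c\<bar> * B"]) (use B in \<open>auto simp: abs_mult intro!: mult_left_mono\<close>)
    then show ?case using cont[OF base] by (auto intro!: continuous_intros)
  next
    case (add f g)
    obtain B where B: "\<And>x. norm (g x) \<le> B" using add by (auto simp: bounded_iff)
    obtain C where C: "\<And>x. norm (f x) \<le> C" using add by (auto simp: bounded_iff)
    have "norm (f x + g x) \<le> C + B" for x using B[of x] C[of x] by (intro norm_triangle_mono)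
    then have "bounded (range (\<lambda>x. f x + g x))" unfolding bounded_iff by blast
    then show ?case using add by (auto intro!: continuous_intros)
  qed
  show "continuous_on UNIV g" "bounded (range g)" if "g \<in> lin_hull G" for g using cb[OF that] by auto
  show "(\<lambda>n. integral\<^sup>L (\<mu> n) g) \<longlonglongrightarrow> integral\<^sup>L \<nu> g" if "g \<in> lin_hull G" for g
    using that
  proof (induction rule: lin_hull.induct)
    case (base g c) then show ?case using conv[OF base] by (auto intro!: tendsto_intros)
  next
    case (add f g)
    have "integral\<^sup>L M (\<lambda>x. f x + g x) = integral\<^sup>L M f + integral\<^sup>L M g" if "prob_space M" "sets M = sets borel" for M
      by (rule Bochner_Integration.integral_add) (use integrable_bounded_continuous[OF that] cb add in auto)
    then show ?case using tendsto_add[OF add.IH] prob sets by auto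
  qed
  show "(\<lambda>x. c) \<in> lin_hull G" for c using lin_hull.base[OF one, of c] by simp
  show "\<exists>g\<in>lin_hull G. g x \<noteq> g y" if "x \<noteq> y" for x y using sep[OF that] lin_hull_incl by blast
  show "(\<lambda>x. f x + g x) \<in> lin_hull G" if "f \<in> lin_hull G" "g \<in> lin_hull G" for f g
    using lin_hull.add[OF that] .
  show "(\<lambda>x. f x * g x) \<in> lin_hull G" if "f \<in> lin_hull G" "g \<in> lin_hull G" for f g
    using lin_hull_mult[of G f g] mult that by blast
  show "prob_space (\<mu> n)" "sets (\<mu> n) = sets borel" for n using prob sets by auto
  show "\<exists>K. compact K \<and> measure \<nu> (- K) \<le> e \<and> (\<forall>\<^sub>F n in sequentially. measure (\<mu> n) (- K) \<le> e)" if "0 < e" for e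
    using tight[OF that] .
  show "prob_space \<nu>" "sets \<nu> = sets borel" using prob sets by auto
qed

text \<open>The generators are cosines with an arbitrary phase: the phase covers sines and makes
  products linear combinations of generators. Tightness comes from the one-dimensional continuity
  theorem applied to each coordinate.\<close>

lemma weak_conv_of_char:
  fixes \<mu> :: "nat \<Rightarrow> 'a::euclidean_space measure"
  assumes prob: "\<And>n. prob_space (\<mu> n)" "prob_space \<nu>"
    and sets: "\<And>n. sets (\<mu> n) = sets borel" "sets \<nu> = sets borel"
    and conv: "\<And>t. (\<lambda>n. \<integral>x. iexp (t \<bullet> x) \<partial>\<mu> n) \<longlonglongrightarrow> (\<integral>x. iexp (t \<bullet> x) \<partial>\<nu>)"
  shows "weak_conv \<mu> \<nu>"
proof (rule weak_conv_of_generators)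
  let ?G = "{\<lambda>x::'a. cos (t \<bullet> x + b) | t b. True}"
  show "(\<lambda>x. 1) \<in> ?G" by (auto intro!: exI[of _ 0])
  show "(\<lambda>x. f x * g x) \<in> lin_hull ?G" if fgG: "f \<in> ?G" "g \<in> ?G" for f g
  proof -
    obtain t b s c where fg: "f = (\<lambda>x. cos (t \<bullet> x + b))" "g = (\<lambda>x. cos (s \<bullet> x + c))"
      using fgG by auto
    have "(\<lambda>x. f x * g x) = (\<lambda>x. 1/2 * cos ((t - s) \<bullet> x + (b - c)) + 1/2 * cos ((t + s) \<bullet> x + (b + c)))"
      unfolding fg by (intro ext) (simp add: cos_times_cos inner_diff_left inner_add_left algebra_simps add_divide_distrib)
    also have "\<dots> \<in> lin_hull ?G" by (intro lin_hull.add lin_hull.base) auto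
    finally show ?thesis .
  qed
  show "\<exists>g\<in>?G. g x \<noteq> g y" if "x \<noteq> y" for x y
  proof -
    \<comment> \<open>Normalised so that \<open>t \<bullet> (x - y) = 1\<close>; with the phase
      chosen below, the two points get the values \<open>cos 1\<close> and
      \<open>cos 0\<close>.\<close>
    define t where "t = (1 / (norm (x - y))\<^sup>2) *\<^sub>R (x - y)"
    have "t \<bullet> x - t \<bullet> y = 1" using that 
      by (simp add: t_def power2_norm_eq_inner inner_diff_right[symmetric] diff_divide_distrib[symmetric])
    then have "cos (t \<bullet> x + (- (t \<bullet> y))) \<noteq> cos (t \<bullet> y + (- (t \<bullet> y)))"
      using cos_monotone_0_pi[of 0 1] pi_gt3 by simp
    moreover have "(\<lambda>x. cos (t \<bullet> x + (- (t \<bullet> y)))) \<in> ?G"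
      by (intro CollectI exI[of _ t] exI[of _ "- (t \<bullet> y)"] conjI refl TrueI)
    ultimately show ?thesis by (rule bexI)
  qed
  have G: "\<exists>t b. g = (\<lambda>x. cos (t \<bullet> x + b))" if "g \<in> ?G" for g using that by simp
  show "continuous_on UNIV g" if "g \<in> ?G" for g
    using G[OF that] by (elim exE) (simp, intro continuous_intros)
  show "bounded (range g)" if "g \<in> ?G" for g
    using G[OF that] unfolding bounded_iff by (elim exE, intro exI[of _ 1]) simp
  show "(\<lambda>n. integral\<^sup>L (\<mu> n) g) \<longlonglongrightarrow> integral\<^sup>L \<nu> g" if gG: "g \<in> ?G" for g
  proof -
    obtain t b where g: "g = (\<lambda>x. cos (t \<bullet> x + b))" using G[OF gG] by auto
    have "integral\<^sup>L M g = Re (iexp b * (\<integral>x. iexp (t \<bullet> x) \<partial>M))" if M: "prob_space M" "sets M = sets borel" for M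
    proof -
      interpret M: prob_space M by fact
      have i: "integrable M (\<lambda>x. iexp (t \<bullet> x))"
        by (rule M.integrable_iexp) (auto intro!: borel_measurable_continuous_cong M continuous_intros)
      have "Re (iexp b * (\<integral>x. iexp (t \<bullet> x) \<partial>M)) = (\<integral>x. Re (iexp b * iexp (t \<bullet> x)) \<partial>M)"
        using i by (subst integral_Re) auto
      also have "\<dots> = integral\<^sup>L M g" unfolding g
        by (intro Bochner_Integration.integral_cong) (auto simp: exp_add[symmetric] Re_exp distrib_left[symmetric] add.commute simp flip: of_real_add)
      finally show ?thesis ..
    qed
    then show ?thesis using prob sets by (auto intro!: tendsto_intros conv)
  qed
  fix e :: real assume e: "0 < e"
  \<comment> \<open>The complement of the box \<open>K\<close> is covered by one coordinate tail per
    basis vector.\<close>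
  define d where "d = e / DIM('a)"
  have d: "d > 0" using e by (auto simp: d_def)
  have "\<exists>T. measure \<nu> {x. T < \<bar>x \<bullet> b\<bar>} \<le> d \<and> eventually (\<lambda>n. measure (\<mu> n) {x. T < \<bar>x \<bullet> b\<bar>} \<le> d) sequentially" for b :: 'a
  proof (rule eventually_small_tail)
    fix T :: nat
    let ?m = "\<lambda>M. distr M borel (\<lambda>x. x \<bullet> b)"
    have meas: "(\<lambda>x. x \<bullet> b) \<in> borel_measurable M" if "sets M = sets borel" for M
      by (intro borel_measurable_continuous_cong that continuous_intros)
    have rd: "real_distribution (?m M)" if "prob_space M" "sets M = sets borel" for M
      using prob_space.prob_space_distr[OF that(1) meas[OF that(2)]] by (auto simp: real_distribution_def real_distribution_axioms_def)
    have ch: "char (?m M) s = (\<integral>x. iexp ((s *\<^sub>R b) \<bullet> x) \<partial>M)" if "prob_space M" "sets M = sets borel" for M s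
      unfolding char_def by (subst integral_distr[OF meas[OF that(2)]])
        (auto intro!: borel_measurable_continuous_onI continuous_intros Bochner_Integration.integral_cong simp: inner_commute)
    have wc: "weak_conv_m (\<lambda>n. ?m (\<mu> n)) (?m \<nu>)"
    proof (rule levy_continuity)
      show "(\<lambda>n. char (?m (\<mu> n)) s) \<longlonglongrightarrow> char (?m \<nu>) s" for s
        using conv[of "s *\<^sub>R b"] unfolding ch[OF prob(1) sets(1)] ch[OF prob(2) sets(2)] .
    qed (use rd prob sets in auto)
    have "(\<lambda>n. \<integral>u. cutoff T u \<partial>?m (\<mu> n)) \<longlonglongrightarrow> (\<integral>u. cutoff T u \<partial>?m \<nu>)"
    proof (rule weak_conv_imp_integral_bdd_continuous_conv[OF _ _ wc, where B = 1])
      show "isCont (cutoff (real T)) x" for x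
        using continuous_on_cutoff[OF continuous_on_id, of UNIV T] by (simp add: continuous_on_eq_continuous_at)
    qed (use rd prob sets cutoff_abs in auto)
    moreover have "(\<integral>u. cutoff T u \<partial>?m M) = (\<integral>x. cutoff T (x \<bullet> b) \<partial>M)" if "sets M = sets borel" for M
      by (intro integral_distr meas that borel_measurable_continuous_onI continuous_intros)
    ultimately show "(\<lambda>n. \<integral>x. cutoff T (x \<bullet> b) \<partial>\<mu> n) \<longlonglongrightarrow> (\<integral>x. cutoff T (x \<bullet> b) \<partial>\<nu>)"
      using sets by simp
  qed (use prob sets d in \<open>auto intro!: continuous_intros\<close>)
  then obtain T where T: "\<And>b. measure \<nu> {x. T b < \<bar>x \<bullet> b\<bar>} \<le> d"
      "\<And>b. eventually (\<lambda>n. measure (\<mu> n) {x. T b < \<bar>x \<bullet> b\<bar>} \<le> d) sequentially"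
    by metis
  define K where "K = cbox (- (\<Sum>b\<in>Basis. T b *\<^sub>R b)) (\<Sum>b\<in>Basis. T b *\<^sub>R b)"
  have cK: "compact K" by (simp add: K_def)
  have key: "measure M (-K) \<le> e" if M: "prob_space M" "sets M = sets borel" "\<And>b. b \<in> Basis \<Longrightarrow> measure M {x. T b < \<bar>x \<bullet> b\<bar>} \<le> d" for M
  proof -
    interpret M: prob_space M by fact
    have s: "{x. T b < \<bar>x \<bullet> b\<bar>} \<in> sets M" for b unfolding M(2) by measurable
    have "-K = (\<Union>b\<in>Basis. {x. T b < \<bar>x \<bullet> b\<bar>})"
    proof -
      have "x \<in> K \<longleftrightarrow> (\<forall>b\<in>Basis. \<bar>x \<bullet> b\<bar> \<le> T b)" for x
        by (simp add: K_def mem_box abs_le_iff minus_le_iff) blast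
      then show ?thesis by (intro set_eqI) (simp add: not_le)
    qed
    then have "measure M (-K) \<le> (\<Sum>b\<in>Basis. measure M {x. T b < \<bar>x \<bullet> b\<bar>})"
      using s by (auto intro!: M.finite_measure_subadditive_finite)
    also have "\<dots> \<le> (\<Sum>b\<in>(Basis::'a set). d)" by (intro sum_mono M)
    also have "\<dots> = e" by (simp add: d_def)
    finally show ?thesis .
  qed
  have "eventually (\<lambda>n. \<forall>b\<in>Basis. measure (\<mu> n) {x. T b < \<bar>x \<bullet> b\<bar>} \<le> d) sequentially"
    using T(2) by (auto intro!: eventually_ball_finite)
  then have "eventually (\<lambda>n. measure (\<mu> n) (-K) \<le> e) sequentially"
    by eventually_elim (use key prob sets in auto)
  then show "\<exists>K. compact K \<and> measure \<nu> (-K) \<le> e \<and> eventually (\<lambda>n. measure (\<mu> n) (-K) \<le> e) sequentially"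
    using cK key[OF prob(2) sets(2)] T by blast
qed (use assms in auto)

text \<open>Monomials in bounded injective functions of the coordinates form a countable class,
  indexed by lists over the finite basis. It is closed under products by appending lists, and it
  separates points.\<close>

lemma countable_weak_conv_determining:
  "\<exists>f :: nat \<Rightarrow> 'a::euclidean_space \<Rightarrow> real.
     (\<forall>k. continuous_on UNIV (f k) \<and> (\<forall>x. \<bar>f k x\<bar> \<le> 1)) \<and>
     (\<forall>\<mu> \<nu>. (\<forall>n. prob_space (\<mu> n) \<and> sets (\<mu> n) = sets borel) \<longrightarrow> prob_space \<nu> \<longrightarrow> sets \<nu> = sets borel \<longrightarrow>
        (\<forall>k. (\<lambda>n. integral\<^sup>L (\<mu> n) (f k)) \<longlonglongrightarrow> integral\<^sup>L \<nu> (f k)) \<longrightarrow> weak_conv \<mu> \<nu>)"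
proof -
  \<comment> \<open>Half of arctan stays below \<open>pi / 4\<close> in absolute value, hence below
    1.\<close>
  define \<phi> :: "real \<Rightarrow> real" where "\<phi> u = arctan u / 2" for u
  have \<phi>_cont: "continuous_on UNIV (\<lambda>x::'a. \<phi> (x \<bullet> b))" for b
    unfolding \<phi>_def by (intro continuous_intros) auto
  have \<phi>_bd: "\<bar>\<phi> u\<bar> \<le> 1" for u
    using arctan_bounded[of u] pi_less_4 by (auto simp: \<phi>_def)
  have \<phi>_inj: "u = v" if "\<phi> u = \<phi> v" for u v
    using that by (simp add: \<phi>_def arctan_eq_iff)
  define m :: "'a list \<Rightarrow> 'a \<Rightarrow> real" where "m bs x = prod_list (map (\<lambda>b. \<phi> (x \<bullet> b)) bs)" for bs x
  have m_cont: "continuous_on UNIV (m bs)" for bs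
    by (induction bs) (auto simp: m_def[abs_def] intro!: continuous_intros \<phi>_cont)
  have m_bd: "\<bar>m bs x\<bar> \<le> 1" for bs x
    by (induction bs) (auto simp: m_def abs_mult intro!: mult_le_one \<phi>_bd)
  \<comment> \<open>The cutoffs of the norm do not serve the algebra; they are tested in addition so
    that tightness can be read off.\<close>
  define F where "F = m ` lists Basis \<union> range (\<lambda>T::nat. \<lambda>x::'a. cutoff T (norm x))"
  have "countable F" unfolding F_def by (intro countable_Un countable_image countable_lists) (auto intro: countable_finite)
  moreover have "F \<noteq> {}" by (auto simp: F_def)
  ultimately obtain f where f: "range (f :: nat \<Rightarrow> 'a \<Rightarrow> real) = F" by (metis range_from_nat_into)
  have fF: "f k \<in> F" for k using f by auto
  show ?thesis
  proof (intro exI[of _ f] conjI allI impI)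
    fix k
    show "continuous_on UNIV (f k)" using fF[of k] by (auto simp: F_def intro!: m_cont continuous_intros)
    show "\<bar>f k x\<bar> \<le> 1" for x using fF[of k] m_bd cutoff_abs by (auto simp: F_def)
  next
    fix \<mu> \<nu>
    assume mu: "\<forall>n. prob_space (\<mu> n) \<and> sets (\<mu> n) = sets borel" and nu: "prob_space \<nu>" "sets \<nu> = sets borel"
      and c: "\<forall>k. (\<lambda>n. integral\<^sup>L (\<mu> n) (f k)) \<longlonglongrightarrow> integral\<^sup>L \<nu> (f k)"
    have conv: "(\<lambda>n. integral\<^sup>L (\<mu> n) g) \<longlonglongrightarrow> integral\<^sup>L \<nu> g" if "g \<in> F" for g
      using that c unfolding f[symmetric] by auto
    show "weak_conv \<mu> \<nu>"
    proof (rule weak_conv_of_generators[where G = "m ` lists Basis"])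
      show "(\<lambda>x. f x * g x) \<in> lin_hull (m ` lists Basis)" if "f \<in> m ` lists Basis" "g \<in> m ` lists Basis" for f g
      proof -
        obtain a b where "a \<in> lists Basis" "b \<in> lists Basis" and fg: "f = m a" "g = m b" using \<open>f \<in> _\<close> \<open>g \<in> _\<close> by blast
        moreover have "(\<lambda>x. f x * g x) = m (a @ b)" by (auto simp: fg m_def)
        moreover have "a @ b \<in> lists Basis" using calculation by auto
        ultimately show ?thesis using lin_hull_incl[of "m (a @ b)" "m ` lists Basis"] by auto
      qed
      show "(\<lambda>x. 1) \<in> m ` lists Basis" by (rule image_eqI[of _ _ "[]"]) (auto simp: m_def)
      show "\<exists>g\<in>m ` lists Basis. g x \<noteq> g y" if xy: "x \<noteq> y" for x y
      proof -
        obtain b where "b \<in> Basis" "x \<bullet> b \<noteq> y \<bullet> b" using xy euclidean_eqI[of x y] by blast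
        then show ?thesis using \<phi>_inj[of "x \<bullet> b" "y \<bullet> b"] by (intro bexI[of _ "m [b]"]) (auto simp: m_def)
      qed
      show "continuous_on UNIV g" if "g \<in> m ` lists Basis" for g using that by (auto intro: m_cont)
      show "bounded (range g)" if "g \<in> m ` lists Basis" for g using that m_bd by (auto simp: bounded_iff intro!: exI[of _ 1])
      show "(\<lambda>n. integral\<^sup>L (\<mu> n) g) \<longlonglongrightarrow> integral\<^sup>L \<nu> g" if "g \<in> m ` lists Basis" for g
        using conv[of g] that by (auto simp: F_def)
      fix e :: real assume e: "0 < e"
      have "\<exists>T. measure \<nu> {x::'a. T < \<bar>norm x\<bar>} \<le> e \<and> eventually (\<lambda>n. measure (\<mu> n) {x. T < \<bar>norm x\<bar>} \<le> e) sequentially"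
        by (rule eventually_small_tail) (use mu nu e in \<open>auto simp: F_def intro!: conv continuous_intros\<close>)
      then obtain T where T: "measure \<nu> {x::'a. T < \<bar>norm x\<bar>} \<le> e" "eventually (\<lambda>n. measure (\<mu> n) {x. T < \<bar>norm x\<bar>} \<le> e) sequentially"
        by blast
      have "{x::'a. T < \<bar>norm x\<bar>} = - cball 0 T" by auto
      then show "\<exists>K. compact K \<and> measure \<nu> (-K) \<le> e \<and> eventually (\<lambda>n. measure (\<mu> n) (-K) \<le> e) sequentially"
        using T by (intro exI[of _ "cball 0 T"]) auto
    qed (use mu nu in auto)
  qed
qed

section \<open>A normal approximation for sums of locally dependent terms\<close>

text \<open>A pointwise condition without sigma-algebras; on product measures, independence then
  follows from Fubini.\<close>

definition depends_on :: "'i set \<Rightarrow> (('i \<Rightarrow> 'a) \<Rightarrow> 'b) \<Rightarrow> bool" where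
  "depends_on S F \<longleftrightarrow> (\<forall>x y. (\<forall>i\<in>S. x i = y i) \<longrightarrow> F x = F y)"

lemma depends_onD: "depends_on S F \<Longrightarrow> (\<And>i. i \<in> S \<Longrightarrow> x i = y i) \<Longrightarrow> F x = F y"
  by (auto simp: depends_on_def)

lemma depends_on_mono: "depends_on S F \<Longrightarrow> S \<subseteq> T \<Longrightarrow> depends_on T F"
  unfolding depends_on_def by blast

lemma depends_on_comp2:
  fixes F :: "('i \<Rightarrow> 'a) \<Rightarrow> 'b" and G :: "('i \<Rightarrow> 'a) \<Rightarrow> 'c"
  assumes "depends_on S F" "depends_on S G"
  shows "depends_on S (\<lambda>x. h (F x) (G x))"
  unfolding depends_on_def
proof (intro allI impI)
  fix x y :: "'i \<Rightarrow> 'a" assume *: "\<forall>i\<in>S. x i = y i"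
  then have "F x = F y" "G x = G y" using assms unfolding depends_on_def by blast+
  then show "h (F x) (G x) = h (F y) (G y)" by simp
qed

lemma depends_on_comp: "depends_on S F \<Longrightarrow> depends_on S (\<lambda>x. h (F x))"
  using depends_on_comp2[of S F F "\<lambda>a b. h a"] .

lemma depends_on_sum:
  fixes F :: "'v \<Rightarrow> ('i \<Rightarrow> 'a) \<Rightarrow> 'b::comm_monoid_add"
  assumes "\<And>u. u \<in> U \<Longrightarrow> depends_on (s u) (F u)"
  shows "depends_on (\<Union>u\<in>U. s u) (\<lambda>x. \<Sum>u\<in>U. F u x)"
  unfolding depends_on_def
proof (intro allI impI sum.cong refl)
  fix x y :: "'i \<Rightarrow> 'a" and u assume "\<forall>i\<in>\<Union> (s ` U). x i = y i" "u \<in> U"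
  then show "F u x = F u y" using assms[of u] unfolding depends_on_def by blast
qed

lemma (in prob_space) integrable_bounded:
  fixes f :: "_ \<Rightarrow> 'b::{banach,second_countable_topology}"
  assumes "f \<in> borel_measurable M" "\<And>x. norm (f x) \<le> B"
  shows "integrable M f"
  using assms by (intro integrable_const_bound[of _ B]) auto

lemma (in prob_space) norm_integral_le_bound:
  fixes f :: "_ \<Rightarrow> 'b::{banach,second_countable_topology}"
  assumes "f \<in> borel_measurable M" "\<And>x. norm (f x) \<le> B"
  shows "norm (integral\<^sup>L M f) \<le> B"
proof -
  have i: "integrable M f" using assms by (rule integrable_bounded)
  have "norm (integral\<^sup>L M f) \<le> (\<integral>x. norm (f x) \<partial>M)" by (rule integral_norm_bound)
  also have "\<dots> \<le> (\<integral>x. B \<partial>M)" using i assms by (intro integral_mono) auto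
  finally show ?thesis by (simp add: prob_space)
qed

lemma product_prob_space_const: "prob_space P \<Longrightarrow> product_prob_space (\<lambda>_. P)"
  by (rule product_prob_spaceI)

lemma PiM_integral_marginal:
  fixes F :: "('i \<Rightarrow> 'a) \<Rightarrow> 'b::{banach,second_countable_topology}"
  assumes P: "prob_space P" and I: "finite I" "S \<subseteq> I"
    and F: "integrable (PiM I (\<lambda>_. P)) F" "depends_on S F"
  shows "integral\<^sup>L (PiM I (\<lambda>_. P)) F = integral\<^sup>L (PiM S (\<lambda>_. P)) F"
proof -
  interpret pp: product_prob_space "\<lambda>_::'i. P" by (rule product_prob_space_const[OF P])
  have I': "I = S \<union> (I - S)" using I by auto
  have fin: "finite S" "finite (I - S)" using I by (auto intro: finite_subset)
  have "integral\<^sup>L (PiM I (\<lambda>_. P)) F = (\<integral>x. (\<integral>y. F (merge S (I - S) (x, y)) \<partial>PiM (I - S) (\<lambda>_. P)) \<partial>PiM S (\<lambda>_. P))"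
    using pp.product_integral_fold[of S "I - S" F] I' fin F(1) by auto
  also have "\<dots> = (\<integral>x. (\<integral>y. F x \<partial>PiM (I - S) (\<lambda>_. P)) \<partial>PiM S (\<lambda>_. P))"
    by (intro Bochner_Integration.integral_cong refl depends_onD[OF F(2)]) auto
  also have "\<dots> = integral\<^sup>L (PiM S (\<lambda>_. P)) F"
    using prob_space.prob_space[OF prob_space_PiM, of "I - S" "\<lambda>_. P"] P by simp
  finally show ?thesis .
qed

text \<open>After splitting off the coordinates in \<open>S\<close>, the factor \<open>F\<close>
  sees only the outer variables and \<open>G\<close> only the inner ones, so the iterated integral
  factors. The complex case is needed for characteristic functions.\<close>

lemma PiM_integral_mult_indep:
  fixes F G :: "('i \<Rightarrow> 'a) \<Rightarrow> 'b::{real_normed_field,banach,second_countable_topology}"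
  assumes P: "prob_space P" and I: "finite I" "S \<subseteq> I" "T \<subseteq> I" "S \<inter> T = {}"
    and F: "integrable (PiM I (\<lambda>_. P)) F" "depends_on S F"
    and G: "integrable (PiM I (\<lambda>_. P)) G" "depends_on T G"
    and FG: "integrable (PiM I (\<lambda>_. P)) (\<lambda>x. F x * G x)"
  shows "(\<integral>x. F x * G x \<partial>PiM I (\<lambda>_. P)) = integral\<^sup>L (PiM I (\<lambda>_. P)) F * integral\<^sup>L (PiM I (\<lambda>_. P)) G"
proof -
  interpret pp: product_prob_space "\<lambda>_::'i. P" by (rule product_prob_space_const[OF P])
  have I': "I = S \<union> (I - S)" using I by auto
  have fin: "finite S" "finite (I - S)" using I by (auto intro: finite_subset)
  have T: "T \<subseteq> I - S" using I by auto
  have "(\<integral>x. F x * G x \<partial>PiM I (\<lambda>_. P)) =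
      (\<integral>x. (\<integral>y. F (merge S (I - S) (x, y)) * G (merge S (I - S) (x, y)) \<partial>PiM (I - S) (\<lambda>_. P)) \<partial>PiM S (\<lambda>_. P))"
    using pp.product_integral_fold[of S "I - S" "\<lambda>x. F x * G x"] I' fin FG by auto
  also have "\<dots> = (\<integral>x. (\<integral>y. F x * G y \<partial>PiM (I - S) (\<lambda>_. P)) \<partial>PiM S (\<lambda>_. P))"
    using T by (intro Bochner_Integration.integral_cong refl arg_cong2[where f = "(*)"] depends_onD[OF F(2)] depends_onD[OF G(2)]) (auto simp: merge_def)
  also have "\<dots> = integral\<^sup>L (PiM S (\<lambda>_. P)) F * integral\<^sup>L (PiM (I - S) (\<lambda>_. P)) G" by simp
  also have "integral\<^sup>L (PiM S (\<lambda>_. P)) F = integral\<^sup>L (PiM I (\<lambda>_. P)) F"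
    using PiM_integral_marginal[OF P I(1,2) F] ..
  also have "integral\<^sup>L (PiM (I - S) (\<lambda>_. P)) G = integral\<^sup>L (PiM I (\<lambda>_. P)) G"
    using PiM_integral_marginal[OF P I(1) _ G(1), of "I - S"] depends_on_mono[OF G(2) T] by auto
  finally show ?thesis .
qed

lemma PiM_integral_coord2:
  fixes f :: "'a \<Rightarrow> 'a \<Rightarrow> 'b::{banach,second_countable_topology}" and I :: "'i set"
  assumes P: "prob_space P" and I: "finite I" "b \<in> I" "c \<in> I" "b \<noteq> c"
    and f: "(\<lambda>(x, y). f x y) \<in> borel_measurable (P \<Otimes>\<^sub>M P)" "\<And>x y. norm (f x y) \<le> B"
  shows "(\<integral>x. f (x b) (x c) \<partial>PiM I (\<lambda>_. P)) = (\<integral>z. f (fst z) (snd z) \<partial>(P \<Otimes>\<^sub>M P))"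
proof -
  interpret P: prob_space P by fact
  interpret pp: product_prob_space "\<lambda>_::'i. P" by (rule product_prob_space_const[OF P])
  interpret PP: pair_prob_space P P ..
  have int: "integrable (PiM J (\<lambda>_. P)) (\<lambda>x. f (x b) (x c))" if "b \<in> J" "c \<in> J" for J
  proof (rule prob_space.integrable_bounded)
    show "prob_space (PiM J (\<lambda>_. P))" by (rule prob_space_PiM) (rule P)
    have "(\<lambda>x. (x b, x c)) \<in> measurable (PiM J (\<lambda>_. P)) (P \<Otimes>\<^sub>M P)" using that by measurable
    from measurable_compose[OF this f(1)] show "(\<lambda>x. f (x b) (x c)) \<in> borel_measurable (PiM J (\<lambda>_. P))" by simp
  qed (rule f)
  have "(\<integral>x. f (x b) (x c) \<partial>PiM I (\<lambda>_. P)) = (\<integral>x. f (x b) (x c) \<partial>PiM {b, c} (\<lambda>_. P))"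
    by (rule PiM_integral_marginal[OF P I(1)]) (use I int in \<open>auto simp: depends_on_def\<close>)
  also have "\<dots> = (\<integral>x. (\<integral>y. f ((x(b := y)) b) ((x(b := y)) c) \<partial>P) \<partial>PiM {c} (\<lambda>_. P))"
    using pp.product_integral_insert[of "{c}" b "\<lambda>x. f (x b) (x c)"] I int[of "{b, c}"] by simp
  also have "\<dots> = (\<integral>x. (\<lambda>z. \<integral>y. f y z \<partial>P) (x c) \<partial>PiM {c} (\<lambda>_. P))" using I by simp
  also have "\<dots> = (\<integral>z. \<integral>y. f y z \<partial>P \<partial>P)"
  proof (rule pp.product_integral_singleton)
    have "(\<lambda>(z, y). f y z) \<in> borel_measurable (P \<Otimes>\<^sub>M P)" using measurable_compose[OF measurable_pair_swap' f(1)] by (simp add: split_beta')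
    then show "(\<lambda>z. \<integral>y. f y z \<partial>P) \<in> borel_measurable P" by (rule P.borel_measurable_lebesgue_integral)
  qed
  also have "\<dots> = (\<integral>z. f (fst z) (snd z) \<partial>(P \<Otimes>\<^sub>M P))"
  proof -
    have "integrable (P \<Otimes>\<^sub>M P) (\<lambda>(x, y). f x y)" using f by (intro PP.integrable_bounded) auto
    from PP.integral_snd[OF this] show ?thesis by (simp add: split_beta')
  qed
  finally show ?thesis .
qed

text \<open>Coordinate \<open>c\<close> is integrated out first: neither \<open>F\<close> nor
  \<open>x b\<close> changes with it, so the inner integral carries the factor 0.\<close>

lemma PiM_integral_degenerate:
  fixes F :: "('i \<Rightarrow> 'a) \<Rightarrow> real"
  assumes P: "prob_space P" and I: "finite I" "c \<in> I" "b \<noteq> c" "depends_on (I - {c}) F"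
    and int: "integrable (PiM I (\<lambda>_. P)) (\<lambda>x. F x * h (x b) (x c))"
    and deg: "\<And>x. (\<integral>y. h x y \<partial>P) = 0"
  shows "(\<integral>x. F x * h (x b) (x c) \<partial>PiM I (\<lambda>_. P)) = 0"
proof -
  interpret pp: product_prob_space "\<lambda>_::'i. P" by (rule product_prob_space_const[OF P])
  have "(\<integral>x. F x * h (x b) (x c) \<partial>PiM I (\<lambda>_. P)) =
     (\<integral>x. (\<integral>y. F (x(c := y)) * h ((x(c := y)) b) ((x(c := y)) c) \<partial>P) \<partial>PiM (I - {c}) (\<lambda>_. P))"
    using pp.product_integral_insert[of "I - {c}" c "\<lambda>x. F x * h (x b) (x c)"] I int by (simp add: insert_absorb)
  also have "\<dots> = (\<integral>x. (\<integral>y. F x * h (x b) y \<partial>P) \<partial>PiM (I - {c}) (\<lambda>_. P))"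
    using I(3) by (intro Bochner_Integration.integral_cong refl arg_cong2[where f = "(*)"] depends_onD[OF I(4)]) auto
  finally show ?thesis by (simp add: deg)
qed

lemma norm_iexp_diff_le: "cmod (iexp a - iexp b) \<le> \<bar>a - b\<bar>"
proof -
  have "iexp a - iexp b = iexp b * (iexp (a - b) - 1)"
    by (simp add: algebra_simps exp_add[symmetric] flip: of_real_diff) (simp add: algebra_simps)
  then have "cmod (iexp a - iexp b) = cmod (iexp (a - b) - 1)" by (simp add: norm_mult)
  also have "\<dots> \<le> \<bar>a - b\<bar>" using iexp_approx1[of "a - b" 0] by simp
  finally show ?thesis .
qed

lemma norm_iexp_taylor_le: "cmod (iexp (a + b) - iexp a - \<i> * b * iexp a) \<le> b\<^sup>2 / 2"
proof -
  have "iexp (a + b) - iexp a - \<i> * b * iexp a = iexp a * (iexp b - (1 + \<i> * b))"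
    by (simp add: algebra_simps exp_add)
  then have "cmod (iexp (a + b) - iexp a - \<i> * b * iexp a) = cmod (iexp b - (1 + \<i> * b))" by (simp add: norm_mult)
  also have "\<dots> \<le> b\<^sup>2 / 2" using iexp_approx1[of b 1] by (simp add: power2_eq_square)
  finally show ?thesis .
qed

lemma has_vector_derivative_of_quadratic_bound:
  fixes f :: "real \<Rightarrow> 'a::real_normed_vector"
  assumes "\<And>y. norm (f y - f x - (y - x) *\<^sub>R f') \<le> K * (y - x)\<^sup>2"
  shows "(f has_vector_derivative f') (at x within S)"
  unfolding has_vector_derivative_def has_derivative_within_alt
proof (intro conjI allI impI)
  show "bounded_linear (\<lambda>h. h *\<^sub>R f')" by (rule bounded_linear_scaleR_left)
  fix e :: real assume e: "0 < e"
  show "\<exists>d>0. \<forall>y\<in>S. norm (y - x) < d \<longrightarrow> norm (f y - f x - (y - x) *\<^sub>R f') \<le> e * norm (y - x)"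
  proof (intro exI[of _ "e / (\<bar>K\<bar> + 1)"] conjI ballI impI)
    show "0 < e / (\<bar>K\<bar> + 1)" using e by simp
    fix y assume y: "norm (y - x) < e / (\<bar>K\<bar> + 1)"
    have "K * (y - x)\<^sup>2 \<le> (\<bar>K\<bar> + 1) * (y - x)\<^sup>2" by (intro mult_right_mono) auto
    also have "\<dots> = ((\<bar>K\<bar> + 1) * \<bar>y - x\<bar>) * \<bar>y - x\<bar>"
      unfolding power2_abs[of "y - x", symmetric] by (simp only: power2_eq_square mult.assoc)
    also have "\<dots> \<le> e * \<bar>y - x\<bar>"
      using y by (intro mult_right_mono) (auto simp: pos_less_divide_eq mult.commute)
    finally show "norm (f y - f x - (y - x) *\<^sub>R f') \<le> e * norm (y - x)" using assms[of y] by simp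
  qed
qed

section \<open>Differential equation for the characteristic function\<close>

text \<open>The dependency structure is given by the coordinate sets \<open>s v\<close>: terms with
  disjoint sets are independent. \<open>D\<close> bounds the number of terms meeting a given one. In
  the limit theorem \<open>V\<close> has order \<open>n\<close> and \<open>c\<close> has order
  \<open>1 / sqrt n\<close>.\<close>

locale dependent_terms =
  fixes P :: "'a measure" and I :: "'i set" and V :: "'v set" and s :: "'v \<Rightarrow> 'i set"
    and X :: "'v \<Rightarrow> ('i \<Rightarrow> 'a) \<Rightarrow> real" and c :: real and D :: nat
  assumes prob_P: "prob_space P"
    and finite_I: "finite I" and finite_V: "finite V"
    and s_sub: "v \<in> V \<Longrightarrow> s v \<subseteq> I"
    and meas: "v \<in> V \<Longrightarrow> X v \<in> borel_measurable (PiM I (\<lambda>_. P))"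
    and dep: "v \<in> V \<Longrightarrow> depends_on (s v) (X v)"
    and bound: "v \<in> V \<Longrightarrow> \<bar>X v x\<bar> \<le> c"
    and centered: "v \<in> V \<Longrightarrow> integral\<^sup>L (PiM I (\<lambda>_. P)) (X v) = 0"
    and degree: "v \<in> V \<Longrightarrow> card {u \<in> V. s u \<inter> s v \<noteq> {}} \<le> D"
    and c_nonneg: "0 \<le> c"
begin

abbreviation "\<Omega> \<equiv> PiM I (\<lambda>_. P)"

sublocale prob_space \<Omega>
  by (rule prob_space_PiM) (rule prob_P)

definition nb :: "'v \<Rightarrow> 'v set" where "nb v = {u \<in> V. s u \<inter> s v \<noteq> {}}"

definition "pcov v u = (\<integral>x. X v x * X u x \<partial>\<Omega>)"

definition "W x = (\<Sum>v\<in>V. X v x)"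

definition "var = (\<Sum>v\<in>V. \<Sum>u\<in>V. pcov v u)"

lemma nb_sub: "nb v \<subseteq> V" and finite_nb: "finite (nb v)"
  using finite_V by (auto simp: nb_def)

lemma card_nb: "v \<in> V \<Longrightarrow> card (nb v) \<le> D"
  using degree by (simp add: nb_def)

lemma sum_meas [measurable]: "U \<subseteq> V \<Longrightarrow> (\<lambda>x. \<Sum>u\<in>U. X u x) \<in> borel_measurable \<Omega>"
  using meas by (intro borel_measurable_sum) auto

lemma sum_bound:
  assumes "U \<subseteq> V" shows "\<bar>\<Sum>u\<in>U. X u x\<bar> \<le> real (card U) * c"
proof -
  have "\<bar>\<Sum>u\<in>U. X u x\<bar> \<le> (\<Sum>u\<in>U. \<bar>X u x\<bar>)" by (rule sum_abs)
  also have "\<dots> \<le> (\<Sum>u\<in>U. c)" using assms bound by (intro sum_mono) auto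
  finally show ?thesis by simp
qed

lemma prod_bound: "v \<in> V \<Longrightarrow> u \<in> V \<Longrightarrow> \<bar>X v x * X u x\<bar> \<le> c\<^sup>2"
  unfolding abs_mult power2_eq_square using bound c_nonneg by (intro mult_mono) auto

lemma prod_int: "v \<in> V \<Longrightarrow> u \<in> V \<Longrightarrow> integrable \<Omega> (\<lambda>x. X v x * X u x)"
  using meas prod_bound by (intro integrable_bounded[of _ "c\<^sup>2"] borel_measurable_times) auto

lemma X_int: "v \<in> V \<Longrightarrow> integrable \<Omega> (X v)"
  using meas bound by (intro integrable_bounded[of _ c]) auto

lemma pcov_bound: "v \<in> V \<Longrightarrow> u \<in> V \<Longrightarrow> \<bar>pcov v u\<bar> \<le> c\<^sup>2"
  using norm_integral_le_bound[of "\<lambda>x. X v x * X u x" "c\<^sup>2"] meas prod_bound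
  by (auto simp: pcov_def intro!: borel_measurable_times)

lemma pcov_zero: "v \<in> V \<Longrightarrow> u \<in> V \<Longrightarrow> s u \<inter> s v = {} \<Longrightarrow> pcov v u = 0"
  using PiM_integral_mult_indep[OF prob_P finite_I s_sub s_sub _ X_int dep X_int dep prod_int, of v u] centered
  by (auto simp: pcov_def)

lemma var_nb: "var = (\<Sum>v\<in>V. \<Sum>u\<in>nb v. pcov v u)"
  unfolding var_def
  by (intro sum.cong refl sum.mono_neutral_right finite_V nb_sub) (auto simp: nb_def pcov_zero)

lemma W_meas [measurable]: "W \<in> borel_measurable \<Omega>"
  unfolding W_def[abs_def] using sum_meas by auto

lemma second_moment: "(\<integral>x. (W x)\<^sup>2 \<partial>\<Omega>) = var"
proof -
  have "(\<integral>x. (W x)\<^sup>2 \<partial>\<Omega>) = (\<integral>x. (\<Sum>v\<in>V. \<Sum>u\<in>V. X v x * X u x) \<partial>\<Omega>)"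
    by (intro Bochner_Integration.integral_cong refl) (simp add: W_def power2_eq_square sum_product)
  also have "\<dots> = var" unfolding var_def pcov_def
    using prod_int by (simp add: Bochner_Integration.integral_sum)
  finally show ?thesis .
qed

lemma var_nonneg: "0 \<le> var"
  using second_moment integral_nonneg_AE[of "\<lambda>x. (W x)\<^sup>2" \<Omega>] by simp

lemma var_le: "var \<le> real (card V) * real D * c\<^sup>2"
proof -
  have "var \<le> (\<Sum>v\<in>V. \<Sum>u\<in>nb v. c\<^sup>2)"
    unfolding var_nb using pcov_bound nb_sub by (intro sum_mono) (meson abs_le_D1 subsetD)
  also have "\<dots> \<le> (\<Sum>v\<in>V. real D * c\<^sup>2)"
    using card_nb by (intro sum_mono) (auto intro!: mult_right_mono)
  finally show ?thesis by simp
qed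

definition "\<phi> t = (\<integral>x. iexp (t * W x) \<partial>\<Omega>)"

lemma iexp_sum_meas [measurable]:
  "U \<subseteq> V \<Longrightarrow> (\<lambda>x. iexp (t * (\<Sum>u\<in>U. X u x))) \<in> borel_measurable \<Omega>"
  using sum_meas by measurable

lemma iexp_sum_depends: "U \<subseteq> V \<Longrightarrow> depends_on (\<Union>u\<in>U. s u) (\<lambda>x. iexp (t * (\<Sum>u\<in>U. X u x)))"
  by (rule depends_on_comp[OF depends_on_sum, of U s X "\<lambda>a. iexp (t * a)"]) (auto intro: dep)

text \<open>Stein's local argument. Removing from \<open>W\<close> all terms that meet
  \<open>v\<close> makes the rest independent of \<open>X v\<close>, so the zeroth order term of the
  Taylor expansion vanishes. The first order term yields the covariances, once the expectation of
  each product \<open>X v * X u\<close> with the exponential is decoupled as well.\<close>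

lemma local_term_bound:
  assumes v: "v \<in> V" and t: "0 \<le> t" "t \<le> 1"
  shows "cmod ((\<integral>x. \<i> * X v x * iexp (t * W x) \<partial>\<Omega>) + t * (\<Sum>u\<in>nb v. pcov v u) * \<phi> t) \<le> 4 * (real D)\<^sup>2 * c ^ 3"
proof -
  define Wv where "Wv x = (\<Sum>u\<in>V - nb v. X u x)" for x
  define Z where "Z x = (\<Sum>u\<in>nb v. X u x)" for x
  have Xm [measurable]: "X u \<in> borel_measurable \<Omega>" if "u \<in> V" for u using meas that .
  have [measurable]: "Wv \<in> borel_measurable \<Omega>" "Z \<in> borel_measurable \<Omega>" "X v \<in> borel_measurable \<Omega>"
    unfolding Wv_def[abs_def] Z_def[abs_def] using nb_sub v by auto
  have WZ: "W x = Wv x + Z x" for x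
    unfolding W_def Wv_def Z_def using finite_V nb_sub by (simp add: sum.subset_diff)
  have Zb: "\<bar>Z x\<bar> \<le> D * c" for x
  proof -
    have "\<bar>Z x\<bar> \<le> card (nb v) * c" unfolding Z_def using nb_sub by (rule sum_bound)
    also have "\<dots> \<le> D * c" using card_nb[OF v] c_nonneg by (intro mult_right_mono) auto
    finally show ?thesis .
  qed
  have Xc: "\<bar>X u x\<bar> \<le> c" if "u \<in> V" for u x using bound that .
  have vanish: "(\<integral>x. complex_of_real (X v x) * iexp (t * Wv x) \<partial>\<Omega>) = 0"
  proof -
    have "(\<integral>x. complex_of_real (X v x) * iexp (t * Wv x) \<partial>\<Omega>) =
        (\<integral>x. complex_of_real (X v x) \<partial>\<Omega>) * (\<integral>x. iexp (t * Wv x) \<partial>\<Omega>)"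
    proof (rule PiM_integral_mult_indep[OF prob_P finite_I])
      show "s v \<subseteq> I" using s_sub v .
      show "(\<Union>u\<in>V - nb v. s u) \<subseteq> I" using s_sub by auto
      show "s v \<inter> (\<Union>u\<in>V - nb v. s u) = {}" by (auto simp: nb_def)
      show "depends_on (s v) (\<lambda>x. complex_of_real (X v x))" using dep[OF v] by (rule depends_on_comp)
      show "depends_on (\<Union>u\<in>V - nb v. s u) (\<lambda>x. iexp (t * Wv x))"
        unfolding Wv_def by (rule iexp_sum_depends) auto
      show "integrable \<Omega> (\<lambda>x. complex_of_real (X v x))" using X_int[OF v] by simp
      show "integrable \<Omega> (\<lambda>x. iexp (t * Wv x))" by (rule integrable_bounded[of _ 1]) auto
      show "integrable \<Omega> (\<lambda>x. complex_of_real (X v x) * iexp (t * Wv x))"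
        using Xc[OF v] by (intro integrable_bounded[of _ c]) (auto simp: norm_mult)
    qed
    then show ?thesis using centered[OF v] by simp
  qed
  define R where "R x = \<i> * X v x * (iexp (t * W x) - iexp (t * Wv x) - \<i> * (t * Z x) * iexp (t * Wv x))" for x
  have Rm: "R \<in> borel_measurable \<Omega>" unfolding R_def[abs_def] by measurable
  have Rb: "cmod (R x) \<le> c * ((D * c)\<^sup>2 / 2)" for x
  proof -
    have "cmod (R x) = \<bar>X v x\<bar> * cmod (iexp (t * Wv x + t * Z x) - iexp (t * Wv x) - \<i> * of_real (t * Z x) * iexp (t * Wv x))"
      by (simp add: R_def norm_mult WZ distrib_left)
    also have "\<dots> \<le> c * ((t * Z x)\<^sup>2 / 2)"
      using norm_iexp_taylor_le[of "t * Wv x" "t * Z x"] Xc[OF v] c_nonneg by (intro mult_mono) auto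
    also have "\<dots> \<le> c * ((D * c)\<^sup>2 / 2)"
    proof -
      have "\<bar>t * Z x\<bar> \<le> 1 * (D * c)" unfolding abs_mult using t Zb by (intro mult_mono) auto
      then have "(t * Z x)\<^sup>2 \<le> (D * c)\<^sup>2" by (metis abs_ge_zero mult_1 power2_abs power_mono)
      then show ?thesis using c_nonneg by (intro mult_left_mono divide_right_mono) auto
    qed
    finally show ?thesis .
  qed
  have Ri: "integrable \<Omega> R" using Rm Rb by (rule integrable_bounded)
  \<comment> \<open>The first order coefficients. They are not yet products of expectations, because
    \<open>Wv\<close> may still depend on the coordinates of \<open>u\<close>.\<close>
  define Y where "Y u = (\<integral>x. complex_of_real (X v x * X u x) * iexp (t * Wv x) \<partial>\<Omega>)" for u
  have Yi: "integrable \<Omega> (\<lambda>x. complex_of_real (X v x * X u x) * iexp (t * Wv x))" if "u \<in> nb v" for u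
  proof (rule integrable_bounded[of _ "c\<^sup>2"])
    have "u \<in> V" using nb_sub that by auto
    then show "(\<lambda>x. complex_of_real (X v x * X u x) * iexp (t * Wv x)) \<in> borel_measurable \<Omega>" by measurable
    show "cmod (complex_of_real (X v x * X u x) * iexp (t * Wv x)) \<le> c\<^sup>2" for x
      using prod_bound[OF v \<open>u \<in> V\<close>, of x] by (simp add: norm_mult abs_mult)
  qed
  have expand: "(\<integral>x. \<i> * X v x * iexp (t * W x) \<partial>\<Omega>) = integral\<^sup>L \<Omega> R - t * (\<Sum>u\<in>nb v. Y u)"
  proof -
    have "\<i> * X v x * iexp (t * W x) = R x + \<i> * (X v x * iexp (t * Wv x))
        - t * (\<Sum>u\<in>nb v. complex_of_real (X v x * X u x) * iexp (t * Wv x))" for x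
    proof -
      have "(\<Sum>u\<in>nb v. complex_of_real (X v x * X u x) * iexp (t * Wv x)) = X v x * Z x * iexp (t * Wv x)"
        by (simp add: Z_def sum_distrib_left sum_distrib_right mult.assoc)
      then show ?thesis by (simp add: R_def algebra_simps)
    qed
    then have "(\<integral>x. \<i> * X v x * iexp (t * W x) \<partial>\<Omega>) = (\<integral>x. R x + \<i> * (X v x * iexp (t * Wv x))
        - t * (\<Sum>u\<in>nb v. complex_of_real (X v x * X u x) * iexp (t * Wv x)) \<partial>\<Omega>)" by simp
    also have "\<dots> = integral\<^sup>L \<Omega> R + \<i> * (\<integral>x. X v x * iexp (t * Wv x) \<partial>\<Omega>) - t * (\<Sum>u\<in>nb v. Y u)"
    proof -
      have i2: "integrable \<Omega> (\<lambda>x. X v x * iexp (t * Wv x))"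
        using Xc[OF v] by (intro integrable_bounded[of _ c]) (auto simp: norm_mult)
      have i3: "integrable \<Omega> (\<lambda>x. \<Sum>u\<in>nb v. complex_of_real (X v x * X u x) * iexp (t * Wv x))"
        using Yi by (rule Bochner_Integration.integrable_sum)
      have "(\<integral>x. (\<Sum>u\<in>nb v. complex_of_real (X v x * X u x) * iexp (t * Wv x)) \<partial>\<Omega>) = (\<Sum>u\<in>nb v. Y u)"
        unfolding Y_def using Yi by (rule Bochner_Integration.integral_sum)
      then show ?thesis using Ri i2 i3 by simp
    qed
    finally show ?thesis using vanish by simp
  qed
  \<comment> \<open>Two replacements: \<open>Wv\<close> by \<open>W2\<close> costs
    \<open>c\<^sup>2 * (D * c)\<close>, and \<open>W2\<close> by \<open>W\<close> inside the
    characteristic function costs \<open>c\<^sup>2 * (2 * D * c)\<close>.\<close>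
  have Yb: "cmod (Y u - pcov v u * \<phi> t) \<le> 3 * D * c ^ 3" if u: "u \<in> nb v" for u
  proof -
    have uV: "u \<in> V" using u nb_sub by auto
    \<comment> \<open>With the neighbours of \<open>u\<close> removed too, the remaining sum is
      independent of the pair \<open>X v\<close>, \<open>X u\<close>.\<close>
    define U where "U = V - (nb v \<union> nb u)"
    define W2 where "W2 x = (\<Sum>w\<in>U. X w x)" for x
    have U: "U \<subseteq> V" by (auto simp: U_def)
    have [measurable]: "W2 \<in> borel_measurable \<Omega>" "X u \<in> borel_measurable \<Omega>"
      unfolding W2_def[abs_def] using U uV by auto
    have d1: "\<bar>Wv x - W2 x\<bar> \<le> D * c" for x
    proof -
      have "Wv x - W2 x = (\<Sum>w\<in>(V - nb v) - U. X w x)"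
        unfolding Wv_def W2_def using finite_V by (subst sum_diff) (auto simp: U_def)
      also have "\<bar>\<dots>\<bar> \<le> card ((V - nb v) - U) * c" by (rule sum_bound) auto
      also have "\<dots> \<le> D * c"
      proof -
        have "card ((V - nb v) - U) \<le> card (nb u)" by (intro card_mono finite_nb) (auto simp: U_def)
        then show ?thesis using card_nb[OF uV] c_nonneg by (intro mult_right_mono) auto
      qed
      finally show ?thesis .
    qed
    have d2: "\<bar>W2 x - W x\<bar> \<le> 2 * D * c" for x using d1[of x] Zb[of x] WZ[of x] by linarith
    have fact: "(\<integral>x. complex_of_real (X v x * X u x) * iexp (t * W2 x) \<partial>\<Omega>) =
        (\<integral>x. complex_of_real (X v x * X u x) \<partial>\<Omega>) * (\<integral>x. iexp (t * W2 x) \<partial>\<Omega>)"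
    proof (rule PiM_integral_mult_indep[OF prob_P finite_I])
      show "s v \<union> s u \<subseteq> I" using s_sub v uV by auto
      show "(\<Union>w\<in>U. s w) \<subseteq> I" using s_sub U by auto
      show "(s v \<union> s u) \<inter> (\<Union>w\<in>U. s w) = {}" by (auto simp: nb_def U_def)
      show "depends_on (s v \<union> s u) (\<lambda>x. complex_of_real (X v x * X u x))"
        by (rule depends_on_comp2) (auto intro: depends_on_mono[OF dep] v uV)
      show "depends_on (\<Union>w\<in>U. s w) (\<lambda>x. iexp (t * W2 x))" unfolding W2_def by (rule iexp_sum_depends[OF U])
      show "integrable \<Omega> (\<lambda>x. complex_of_real (X v x * X u x))" using integrable_of_real[OF prod_int[OF v uV]] by (simp del: of_real_mult)
      show "integrable \<Omega> (\<lambda>x. iexp (t * W2 x))" by (rule integrable_bounded[of _ 1]) auto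
      show "integrable \<Omega> (\<lambda>x. complex_of_real (X v x * X u x) * iexp (t * W2 x))"
        using prod_bound[OF v uV] by (intro integrable_bounded[of _ "c\<^sup>2"]) (auto simp: norm_mult abs_mult)
    qed
    have pc: "(\<integral>x. complex_of_real (X v x * X u x) \<partial>\<Omega>) = pcov v u"
      unfolding pcov_def using prod_int[OF v uV] by (rule integral_of_real)
    have e1: "cmod (Y u - (\<integral>x. complex_of_real (X v x * X u x) * iexp (t * W2 x) \<partial>\<Omega>)) \<le> c\<^sup>2 * (D * c)"
    proof -
      have i: "integrable \<Omega> (\<lambda>x. complex_of_real (X v x * X u x) * iexp (t * W2 x))"
        using prod_bound[OF v uV] by (intro integrable_bounded[of _ "c\<^sup>2"]) (auto simp: norm_mult abs_mult)
      have "Y u - (\<integral>x. complex_of_real (X v x * X u x) * iexp (t * W2 x) \<partial>\<Omega>) =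
          (\<integral>x. complex_of_real (X v x * X u x) * (iexp (t * Wv x) - iexp (t * W2 x)) \<partial>\<Omega>)"
        unfolding Y_def right_diff_distrib by (rule Bochner_Integration.integral_diff[symmetric, OF Yi[OF u] i])
      also have "cmod \<dots> \<le> c\<^sup>2 * (D * c)"
      proof (rule norm_integral_le_bound)
        fix x
        have "cmod (iexp (t * Wv x) - iexp (t * W2 x)) \<le> \<bar>t * Wv x - t * W2 x\<bar>" by (rule norm_iexp_diff_le)
        also have "\<dots> = t * \<bar>Wv x - W2 x\<bar>" using t by (simp add: right_diff_distrib[symmetric] abs_mult)
        also have "\<dots> \<le> 1 * (D * c)" using t d1 by (intro mult_mono) auto
        finally show "cmod (complex_of_real (X v x * X u x) * (iexp (t * Wv x) - iexp (t * W2 x))) \<le> c\<^sup>2 * (D * c)"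
          unfolding norm_mult norm_of_real using prod_bound[OF v uV] c_nonneg by (intro mult_mono) auto
      qed measurable
      finally show ?thesis .
    qed
    have e2: "cmod ((\<integral>x. iexp (t * W2 x) \<partial>\<Omega>) - \<phi> t) \<le> 2 * D * c"
    proof -
      have "(\<integral>x. iexp (t * W2 x) \<partial>\<Omega>) - \<phi> t = (\<integral>x. iexp (t * W2 x) - iexp (t * W x) \<partial>\<Omega>)"
        unfolding \<phi>_def by (rule Bochner_Integration.integral_diff[symmetric]; rule integrable_bounded[of _ 1]) auto
      also have "cmod \<dots> \<le> 2 * D * c"
      proof (rule norm_integral_le_bound)
        fix x
        have "cmod (iexp (t * W2 x) - iexp (t * W x)) \<le> \<bar>t * W2 x - t * W x\<bar>" by (rule norm_iexp_diff_le)
        also have "\<dots> = t * \<bar>W2 x - W x\<bar>" using t by (simp add: right_diff_distrib[symmetric] abs_mult)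
        also have "\<dots> \<le> 1 * (2 * D * c)" using t d2 by (intro mult_mono) auto
        finally show "cmod (iexp (t * W2 x) - iexp (t * W x)) \<le> 2 * D * c" by simp
      qed measurable
      finally show ?thesis .
    qed
    have "Y u - pcov v u * \<phi> t = (Y u - (\<integral>x. complex_of_real (X v x * X u x) * iexp (t * W2 x) \<partial>\<Omega>))
        + pcov v u * ((\<integral>x. iexp (t * W2 x) \<partial>\<Omega>) - \<phi> t)"
      unfolding fact pc by (simp add: algebra_simps)
    also have "cmod \<dots> \<le> c\<^sup>2 * (D * c) + c\<^sup>2 * (2 * D * c)"
      by (rule norm_triangle_mono[OF e1]) (use pcov_bound[OF v uV] e2 in \<open>auto simp: norm_mult intro!: mult_mono\<close>)
    also have "\<dots> = 3 * D * c ^ 3" by (simp add: power2_eq_square power3_eq_cube)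
    finally show ?thesis .
  qed
  have "(\<integral>x. \<i> * X v x * iexp (t * W x) \<partial>\<Omega>) + t * (\<Sum>u\<in>nb v. pcov v u) * \<phi> t =
      integral\<^sup>L \<Omega> R - t * (\<Sum>u\<in>nb v. Y u - pcov v u * \<phi> t)"
  proof -
    have "(\<Sum>u\<in>nb v. Y u - pcov v u * \<phi> t) = (\<Sum>u\<in>nb v. Y u) - (\<Sum>u\<in>nb v. pcov v u) * \<phi> t"
      by (simp add: sum_subtractf sum_distrib_right)
    then show ?thesis unfolding expand by (simp only:) (simp add: algebra_simps)
  qed
  also have "cmod \<dots> \<le> cmod (integral\<^sup>L \<Omega> R) + cmod (t * (\<Sum>u\<in>nb v. Y u - pcov v u * \<phi> t))" by (rule norm_triangle_ineq4)
  also have "\<dots> \<le> c * ((D * c)\<^sup>2 / 2) + D * (3 * D * c ^ 3)"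
  proof (rule add_mono)
    show "cmod (integral\<^sup>L \<Omega> R) \<le> c * ((D * c)\<^sup>2 / 2)" using Rm Rb by (rule norm_integral_le_bound)
    have "cmod (t * (\<Sum>u\<in>nb v. Y u - pcov v u * \<phi> t)) = t * cmod (\<Sum>u\<in>nb v. Y u - pcov v u * \<phi> t)" using t by (simp add: norm_mult)
    also have "\<dots> \<le> 1 * cmod (\<Sum>u\<in>nb v. Y u - pcov v u * \<phi> t)" using t by (intro mult_right_mono) auto
    also have "\<dots> \<le> (\<Sum>u\<in>nb v. 3 * D * c ^ 3)" unfolding mult_1 by (rule sum_norm_le) (rule Yb)
    also have "\<dots> = card (nb v) * (3 * D * c ^ 3)" by simp
    also have "\<dots> \<le> D * (3 * D * c ^ 3)" using card_nb[OF v] c_nonneg by (intro mult_right_mono) auto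
    finally show "cmod (t * (\<Sum>u\<in>nb v. Y u - pcov v u * \<phi> t)) \<le> D * (3 * D * c ^ 3)" .
  qed
  \<comment> \<open>One half from the Taylor remainder and 3 from at most \<open>D\<close>
    decoupling errors of size \<open>3 * D * c ^ 3\<close>.\<close>
  also have "\<dots> = 7/2 * ((real D)\<^sup>2 * c ^ 3)" by (simp add: power2_eq_square power3_eq_cube)
  also have "\<dots> \<le> 4 * ((real D)\<^sup>2 * c ^ 3)" using c_nonneg by (intro mult_right_mono) auto
  finally show ?thesis by simp
qed

text \<open>\<open>W\<close> is bounded, so the quadratic Taylor remainder of the exponential is
  uniform over the sample space; integrating it justifies differentiation under the
  integral.\<close>

lemma \<phi>_derivative:
  "(\<phi> has_vector_derivative (\<Sum>v\<in>V. \<integral>x. \<i> * X v x * iexp (t * W x) \<partial>\<Omega>)) (at t within S)"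
proof (rule has_vector_derivative_of_quadratic_bound)
  fix y
  define B where "B = real (card V) * c"
  have Wb: "\<bar>W x\<bar> \<le> B" for x unfolding W_def B_def by (rule sum_bound) simp
  have Xm [measurable]: "X u \<in> borel_measurable \<Omega>" if "u \<in> V" for u using meas that .
  have i: "integrable \<Omega> (\<lambda>x. \<i> * X v x * iexp (t * W x))" if "v \<in> V" for v
    by (rule integrable_bounded[of _ c]) (use bound[OF that] Xm[OF that] in \<open>auto simp: norm_mult\<close>)
  have ie: "integrable \<Omega> (\<lambda>x. iexp (r * W x))" for r by (rule integrable_bounded[of _ 1]) auto
  have "(\<Sum>v\<in>V. \<integral>x. \<i> * X v x * iexp (t * W x) \<partial>\<Omega>) = (\<integral>x. (\<Sum>v\<in>V. \<i> * X v x * iexp (t * W x)) \<partial>\<Omega>)"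
    using i by (rule Bochner_Integration.integral_sum[symmetric])
  also have "\<dots> = (\<integral>x. \<i> * W x * iexp (t * W x) \<partial>\<Omega>)" by (simp add: W_def sum_distrib_left sum_distrib_right)
  finally have s: "(\<Sum>v\<in>V. \<integral>x. \<i> * X v x * iexp (t * W x) \<partial>\<Omega>) = (\<integral>x. \<i> * W x * iexp (t * W x) \<partial>\<Omega>)" .
  have iW: "integrable \<Omega> (\<lambda>x. \<i> * W x * iexp (t * W x))"
    by (rule integrable_bounded[of _ B]) (use Wb in \<open>auto simp: norm_mult\<close>)
  have "\<phi> y - \<phi> t - (y - t) *\<^sub>R (\<integral>x. \<i> * W x * iexp (t * W x) \<partial>\<Omega>)
      = (\<integral>x. iexp (y * W x) - iexp (t * W x) - (y - t) *\<^sub>R (\<i> * W x * iexp (t * W x)) \<partial>\<Omega>)"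
    unfolding \<phi>_def using ie iW by simp
  also have "norm \<dots> \<le> B\<^sup>2 / 2 * (y - t)\<^sup>2"
  proof (rule norm_integral_le_bound)
    fix x
    have "iexp (y * W x) - iexp (t * W x) - (y - t) *\<^sub>R (\<i> * W x * iexp (t * W x)) =
       iexp (t * W x + (y - t) * W x) - iexp (t * W x) - \<i> * of_real ((y - t) * W x) * iexp (t * W x)"
      by (simp add: scaleR_conv_of_real algebra_simps)
    also have "cmod \<dots> \<le> ((y - t) * W x)\<^sup>2 / 2" by (rule norm_iexp_taylor_le)
    also have "\<dots> = (W x)\<^sup>2 / 2 * (y - t)\<^sup>2" by (simp add: power_mult_distrib)
    also have "\<dots> \<le> B\<^sup>2 / 2 * (y - t)\<^sup>2"
    proof -
      have "(W x)\<^sup>2 \<le> B\<^sup>2" using Wb[of x] by (metis abs_ge_zero power2_abs power_mono)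
      then show ?thesis by (intro mult_right_mono) auto
    qed
    finally show "norm (iexp (y * W x) - iexp (t * W x) - (y - t) *\<^sub>R (\<i> * W x * iexp (t * W x))) \<le> B\<^sup>2 / 2 * (y - t)\<^sup>2" .
  qed measurable
  finally show "norm (\<phi> y - \<phi> t - (y - t) *\<^sub>R (\<Sum>v\<in>V. \<integral>x. \<i> * X v x * iexp (t * W x) \<partial>\<Omega>)) \<le> (real (card V) * c)\<^sup>2 / 2 * (y - t)\<^sup>2"
    unfolding s B_def .
qed

text \<open>Summing the local bounds gives \<open>\<phi>' = - t * var * \<phi>\<close> up to an
  error \<open>\<delta>\<close>. The integrating factor turns this into a bound on the derivative of
  \<open>\<psi>\<close> on \<open>[0, 1]\<close>, and \<open>\<psi> 0 = 1\<close>. Its size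
  \<open>exp (var / 2)\<close> cancels at the end, so no lower or upper bound on the variance
  enters.\<close>

lemma char_normal_approx:
  "cmod ((\<integral>x. iexp (W x) \<partial>\<Omega>) - exp (- var / 2)) \<le> 4 * real (card V) * (real D)\<^sup>2 * c ^ 3"
proof -
  define \<delta> where "\<delta> = 4 * real (card V) * (real D)\<^sup>2 * c ^ 3"
  define \<phi>' where "\<phi>' t = (\<Sum>v\<in>V. \<integral>x. \<i> * X v x * iexp (t * W x) \<partial>\<Omega>)" for t
  define \<psi> where "\<psi> t = \<phi> t * complex_of_real (exp (var * t\<^sup>2 / 2))" for t
  define \<psi>' where "\<psi>' t = (\<phi>' t + t * var * \<phi> t) * complex_of_real (exp (var * t\<^sup>2 / 2))" for t
  have main: "cmod (\<phi>' t + t * var * \<phi> t) \<le> \<delta>" if t: "0 \<le> t" "t \<le> 1" for t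
  proof -
    have "\<phi>' t + t * var * \<phi> t = (\<Sum>v\<in>V. (\<integral>x. \<i> * X v x * iexp (t * W x) \<partial>\<Omega>) + t * (\<Sum>u\<in>nb v. pcov v u) * \<phi> t)"
      unfolding \<phi>'_def var_nb by (simp add: sum.distrib sum_distrib_left sum_distrib_right)
    also have "cmod \<dots> \<le> (\<Sum>v\<in>V. 4 * (real D)\<^sup>2 * c ^ 3)"
      by (intro sum_norm_le) (use local_term_bound t in auto)
    finally show ?thesis by (simp add: \<delta>_def)
  qed
  have der: "(\<psi> has_vector_derivative \<psi>' t) (at t within S)" for t S
  proof -
    have "((\<lambda>t. complex_of_real (exp (var * t\<^sup>2 / 2))) has_vector_derivative complex_of_real (exp (var * t\<^sup>2 / 2) * (var * t))) (at t within S)"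
      by (rule has_vector_derivative_of_real) (auto intro!: derivative_eq_intros simp: has_real_derivative_iff_has_vector_derivative[symmetric])
    from has_vector_derivative_mult[OF \<phi>_derivative[of t S] this]
    show ?thesis unfolding \<psi>_def[abs_def] \<psi>'_def \<phi>'_def by (simp add: algebra_simps)
  qed
  have "norm (\<psi> 1 - \<psi> 0) \<le> \<delta> * exp (var / 2) * norm (1 - 0 :: real)"
  proof (rule differentiable_bound[where S = "{0..1}" and f' = "\<lambda>t h. h *\<^sub>R \<psi>' t"])
    show "(\<psi> has_derivative (\<lambda>h. h *\<^sub>R \<psi>' t)) (at t within {0..1})" for t
      using der[of t "{0..1}"] by (simp add: has_vector_derivative_def)
    fix t :: real assume "t \<in> {0..1}"
    then have t: "0 \<le> t" "t \<le> 1" by auto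
    have d0: "0 \<le> \<delta>" using c_nonneg by (simp add: \<delta>_def)
    have "norm (\<psi>' t) = cmod (\<phi>' t + t * var * \<phi> t) * exp (var * t\<^sup>2 / 2)" by (simp add: \<psi>'_def norm_mult)
    also have "\<dots> \<le> \<delta> * exp (var / 2)"
    proof (rule mult_mono[OF main[OF t]])
      have "var * t\<^sup>2 \<le> var * 1" using t var_nonneg by (intro mult_left_mono power_le_one) auto
      then show "exp (var * t\<^sup>2 / 2) \<le> exp (var / 2)" by simp
    qed (use d0 in auto)
    finally show "onorm (\<lambda>h. h *\<^sub>R \<psi>' t) \<le> \<delta> * exp (var / 2)"
      using d0 by (intro onorm_bound) (auto simp: mult.commute[of "\<delta> * _"] intro: mult_left_mono)
  qed auto
  then have b: "cmod (\<phi> 1 * exp (var / 2) - 1) \<le> \<delta> * exp (var / 2)"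
    by (simp add: \<psi>_def \<phi>_def prob_space)
  have "cmod (\<phi> 1 - exp (- var / 2)) = exp (- var / 2) * cmod (\<phi> 1 * exp (var / 2) - 1)"
  proof -
    have "\<phi> 1 - exp (- var / 2) = complex_of_real (exp (- var / 2)) * (\<phi> 1 * complex_of_real (exp (var / 2)) - 1)"
      by (simp add: right_diff_distrib mult.left_commute flip: of_real_mult exp_add)
    then show ?thesis by (simp add: norm_mult)
  qed
  also have "\<dots> \<le> exp (- var / 2) * (\<delta> * exp (var / 2))" using b by (intro mult_left_mono) auto
  also have "\<dots> = \<delta>" by (simp add: mult.left_commute flip: exp_add)
  finally show ?thesis by (simp add: \<phi>_def \<delta>_def)
qed

end

section \<open>Centered Gaussian laws on symmetric matrices\<close>

lemma linear_functional_inner: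
  fixes f :: "'a::euclidean_space \<Rightarrow> real"
  assumes "linear f"
  shows "f x = x \<bullet> (\<Sum>b\<in>Basis. f b *\<^sub>R b)"
proof -
  have "f x = f (\<Sum>b\<in>Basis. (x \<bullet> b) *\<^sub>R b)" by (simp add: euclidean_representation)
  also have "\<dots> = (\<Sum>b\<in>Basis. (x \<bullet> b) * f b)"
    using assms by (simp add: linear_sum linear.scaleR)
  also have "\<dots> = x \<bullet> (\<Sum>b\<in>Basis. f b *\<^sub>R b)" by (simp add: inner_sum_right mult.commute)
  finally show ?thesis .
qed

text \<open>Lagrange reduction: while some \<open>B a a\<close> is positive, the square of one
  linear functional is split off. The remainder is still positive semidefinite and gains
  \<open>a\<close> in its kernel, so the codimension of the kernel drops. The number of squares is
  left unspecified.\<close>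

lemma psd_form_sum_of_squares:
  fixes B :: "'a::euclidean_space \<Rightarrow> 'a \<Rightarrow> real"
  assumes "bilinear B" "\<And>x y. B x y = B y x" "\<And>x. 0 \<le> B x x"
  shows "\<exists>m (w :: nat \<Rightarrow> 'a). \<forall>x. B x x = (\<Sum>k<m. (x \<bullet> w k)\<^sup>2)"
  using assms
proof (induction "DIM('a) - dim {x. \<forall>y. B x y = 0}" arbitrary: B rule: less_induct)
  case less
  note bil = less.prems(1) and sym = less.prems(2) and psd = less.prems(3)
  have ker: "subspace {x. \<forall>y. C x y = 0}" if "bilinear C" for C :: "'a \<Rightarrow> 'a \<Rightarrow> real"
    using that by (auto simp: subspace_def bilinear_ladd bilinear_lmul bilinear_lzero)
  show ?case
  proof (cases "\<forall>x. B x x = 0")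
    case True
    then show ?thesis by (intro exI[of _ 0]) simp
  next
    case False
    then obtain a where a: "B a a > 0" using psd by (metis less_eq_real_def)
    define \<beta> where "\<beta> = B a a"
    have \<beta>: "\<beta> > 0" using a by (simp add: \<beta>_def)
    define B' where "B' x y = B x y - B x a * B y a / \<beta>" for x y
    have bil': "bilinear B'"
      unfolding bilinear_def B'_def
      by (intro conjI allI linearI) (simp_all add: bilinear_ladd[OF bil] bilinear_radd[OF bil] bilinear_lmul[OF bil] bilinear_rmul[OF bil] algebra_simps add_divide_distrib)
    have sym': "B' x y = B' y x" for x y by (simp add: B'_def sym[of x y] mult.commute)
    have psd': "0 \<le> B' x x" for x
    proof -
      \<comment> \<open>The minimiser over \<open>r\<close> of the form at
        \<open>x - r *\<^sub>R a\<close>; the minimum is \<open>B' x x\<close>.\<close>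
      define r where "r = B x a / \<beta>"
      have "0 \<le> B (x - r *\<^sub>R a) (x - r *\<^sub>R a)" by (rule psd)
      also have "\<dots> = B x x - 2 * r * B x a + r * r * \<beta>"
        by (simp add: bilinear_lsub[OF bil] bilinear_rsub[OF bil] bilinear_lmul[OF bil] bilinear_rmul[OF bil] sym[of a x] \<beta>_def algebra_simps)
      also have "\<dots> = B' x x" using \<beta> by (simp add: B'_def r_def field_simps)
      finally show ?thesis .
    qed
    have "{x. \<forall>y. B x y = 0} \<subset> {x. \<forall>y. B' x y = 0}"
    proof
      show "{x. \<forall>y. B x y = 0} \<subseteq> {x. \<forall>y. B' x y = 0}" by (auto simp: B'_def)
      have "B' a y = 0" for y using \<beta> by (simp add: B'_def \<beta>_def sym[of a y])
      moreover have "B a a \<noteq> 0" using a by simp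
      ultimately show "{x. \<forall>y. B x y = 0} \<noteq> {x. \<forall>y. B' x y = 0}" by blast
    qed
    then have "dim {x. \<forall>y. B x y = 0} < dim {x. \<forall>y. B' x y = 0}"
      by (intro dim_psubset) (simp add: span_eq_iff[THEN iffD2, OF ker[OF bil]] span_eq_iff[THEN iffD2, OF ker[OF bil']])
    moreover have "dim {x. \<forall>y. B' x y = 0} \<le> DIM('a)" by (rule dim_subset_UNIV)
    ultimately have "DIM('a) - dim {x. \<forall>y. B' x y = 0} < DIM('a) - dim {x. \<forall>y. B x y = 0}" by linarith
    then have "\<exists>m (w :: nat \<Rightarrow> 'a). \<forall>x. B' x x = (\<Sum>k<m. (x \<bullet> w k)\<^sup>2)"
      using less.hyps[OF _ bil' sym' psd'] by simp
    then obtain m and w :: "nat \<Rightarrow> 'a" where w: "\<And>x. B' x x = (\<Sum>k<m. (x \<bullet> w k)\<^sup>2)" by auto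
    define f where "f x = B x a / sqrt \<beta>" for x
    have "linear f" unfolding f_def
      by (rule linearI) (simp_all add: bilinear_ladd[OF bil] bilinear_lmul[OF bil] add_divide_distrib)
    then obtain u where u: "\<And>x. f x = x \<bullet> u" using linear_functional_inner by blast
    have "B x x = (\<Sum>k<Suc m. (x \<bullet> (w(m := u)) k)\<^sup>2)" for x
    proof -
      have "B x x = B' x x + (f x)\<^sup>2" using \<beta> by (simp add: B'_def f_def power2_eq_square)
      then show ?thesis by (simp add: w u)
    qed
    then show ?thesis by (intro exI[of _ "Suc m"] exI[of _ "w(m := u)"] allI)
  qed
qed

lemma char_normal_law:
  assumes "0 \<le> v"
  shows "real_distribution (normal_law v)" "char (normal_law v) t = exp (- v * t\<^sup>2 / 2)"
proof -
  have "real_distribution (normal_law v) \<and> char (normal_law v) t = exp (- v * t\<^sup>2 / 2)"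
  proof (cases "v = 0")
    case True
    have "prob_space (return borel (0::real))" by (rule prob_space_return) simp
    then show ?thesis using True
      by (simp add: normal_law_def char_def integral_return real_distribution_def real_distribution_axioms_def)
  next
    case False
    define \<sigma> where "\<sigma> = sqrt v"
    have \<sigma>: "\<sigma> > 0" "\<sigma>\<^sup>2 = v" using assms False by (auto simp: \<sigma>_def)
    define N where "N = density lborel (normal_density 0 \<sigma>)"
    interpret N: prob_space N unfolding N_def by (rule prob_space_normal_density[OF \<sigma>(1)])
    have [simp, measurable_cong]: "sets N = sets borel" by (simp add: N_def)
    have "distributed N lborel (\<lambda>x. x) (normal_density 0 \<sigma>)"
      unfolding distributed_def N_def by (auto simp: distr_id2)
    then have "distributed N lborel (\<lambda>x. (x - 0) / \<sigma>) std_normal_density"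
      using N.normal_standard_normal_convert[OF \<sigma>(1), of "\<lambda>x. x" 0] by simp
    then have D: "distr N lborel (\<lambda>x. x / \<sigma>) = std_normal_distribution" by (simp add: distributed_def)
    have "char N t = (\<integral>x. iexp ((t * \<sigma>) * (x / \<sigma>)) \<partial>N)" using \<sigma> by (simp add: char_def)
    also have "\<dots> = (\<integral>y. iexp ((t * \<sigma>) * y) \<partial>distr N lborel (\<lambda>x. x / \<sigma>))"
      by (subst integral_distr) auto
    also have "\<dots> = char std_normal_distribution (t * \<sigma>)" unfolding D char_def ..
    also have "\<dots> = exp (- v * t\<^sup>2 / 2)" by (simp add: char_std_normal_distribution power_mult_distrib \<sigma>(2) mult.commute)
    finally have "char N t = exp (- v * t\<^sup>2 / 2)" .
    moreover have "real_distribution N" using N.prob_space_axioms by (simp add: real_distribution_def real_distribution_axioms_def)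
    moreover have "normal_law v = N" using False by (simp add: normal_law_def N_def \<sigma>_def)
    ultimately show ?thesis by simp
  qed
  then show "real_distribution (normal_law v)" "char (normal_law v) t = exp (- v * t\<^sup>2 / 2)" by auto
qed

lemma inner_transpose: "transpose A \<bullet> B = A \<bullet> transpose B" for A B :: "real^'n^'n"
  by (simp add: inner_vec_def transpose_def) (rule sum.swap)

text \<open>The antisymmetric part \<open>w - transpose w\<close> has opposite inner products with
  \<open>w\<close> and with \<open>transpose w\<close>, so its squared norm is twice the inner
  product assumed to vanish.\<close>

lemma symm_of_inner_zero:
  fixes w :: "real^'n^'n"
  assumes "(w - transpose w) \<bullet> w = 0"
  shows "symm w"
proof -
  have "(w - transpose w) \<bullet> transpose w = - ((w - transpose w) \<bullet> w)"
    using inner_transpose[of w w] inner_transpose[of w "transpose w"]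
    by (simp add: inner_diff_left)
  then have "(w - transpose w) \<bullet> (w - transpose w) = 0" using assms by (simp add: inner_diff_right)
  then show ?thesis by (simp add: symm_def)
qed

text \<open>With \<open>v\<close> written as a sum of squares of \<open>A \<bullet> w k\<close>, the
  law sought is that of the sum of \<open>z k *\<^sub>R w k\<close> for independent standard normal
  \<open>z k\<close>; this covers singular covariances. The characteristic function is recorded for
  all \<open>A\<close>, symmetric or not, since the limit is identified in the full matrix
  space.\<close>

lemma centered_gaussian_sym_exists:
  fixes H :: "'b \<Rightarrow> real^'q^'q"
  assumes N: "prob_space N" and H: "H \<in> borel_measurable N" "\<And>x. norm (H x) \<le> K" and sym: "\<And>x. symm (H x)"
  defines "v \<equiv> \<lambda>A. \<integral>x. (A \<bullet> H x)\<^sup>2 \<partial>N"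
  shows "\<exists>G. centered_gaussian_sym G v \<and> (\<forall>A. (\<integral>x. iexp (A \<bullet> x) \<partial>G) = exp (- v A / 2))"
proof -
  interpret N: prob_space N by fact
  note [measurable] = H(1)
  \<comment> \<open>The bilinear form whose diagonal is \<open>v\<close>.\<close>
  define B where "B A A' = (\<integral>x. (A \<bullet> H x) * (A' \<bullet> H x) \<partial>N)" for A A'
  have int: "integrable N (\<lambda>x. (A \<bullet> H x) * (A' \<bullet> H x))" for A A'
  proof (rule N.integrable_const_bound[of _ "(norm A * K) * (norm A' * K)"])
    have b: "\<bar>C \<bullet> H x\<bar> \<le> norm C * K" for C x
      using Cauchy_Schwarz_ineq2[of C "H x"] mult_left_mono[OF H(2)[of x], of "norm C"] by simp
    have "norm ((A \<bullet> H x) * (A' \<bullet> H x)) \<le> (norm A * K) * (norm A' * K)" for x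
      unfolding real_norm_def abs_mult using b[of A x] b[of A' x] by (intro mult_mono) auto
    then show "AE x in N. norm ((A \<bullet> H x) * (A' \<bullet> H x)) \<le> (norm A * K) * (norm A' * K)" by simp
  qed measurable
  have bil: "bilinear B"
    unfolding bilinear_def B_def
    by (intro conjI allI linearI)
      (simp_all add: int inner_add_left distrib_right distrib_left mult.assoc mult.left_commute)
  have vB: "B A A = v A" for A by (simp add: B_def v_def power2_eq_square)
  have v0: "0 \<le> v A" for A by (simp add: v_def)
  have "\<exists>m (w :: nat \<Rightarrow> real^'q^'q). \<forall>A. B A A = (\<Sum>k<m. (A \<bullet> w k)\<^sup>2)"
  proof (rule psd_form_sum_of_squares[OF bil])
    show "B A A' = B A' A" for A A' by (simp add: B_def mult.commute)
    show "0 \<le> B A A" for A using v0 by (simp add: vB)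
  qed
  then obtain m and w :: "nat \<Rightarrow> real^'q^'q" where w: "\<And>A. v A = (\<Sum>k<m. (A \<bullet> w k)\<^sup>2)"
    unfolding vB by auto
  \<comment> \<open>Antisymmetric matrices are orthogonal to every value of \<open>H\<close>, so
    \<open>v\<close> vanishes on them and each square in its representation must vanish too.\<close>
  have w_sym: "symm (w k)" if "k < m" for k
  proof (rule symm_of_inner_zero)
    define A where "A = w k - transpose (w k)"
    have "A \<bullet> H x = 0" for x
      using sym[of x] inner_transpose[of "w k" "H x"] by (simp add: A_def inner_diff_left symm_def)
    then have "(\<Sum>j<m. (A \<bullet> w j)\<^sup>2) = 0" unfolding w[symmetric] by (simp add: v_def)
    then have "(A \<bullet> w k)\<^sup>2 = 0" using that by (subst (asm) sum_nonneg_eq_0_iff) auto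
    then show "(w k - transpose (w k)) \<bullet> w k = 0" by (simp add: A_def)
  qed
  interpret pp: product_prob_space "\<lambda>_::nat. std_normal_distribution"
    by (rule product_prob_spaceI) (rule prob_space_normal_density, simp)
  let ?Z = "PiM {..<m} (\<lambda>_. std_normal_distribution)"
  define T where "T z = (\<Sum>k<m. z k *\<^sub>R w k)" for z
  have T [measurable]: "T \<in> borel_measurable ?Z"
    unfolding T_def[abs_def]
  proof (intro borel_measurable_sum borel_measurable_scaleR borel_measurable_const)
    fix k assume "k \<in> {..<m}"
    then have "(\<lambda>z. z k) \<in> measurable ?Z std_normal_distribution" by (rule measurable_component_singleton)
    then show "(\<lambda>z. z k) \<in> borel_measurable ?Z" by (simp cong: measurable_cong_sets)
  qed
  define G where "G = distr ?Z borel T"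
  have pZ: "prob_space ?Z" by (rule prob_space_PiM) (rule prob_space_normal_density, simp)
  have G: "prob_space G" unfolding G_def by (rule prob_space.prob_space_distr[OF pZ T])
  have Gs [simp, measurable_cong]: "sets G = sets borel" by (simp add: G_def)
  have cf: "(\<integral>x. iexp (A \<bullet> x) \<partial>G) = exp (- v A / 2)" for A
  proof -
    have "(\<integral>x. iexp (A \<bullet> x) \<partial>G) = (\<integral>z. iexp (A \<bullet> T z) \<partial>?Z)"
      unfolding G_def by (rule integral_distr) (auto intro!: borel_measurable_continuous_onI continuous_intros)
    also have "\<dots> = (\<integral>z. (\<Prod>k<m. iexp ((A \<bullet> w k) * z k)) \<partial>?Z)"
      by (simp add: T_def inner_sum_right sum_distrib_left exp_sum[symmetric] mult.commute)
    also have "\<dots> = (\<Prod>k<m. char std_normal_distribution (A \<bullet> w k))"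
      unfolding char_def
    proof (rule pp.product_integral_prod)
      show "integrable std_normal_distribution (\<lambda>u. iexp ((A \<bullet> w k) * u))" for k
        by (rule prob_space.integrable_iexp[OF prob_space_normal_density]) auto
    qed simp
    also have "\<dots> = (\<Prod>k<m. complex_of_real (exp (- (A \<bullet> w k)\<^sup>2 / 2)))" by (simp add: char_std_normal_distribution)
    also have "\<dots> = exp (- v A / 2)" by (simp add: w exp_sum[symmetric] sum_negf sum_divide_distrib[symmetric] flip: of_real_prod)
    finally show ?thesis .
  qed
  have "centered_gaussian_sym G v"
    unfolding centered_gaussian_sym_def
  proof (intro conjI allI impI)
    have [measurable]: "Measurable.pred borel (symm :: real^'q^'q \<Rightarrow> bool)"
    proof -
      have "closed {A :: real^'q^'q. transpose A = A}"
        by (intro closed_Collect_eq continuous_intros) (auto simp: transpose_def intro!: continuous_on_vec_lambda continuous_intros)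
      then show ?thesis by (auto simp: symm_def[abs_def] pred_def)
    qed
    have "symm (T z)" for z
    proof -
      have "(\<Sum>k<m. z k * w k $ i $ j) = (\<Sum>k<m. z k * w k $ j $ i)" for i j
      proof (rule sum.cong[OF refl])
        fix k assume "k \<in> {..<m}"
        then have "transpose (w k) $ i $ j = w k $ i $ j" using w_sym[of k] by (simp add: symm_def)
        then show "z k * w k $ i $ j = z k * w k $ j $ i" by (simp add: transpose_def)
      qed
      then show ?thesis by (simp add: symm_def T_def transpose_def vec_eq_iff)
    qed
    then show "AE x in G. symm x" unfolding G_def by (subst AE_distr_iff) auto
    fix A :: "real^'q^'q"
    have m: "(\<lambda>x. A \<bullet> x) \<in> borel_measurable G" by measurable
    show "distr G borel (\<lambda>x. A \<bullet> x) = normal_law (v A)"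
    proof (rule Levy_uniqueness)
      show "real_distribution (distr G borel (\<lambda>x. A \<bullet> x))"
        using prob_space.prob_space_distr[OF G m] by (simp add: real_distribution_def real_distribution_axioms_def)
      show "real_distribution (normal_law (v A))" using v0 by (rule char_normal_law)
      show "char (distr G borel (\<lambda>x. A \<bullet> x)) = char (normal_law (v A))"
      proof
        fix t
        have "char (distr G borel (\<lambda>x. A \<bullet> x)) t = (\<integral>x. iexp (t * (A \<bullet> x)) \<partial>G)"
          unfolding char_def by (rule integral_distr[OF m]) (auto intro!: borel_measurable_continuous_onI continuous_intros)
        also have "\<dots> = exp (- v (t *\<^sub>R A) / 2)" using cf[of "t *\<^sub>R A"] by simp
        also have "v (t *\<^sub>R A) = t\<^sup>2 * v A" by (simp add: v_def power_mult_distrib)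
        finally show "char (distr G borel (\<lambda>x. A \<bullet> x)) t = char (normal_law (v A)) t"
          by (simp add: char_normal_law(2)[OF v0] mult.commute)
      qed
    qed
  qed (use G in simp_all)
  then show ?thesis using cf by blast
qed

section \<open>The domain of Tyler's functional\<close>

text \<open>For orthonormal \<open>e $ i\<close> with \<open>i\<close> in \<open>K\<close>, the
  component of \<open>y\<close> orthogonal to their span. Frames are indexed by a subset of the
  finite index type, so that they live in a Euclidean space, where bounded sequences have convergent
  subsequences.\<close>

definition resid :: "'n set \<Rightarrow> (real^'n)^'n \<Rightarrow> real^'n \<Rightarrow> real^'n" where
  "resid K e y = y - (\<Sum>i\<in>K. (y \<bullet> e $ i) *\<^sub>R e $ i)"

lemma resid_zero_iff:
  fixes e :: "(real^'n)^'n"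
  assumes on: "\<And>i j. i \<in> K \<Longrightarrow> j \<in> K \<Longrightarrow> e $ i \<bullet> e $ j = (if i = j then 1 else 0)"
  shows "resid K e y = 0 \<longleftrightarrow> y \<in> span ((\<lambda>i. e $ i) ` K)"
proof
  assume "resid K e y = 0"
  then have "y = (\<Sum>i\<in>K. (y \<bullet> e $ i) *\<^sub>R e $ i)" by (simp add: resid_def)
  also have "\<dots> \<in> span ((\<lambda>i. e $ i) ` K)" by (intro span_sum span_scale span_base) auto
  finally show "y \<in> span ((\<lambda>i. e $ i) ` K)" .
next
  have lin: "linear (resid K e)"
    unfolding resid_def by (rule linearI) (simp_all add: inner_add_left sum.distrib algebra_simps scaleR_sum_right)
  have "resid K e (e $ j) = 0" if "j \<in> K" for j
  proof -
    have "(\<Sum>i\<in>K. (e $ j \<bullet> e $ i) *\<^sub>R e $ i) = (\<Sum>i\<in>K. if j = i then e $ i else 0)"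
      using on that by (intro sum.cong) auto
    also have "\<dots> = e $ j" using that by (simp add: sum.delta)
    finally show ?thesis by (simp add: resid_def)
  qed
  then have "(\<lambda>i. e $ i) ` K \<subseteq> {y. resid K e y = 0}" by auto
  moreover have "subspace {y. resid K e y = 0}" using lin by (rule linear_subspace_kernel)
  ultimately have "span ((\<lambda>i. e $ i) ` K) \<subseteq> {y. resid K e y = 0}" by (rule span_minimal)
  then show "y \<in> span ((\<lambda>i. e $ i) ` K) \<Longrightarrow> resid K e y = 0" by auto
qed

text \<open>The factor \<open>norm y\<close> makes the estimate conic: the whole span of a nearby
  frame, unbounded as it is, lies in a narrow cone around the span of \<open>e\<close>.\<close>

lemma resid_diff_bound:
  fixes e e' :: "(real^'n)^'n"
  assumes "\<And>i. i \<in> K \<Longrightarrow> norm (e $ i) = 1" "\<And>i. i \<in> K \<Longrightarrow> norm (e' $ i) = 1"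
  shows "norm (resid K e y - resid K e' y) \<le> 2 * CARD('n) * norm (e - e') * norm y"
proof -
  have "resid K e y - resid K e' y = (\<Sum>i\<in>K. (y \<bullet> e' $ i) *\<^sub>R e' $ i - (y \<bullet> e $ i) *\<^sub>R e $ i)"
    by (simp add: resid_def sum_subtractf)
  also have "norm \<dots> \<le> (\<Sum>i\<in>K. 2 * norm (e - e') * norm y)"
  proof (rule sum_norm_le)
    fix i assume i: "i \<in> K"
    have d: "norm (e' $ i - e $ i) \<le> norm (e - e')"
      using Finite_Cartesian_Product.norm_nth_le[of "e - e'" i] by (simp add: norm_minus_commute)
    have "(y \<bullet> e' $ i) *\<^sub>R e' $ i - (y \<bullet> e $ i) *\<^sub>R e $ i =
        (y \<bullet> (e' $ i - e $ i)) *\<^sub>R e' $ i + (y \<bullet> e $ i) *\<^sub>R (e' $ i - e $ i)"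
      by (simp add: inner_diff_right algebra_simps)
    also have "norm \<dots> \<le> (norm y * norm (e - e')) * 1 + (norm y * 1) * norm (e - e')"
    proof (rule norm_triangle_mono)
      have "\<bar>y \<bullet> (e' $ i - e $ i)\<bar> \<le> norm y * norm (e' $ i - e $ i)" by (rule Cauchy_Schwarz_ineq2)
      also have "\<dots> \<le> norm y * norm (e - e')" using d by (intro mult_left_mono) auto
      finally show "norm ((y \<bullet> (e' $ i - e $ i)) *\<^sub>R e' $ i) \<le> (norm y * norm (e - e')) * 1"
        using assms(2)[OF i] by simp
      have "\<bar>y \<bullet> e $ i\<bar> \<le> norm y * 1" using Cauchy_Schwarz_ineq2[of y "e $ i"] assms(1)[OF i] by simp
      then show "norm ((y \<bullet> e $ i) *\<^sub>R (e' $ i - e $ i)) \<le> (norm y * 1) * norm (e - e')"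
        unfolding norm_scaleR using d by (intro mult_mono) auto
    qed
    finally show "norm ((y \<bullet> e' $ i) *\<^sub>R e' $ i - (y \<bullet> e $ i) *\<^sub>R e $ i) \<le> 2 * norm (e - e') * norm y" by (simp add: mult.commute)
  qed
  also have "\<dots> = card K * (2 * norm (e - e') * norm y)" by simp
  also have "\<dots> \<le> CARD('n) * (2 * norm (e - e') * norm y)"
    by (intro mult_right_mono) (auto intro: card_mono)
  finally show ?thesis by (simp add: mult.commute mult.left_commute)
qed

lemma subspace_orthonormal_tuple:
  fixes W :: "(real^'n) set"
  assumes W: "subspace W" and K: "card K = dim W"
  obtains e :: "(real^'n)^'n" where
    "\<And>i j. i \<in> K \<Longrightarrow> j \<in> K \<Longrightarrow> e $ i \<bullet> e $ j = (if i = j then 1 else 0)"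
    "\<And>i. i \<notin> K \<Longrightarrow> e $ i = 0" "W = span ((\<lambda>i. e $ i) ` K)"
proof -
  obtain B where B: "B \<subseteq> W" "pairwise orthogonal B" "\<And>x. x \<in> B \<Longrightarrow> norm x = 1" "independent B" "card B = dim W" "span B = W"
    using orthonormal_basis_subspace[OF W] by metis
  have "finite B" using B(4) by (rule independent_imp_finite)
  then obtain g where g: "bij_betw g K B" using K B(5) finite_same_card_bij[of K B] by auto
  define e :: "(real^'n)^'n" where "e = (\<chi> i. if i \<in> K then g i else 0)"
  have "(\<lambda>i. e $ i) ` K = B" using g by (auto simp: e_def bij_betw_def)
  moreover have "e $ i \<bullet> e $ j = (if i = j then 1 else 0)" if ij: "i \<in> K" "j \<in> K" for i j
  proof (cases "i = j")
    case True
    have "norm (g j) = 1" using B(3) g ij by (auto simp: bij_betw_def)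
    then show ?thesis using True ij by (simp add: e_def norm_eq_1)
  next
    case False
    then have "g i \<noteq> g j" "g i \<in> B" "g j \<in> B" using g ij by (auto simp: bij_betw_def inj_on_def)
    then have "orthogonal (g i) (g j)" using B(2) by (auto simp: pairwise_def)
    then show ?thesis using False ij by (simp add: e_def orthogonal_def)
  qed
  ultimately show ?thesis using B(6) that[of e] by (auto simp: e_def)
qed

lemma orthonormal_tuple_dim:
  fixes e :: "(real^'n)^'n"
  assumes on: "\<And>i j. i \<in> K \<Longrightarrow> j \<in> K \<Longrightarrow> e $ i \<bullet> e $ j = (if i = j then 1 else 0)"
  shows "dim (span ((\<lambda>i. e $ i) ` K)) = card K"
proof -
  have inj: "inj_on (\<lambda>i. e $ i) K"
  proof (rule inj_onI)
    fix i j assume "i \<in> K" "j \<in> K" "e $ i = e $ j"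
    then show "i = j" using on[of i j] on[of j j] by (auto split: if_splits)
  qed
  have "pairwise orthogonal ((\<lambda>i. e $ i) ` K)"
    using on by (auto simp: pairwise_def orthogonal_def)
  moreover have "0 \<notin> (\<lambda>i. e $ i) ` K"
  proof
    assume "0 \<in> (\<lambda>i. e $ i) ` K"
    then obtain i where "i \<in> K" "e $ i = 0" by auto
    then show False using on[of i i] by simp
  qed
  ultimately have "independent ((\<lambda>i. e $ i) ` K)" by (rule pairwise_orthogonal_independent)
  then show ?thesis using inj by (simp add: dim_eq_card_independent card_image)
qed

text \<open>By compactness, violating subspaces accumulate at a subspace of the same dimension and eventually
  lie in any conic neighbourhood of it.\<close>

lemma Q0_relatively_weakly_open:
  fixes Q :: "(real^'n) measure"
  assumes Q: "Q \<in> Q0" and Qs: "\<And>n. probdist (Qs n)" "\<And>n. emeasure (Qs n) {0} = 0"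
    and conv: "weak_conv Qs Q"
  shows "eventually (\<lambda>n. Qs n \<in> Q0) sequentially"
proof (rule ccontr)
  assume "\<not> ?thesis"
  then have "\<exists>\<^sub>F n in sequentially. Qs n \<notin> Q0" by (simp add: not_eventually)
  then have "\<exists>\<^sub>F n in sequentially. \<exists>k\<in>{1..<CARD('n)}. \<exists>W. subspace W \<and> dim W = k \<and> real k / CARD('n) \<le> measure (Qs n) W"
    by (rule frequently_elim1) (use Qs in \<open>force simp: Q0_def not_less\<close>)
  \<comment> \<open>Finitely many dimensions are possible, so one of them is violated infinitely
    often. It stays fixed when passing to subsequences.\<close>
  then obtain k where k: "k \<in> {1..<CARD('n)}"
    and freq: "\<exists>\<^sub>F n in sequentially. \<exists>W. subspace W \<and> dim W = k \<and> real k / CARD('n) \<le> measure (Qs n) W"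
    by (auto simp: frequently_bex_finite_distrib)
  obtain K :: "'n set" where K: "card K = k" using k obtain_subset_with_card_n[of k "UNIV :: 'n set"] by auto
  define good where "good e \<longleftrightarrow> (\<forall>i\<in>K. \<forall>j\<in>K. e $ i \<bullet> e $ j = (if i = j then 1 else 0)) \<and> (\<forall>i. i \<notin> K \<longrightarrow> e $ i = 0)" for e :: "(real^'n)^'n"
  have "\<exists>\<^sub>F n in sequentially. \<exists>e. good e \<and> real k / CARD('n) \<le> measure (Qs n) (span ((\<lambda>i. e $ i) ` K))"
    using freq
  proof (rule frequently_elim1)
    fix n assume "\<exists>W. subspace W \<and> dim W = k \<and> real k / CARD('n) \<le> measure (Qs n) W"
    then obtain W where W: "subspace W" "dim W = k" "real k / CARD('n) \<le> measure (Qs n) W" by blast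
    obtain e :: "(real^'n)^'n" where "\<And>i j. i \<in> K \<Longrightarrow> j \<in> K \<Longrightarrow> e $ i \<bullet> e $ j = (if i = j then 1 else 0)"
      "\<And>i. i \<notin> K \<Longrightarrow> e $ i = 0" "W = span ((\<lambda>i. e $ i) ` K)"
      using subspace_orthonormal_tuple[OF W(1), of K] K W(2) by metis
    then have "good e \<and> real k / CARD('n) \<le> measure (Qs n) (span ((\<lambda>i. e $ i) ` K))"
      using W(3) unfolding good_def by auto
    then show "\<exists>e. good e \<and> real k / CARD('n) \<le> measure (Qs n) (span ((\<lambda>i. e $ i) ` K))" by blast
  qed
  then have inf: "infinite {n. \<exists>e. good e \<and> real k / CARD('n) \<le> measure (Qs n) (span ((\<lambda>i. e $ i) ` K))}"
    by (simp add: frequently_cofinite[symmetric] cofinite_eq_sequentially)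
  then obtain r :: "nat \<Rightarrow> nat" where r: "strict_mono r"
    "\<And>n. \<exists>e. good e \<and> real k / CARD('n) \<le> measure (Qs (r n)) (span ((\<lambda>i. e $ i) ` K))"
    using infinite_enumerate[OF inf] by auto
  then obtain E where E: "\<And>n. good (E n)" "\<And>n. real k / CARD('n) \<le> measure (Qs (r n)) (span ((\<lambda>i. E n $ i) ` K))"
    by metis
  have good_norm: "norm (e $ i) = (if i \<in> K then 1 else 0)" if "good e" for e i
    using that by (auto simp: good_def norm_eq_1)
  have "compact (cball (0 :: (real^'n)^'n) (CARD('n)))" by simp
  moreover have "E n \<in> cball 0 (CARD('n))" for n
  proof -
    have "norm (E n) \<le> (\<Sum>i\<in>UNIV. norm (E n $ i))" by (simp add: norm_vec_def L2_set_le_sum)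
    also have "\<dots> \<le> (\<Sum>i\<in>(UNIV::'n set). 1)" using good_norm[OF E(1)] by (intro sum_mono) auto
    finally show ?thesis by simp
  qed
  ultimately obtain e r' where e: "strict_mono r'" "(E \<circ> r') \<longlonglongrightarrow> e"
    unfolding compact_def by metis
  have lim: "(\<lambda>n. E (r' n) $ i) \<longlonglongrightarrow> e $ i" for i
    using tendsto_vec_nth[OF e(2), of i] by (simp add: o_def)
  have on: "e $ i \<bullet> e $ j = (if i = j then 1 else 0)" if "i \<in> K" "j \<in> K" for i j
  proof (rule LIMSEQ_unique)
    show "(\<lambda>n. E (r' n) $ i \<bullet> E (r' n) $ j) \<longlonglongrightarrow> e $ i \<bullet> e $ j" by (intro tendsto_inner lim)
    show "(\<lambda>n. E (r' n) $ i \<bullet> E (r' n) $ j) \<longlonglongrightarrow> (if i = j then 1 else 0)"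
      using E(1) that by (auto simp: good_def)
  qed
  define W where "W = span ((\<lambda>i. e $ i) ` K)"
  have "dim W = k" unfolding W_def using orthonormal_tuple_dim[OF on] K by simp
  moreover have "subspace W" by (simp add: W_def)
  ultimately have QW: "measure Q W < real k / CARD('n)" using Q k by (auto simp: Q0_def)
  \<comment> \<open>A continuous function that is 1 on the cone where the residual is at most
    \<open>norm y / m\<close> and 0 where it is at least \<open>(1 + norm y) / m\<close>. As
    \<open>m\<close> grows it tends to the indicator of \<open>W\<close>; only indices
    \<open>Suc m\<close> are used, to keep the division proper.\<close>
  define f where "f m y = max 0 (1 - real m * max 0 (norm (resid K e y) - norm y / real m))" for m :: nat and y :: "real^'n"
  have resid_cont: "continuous_on UNIV (\<lambda>y. norm (resid K e y))"
    unfolding resid_def by (intro continuous_intros)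
  have f_cont: "continuous_on UNIV (f m)" if "m > 0" for m
    unfolding f_def using that by (intro continuous_intros resid_cont) auto
  have f_bd: "0 \<le> f m y" "f m y \<le> 1" for m y by (auto simp: f_def)
  have Wc: "closed W" unfolding W_def by (rule closed_subspace) simp
  have pQ: "prob_space Q" "sets Q = sets borel" using Q by (auto simp: Q0_def probdist_def)
  interpret Q: prob_space Q by fact
  have "(\<lambda>m. integral\<^sup>L Q (f (Suc m))) \<longlonglongrightarrow> (\<integral>y. indicator W y \<partial>Q)"
  proof (rule integral_dominated_convergence[where w = "\<lambda>_. 1"])
    show "indicat_real W \<in> borel_measurable Q" using Wc pQ(2) by (intro borel_measurable_indicator) auto
    show "f (Suc m) \<in> borel_measurable Q" for m
      unfolding measurable_cong_sets[OF pQ(2) refl] by (intro borel_measurable_continuous_onI f_cont) simp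
    show "AE y in Q. norm (f (Suc m) y) \<le> 1" for m using f_bd by simp
    show "AE y in Q. (\<lambda>m. f (Suc m) y) \<longlonglongrightarrow> indicator W y"
    proof (rule AE_I2)
      fix y
      show "(\<lambda>m. f (Suc m) y) \<longlonglongrightarrow> indicator W y"
      proof (cases "y \<in> W")
        case True
        then have "resid K e y = 0" using resid_zero_iff[OF on] by (simp add: W_def)
        then have "f (Suc m) y = 1" for m by (simp add: f_def)
        then show ?thesis using True by simp
      next
        case False
        then have pos: "0 < norm (resid K e y)" using resid_zero_iff[OF on] by (simp add: W_def)
        obtain k0 :: nat where k0: "(1 + norm y) / norm (resid K e y) < k0" using reals_Archimedean2 by blast
        have "eventually (\<lambda>m. f (Suc m) y = 0) sequentially"
          using eventually_ge_at_top[of k0]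
        proof eventually_elim
          case (elim m)
          have "(1 + norm y) / norm (resid K e y) < Suc m" using k0 elim by simp
          then have "1 + norm y < Suc m * norm (resid K e y)" using pos by (simp add: pos_divide_less_eq)
          then have "1 \<le> real (Suc m) * (norm (resid K e y) - norm y / real (Suc m))" by (simp add: right_diff_distrib)
          also have "\<dots> \<le> real (Suc m) * max 0 (norm (resid K e y) - norm y / real (Suc m))" by (intro mult_left_mono) auto
          finally show ?case by (simp add: f_def)
        qed
        then show ?thesis using False by (simp add: tendsto_eventually)
      qed
    qed
  qed auto
  moreover have "(\<integral>y. indicator W y \<partial>Q) = measure Q W" using Wc pQ(2) by simp
  ultimately have "eventually (\<lambda>m. integral\<^sup>L Q (f (Suc m)) < real k / CARD('n)) sequentially"
    using QW by (intro order_tendstoD(2)) auto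
  then obtain m where m: "integral\<^sup>L Q (f (Suc m)) < real k / CARD('n)" by (meson eventually_happens' sequentially_bot)
  have "(\<lambda>n. integral\<^sup>L (Qs n) (f (Suc m))) \<longlonglongrightarrow> integral\<^sup>L Q (f (Suc m))"
  proof -
    have "bounded (range (f (Suc m)))" using f_bd by (auto simp: bounded_iff intro!: exI[of _ 1])
    then show ?thesis using conv f_cont[of "Suc m"] unfolding weak_conv_def by blast
  qed
  then have "(\<lambda>n. integral\<^sup>L (Qs (r (r' n))) (f (Suc m))) \<longlonglongrightarrow> integral\<^sup>L Q (f (Suc m))"
    using LIMSEQ_subseq_LIMSEQ[OF _ strict_mono_o[OF r(1) e(1)]] by (simp add: o_def)
  then have ev1: "eventually (\<lambda>n. integral\<^sup>L (Qs (r (r' n))) (f (Suc m)) < real k / CARD('n)) sequentially"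
    using m by (rule order_tendstoD(2))
  have "(\<lambda>n. norm (e - E (r' n))) \<longlonglongrightarrow> norm (e - e)"
    using e(2) by (intro tendsto_intros) (simp add: o_def)
  \<comment> \<open>This radius turns \<open>resid_diff_bound\<close> into the bound
    \<open>norm y / Suc m\<close>, so that \<open>f (Suc m)\<close> equals 1 on the whole violating
    subspace.\<close>
  then have ev2: "eventually (\<lambda>n. norm (e - E (r' n)) < 1 / (2 * CARD('n) * real (Suc m))) sequentially"
    by (intro order_tendstoD(2)) auto
  have "eventually (\<lambda>n. False) sequentially" using ev1 ev2
  proof eventually_elim
    case (elim n)
    let ?M = "Qs (r (r' n))" and ?V = "span ((\<lambda>i. E (r' n) $ i) ` K)"
    have pM: "prob_space ?M" "sets ?M = sets borel" using Qs(1) by (auto simp: probdist_def)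
    interpret M: prob_space ?M by fact
    have Vc: "closed ?V" by (rule closed_subspace) simp
    have "f (Suc m) y = 1" if "y \<in> ?V" for y
    proof -
      have "resid K (E (r' n)) y = 0"
        using that resid_zero_iff[of K "E (r' n)" y] E(1)[of "r' n"] by (auto simp: good_def)
      then have "norm (resid K e y) \<le> 2 * CARD('n) * norm (e - E (r' n)) * norm y"
        using resid_diff_bound[of K e "E (r' n)" y] on good_norm[OF E(1)] by (simp add: norm_eq_1)
      also have "\<dots> \<le> (1 / real (Suc m)) * norm y"
      proof (intro mult_right_mono)
        have "2 * CARD('n) * norm (e - E (r' n)) \<le> 2 * CARD('n) * (1 / (2 * CARD('n) * real (Suc m)))"
          using elim(2) by (intro mult_left_mono) auto
        then show "2 * CARD('n) * norm (e - E (r' n)) \<le> 1 / real (Suc m)" by simp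
      qed simp
      finally show ?thesis by (simp add: f_def)
    qed
    then have "indicator ?V y \<le> f (Suc m) y" for y using f_bd(1)[of "Suc m" y] by (auto simp: indicator_def)
    then have "(\<integral>y. indicator ?V y \<partial>?M) \<le> integral\<^sup>L ?M (f (Suc m))"
    proof (intro integral_mono)
      have "?V \<in> sets ?M" using Vc pM(2) by auto
      then show "integrable ?M (indicat_real ?V)" by (simp add: M.emeasure_finite less_top[symmetric])
      have "f (Suc m) \<in> borel_measurable ?M"
        unfolding measurable_cong_sets[OF pM(2) refl] by (intro borel_measurable_continuous_onI f_cont) simp
      then show "integrable ?M (f (Suc m))" using f_bd by (intro M.integrable_const_bound[of _ 1]) auto
    qed
    moreover have "(\<integral>y. indicator ?V y \<partial>?M) = measure ?M ?V" using Vc pM(2) by simp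
    ultimately show False using E(2)[of "r' n"] elim(1) by linarith
  qed
  then show False by simp
qed

section \<open>Random Hamiltonian cycles\<close>

text \<open>Without integrability the integral takes the value 0, which is why \<open>B\<close> has
  to be nonnegative.\<close>

lemma (in prob_space) integral_le_const:
  fixes f :: "'a \<Rightarrow> real"
  assumes "\<And>x. f x \<le> B" "0 \<le> B"
  shows "integral\<^sup>L M f \<le> B"
proof (cases "integrable M f")
  case True
  then have "integral\<^sup>L M f \<le> (\<integral>x. B \<partial>M)" using assms by (intro integral_mono) auto
  then show ?thesis by (simp add: prob_space)
qed (simp add: not_integrable_integral_eq assms)

lemma nxt_in: "i \<in> {1..n} \<Longrightarrow> nxt n i \<in> {1..n}"
  by (auto simp: nxt_def)

lemma nxt_inj: "inj_on (nxt n) {1..n}"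
  by (auto simp: inj_on_def nxt_def split: if_splits)

lemma nxt_neq: "2 \<le> n \<Longrightarrow> i \<in> {1..n} \<Longrightarrow> nxt n i \<noteq> i"
  by (auto simp: nxt_def)

lemma nxt_bij: "bij_betw (nxt n) {1..n} {1..n}"
proof -
  have "nxt n ` {1..n} \<subseteq> {1..n}" using nxt_in by blast
  then show ?thesis using endo_inj_surj[of "{1..n}" "nxt n"] nxt_inj[of n] by (auto simp: bij_betw_def)
qed

text \<open>For \<open>n = 2\<close> both positions give the same unordered pair; this is where the
  bound \<open>3 \<le> n\<close> of the conditional approximation originates.\<close>

lemma edge_eq_imp_eq:
  "3 \<le> n \<Longrightarrow> i \<in> {1..n} \<Longrightarrow> j \<in> {1..n} \<Longrightarrow> {i, nxt n i} = {j, nxt n j} \<Longrightarrow> i = j"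
  by (auto simp: nxt_def doubleton_eq_iff split: if_splits)

lemma perms_in: "p \<in> perms n \<Longrightarrow> i \<in> {1..n} \<Longrightarrow> p i \<in> {1..n}"
  unfolding perms_def using permutes_in_image[of p "{1..n}" i] by auto

lemma perms_eq_iff: "p \<in> perms n \<Longrightarrow> p i = p j \<longleftrightarrow> i = j"
  unfolding perms_def using permutes_inj[of p "{1..n}"] by (auto simp: inj_def)

lemma perms_finite: "finite (perms n)"
  unfolding perms_def by (rule finite_permutations) simp

lemma perms_nonempty: "perms n \<noteq> {}"
  unfolding perms_def using permutes_id by blast

lemma sum_perm: "p \<in> perms n \<Longrightarrow> (\<Sum>i=1..n. f (p i)) = (\<Sum>i=1..n. f i)"
  unfolding perms_def using sum.permute[of p "{1..n}" f] by (simp add: o_def)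

lemma sum_nxt: "(\<Sum>i=1..n. f (nxt n i)) = (\<Sum>i=1..n. f i)"
  by (rule sum.reindex_bij_betw[OF nxt_bij])

section \<open>Probability of two prescribed values\<close>

lemma exists_perm_two_points:
  assumes "u \<in> {1..n}" "u' \<in> {1..n}" "u \<noteq> u'" "j \<in> {1..n}" "j' \<in> {1..n}" "j \<noteq> j'"
  shows "\<exists>\<tau>. \<tau> permutes {1..n} \<and> \<tau> u = j \<and> \<tau> u' = j'"
proof -
  \<comment> \<open>The place of \<open>u'\<close> after swapping \<open>u\<close> and
    \<open>j\<close>. It differs from \<open>j\<close>, so the second swap, of \<open>k\<close> and
    \<open>j'\<close>, leaves the first image alone.\<close>
  define k where "k = Transposition.transpose u j u'"
  have k: "k \<in> {1..n}" "k \<noteq> j" using assms by (auto simp: k_def Transposition.transpose_def)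
  have "Transposition.transpose k j' \<circ> Transposition.transpose u j permutes {1..n}"
    using assms k by (intro permutes_compose permutes_swap_id) auto
  moreover have "(Transposition.transpose k j' \<circ> Transposition.transpose u j) u = j" using assms k by (simp add: Transposition.transpose_def)
  moreover have "(Transposition.transpose k j' \<circ> Transposition.transpose u j) u' = j'" by (simp add: k_def[symmetric])
  ultimately show ?thesis by blast
qed

text \<open>Double counting. A permutation takes the values \<open>a\<close> and \<open>b\<close> at
  no more than one ordered pair of distinct positions, so the sets \<open>S u\<close> are disjoint;
  composing with a permutation of the positions shows that each is at least as large as the one in
  question.\<close>

lemma card_perms_two_values:
  assumes j: "j \<in> {1..n}" "j' \<in> {1..n}" "j \<noteq> j'"
  shows "card {p \<in> perms n. p j = a \<and> p j' = b} * (n * (n - 1)) \<le> card (perms n)"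
proof -
  define S where "S u = {p \<in> perms n. p (fst u) = a \<and> p (snd u) = b}" for u :: "nat \<times> nat"
  define U where "U = (SIGMA u:{1..n}. {1..n} - {u})"
  have cU: "card U = n * (n - 1)" unfolding U_def by (subst card_SigmaI) auto
  have fS: "finite (S u)" for u unfolding S_def using perms_finite by auto
  have "card (S (j, j')) \<le> card (S u)" if uU: "u \<in> U" for u
  proof -
    obtain \<tau> where \<tau>: "\<tau> permutes {1..n}" "\<tau> (fst u) = j" "\<tau> (snd u) = j'"
      using exists_perm_two_points[of "fst u" n "snd u" j j'] j uU by (force simp: U_def)
    have "(\<lambda>p. p \<circ> \<tau>) ` S (j, j') \<subseteq> S u"
      using \<tau> permutes_compose[OF \<tau>(1)] by (auto simp: S_def perms_def)
    moreover have "inj_on (\<lambda>p. p \<circ> \<tau>) (S (j, j'))"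
    proof (rule inj_onI)
      fix p q :: "nat \<Rightarrow> nat" assume "p \<circ> \<tau> = q \<circ> \<tau>"
      then show "p = q" using permutes_surj[OF \<tau>(1)] by (metis surj_fun_eq fun.map_comp o_id surj_iff)
    qed
    ultimately show ?thesis using fS by (metis card_image card_mono)
  qed
  then have "card U * card (S (j, j')) \<le> (\<Sum>u\<in>U. card (S u))"
    using sum_mono[of U "\<lambda>_. card (S (j, j'))" "\<lambda>u. card (S u)"] by simp
  also have "\<dots> = card (\<Union>u\<in>U. S u)"
  proof (rule card_UN_disjoint[symmetric])
    show "finite U" by (auto simp: U_def)
    show "\<forall>u\<in>U. finite (S u)" using fS by auto
    show "\<forall>u\<in>U. \<forall>w\<in>U. u \<noteq> w \<longrightarrow> S u \<inter> S w = {}"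
      by (auto simp: S_def) (metis perms_eq_iff)+
  qed
  also have "\<dots> \<le> card (perms n)" by (intro card_mono perms_finite) (auto simp: S_def)
  finally show ?thesis by (simp add: S_def cU mult.commute)
qed

lemma prob_perms_two_values:
  assumes j: "j \<in> {1..n}" "j' \<in> {1..n}" "j \<noteq> j'"
  shows "measure (measure_pmf (pmf_of_set (perms n))) {p. p j = a \<and> p j' = b} \<le> 1 / (real n * (real n - 1))"
proof -
  have n: "2 \<le> n" using j by auto
  have "real (card {p \<in> perms n. p j = a \<and> p j' = b} * (n * (n - 1))) \<le> real (card (perms n))"
    using card_perms_two_values[OF j] by (simp only: of_nat_le_iff)
  then have "real (card {p \<in> perms n. p j = a \<and> p j' = b}) * (real n * (real n - 1)) \<le> real (card (perms n))"
    using n by (simp add: of_nat_diff)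
  moreover have "real (card (perms n)) > 0" using perms_finite perms_nonempty by (simp add: card_gt_0_iff)
  moreover have "real n * (real n - 1) > 0" using n by simp
  moreover have "measure (measure_pmf (pmf_of_set (perms n))) {p. p j = a \<and> p j' = b}
      = real (card {p \<in> perms n. p j = a \<and> p j' = b}) / real (card (perms n))"
    by (subst measure_pmf_of_set[OF perms_nonempty perms_finite]) (simp add: Int_def conj_commute)
  ultimately show ?thesis by (simp only: pos_le_divide_eq times_divide_eq_left divide_le_eq_1_pos)
qed

abbreviation perm_law :: "'d::finite itself \<Rightarrow> nat \<Rightarrow> ('d \<Rightarrow> nat \<Rightarrow> nat) measure" where
  "perm_law T n \<equiv> PiM (UNIV :: 'd set) (\<lambda>_. measure_pmf (pmf_of_set (perms n)))"

lemma prob_space_perm_law: "prob_space (perm_law T n)"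
  by (rule prob_space_PiM) (rule prob_space_measure_pmf)

lemma AE_perm_law: "AE \<pi> in perm_law T n. \<forall>l. \<pi> l \<in> perms n"
proof (rule AE_all_countable[THEN iffD2], rule allI)
  fix l
  show "AE \<pi> in perm_law T n. \<pi> l \<in> perms n"
    by (rule AE_PiM_component[where P = "\<lambda>p. p \<in> perms n"])
      (auto simp: prob_space_measure_pmf AE_measure_pmf_iff set_pmf_of_set[OF perms_nonempty perms_finite])
qed

lemma perm_law_value_measurable [measurable]:
  "(\<lambda>\<pi>. \<pi> l i) \<in> measurable (perm_law (T :: 'd::finite itself) n) (count_space UNIV)"
proof -
  have "(\<lambda>\<pi>. \<pi> l) \<in> measurable (perm_law T n) (measure_pmf (pmf_of_set (perms n)))"
    by (rule measurable_component_singleton) simp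
  then show ?thesis by (rule measurable_compose) simp
qed

definition same_edge :: "nat \<Rightarrow> (nat \<Rightarrow> nat) \<Rightarrow> nat \<Rightarrow> (nat \<Rightarrow> nat) \<Rightarrow> nat \<Rightarrow> bool" where
  "same_edge n p i q j \<longleftrightarrow> {p i, p (nxt n i)} = {q j, q (nxt n j)}"

lemma same_edge_iff: "same_edge n p i q j \<longleftrightarrow> (q j = p i \<and> q (nxt n j) = p (nxt n i)) \<or> (q j = p (nxt n i) \<and> q (nxt n j) = p i)"
  by (auto simp: same_edge_def doubleton_eq_iff)

lemma same_edge_measurable [measurable]:
  "(\<lambda>\<pi>. same_edge n (\<pi> l) i (\<pi> l') j) \<in> measurable (perm_law (T :: 'd::finite itself) n) (count_space UNIV)"
  unfolding same_edge_iff by measurable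

text \<open>For fixed \<open>\<pi> l\<close> only the independent permutation
  \<open>\<pi> l'\<close> is integrated. The edge may be traversed in two directions, which gives
  the factor 2.\<close>

lemma integral_same_edge_le:
  fixes l l' :: "'d::finite"
  assumes n: "2 \<le> n" and j: "j \<in> {1..n}" and l: "l \<noteq> l'"
  shows "(\<integral>\<pi>. of_bool (same_edge n (\<pi> l) i (\<pi> l') j) \<partial>perm_law T n) \<le> 2 / (real n * (real n - 1))"
proof -
  let ?p = "measure_pmf (pmf_of_set (perms n))"
  interpret pp: product_prob_space "\<lambda>_::'d. ?p" by (rule product_prob_space_const) (rule prob_space_measure_pmf)
  interpret K: prob_space "perm_law T n" by (rule prob_space_perm_law)
  interpret K': prob_space "PiM (UNIV - {l'}) (\<lambda>_::'d. ?p)" by (rule prob_space_PiM) (rule prob_space_measure_pmf)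
  have int: "integrable (perm_law T n) (\<lambda>\<pi>. of_bool (same_edge n (\<pi> l) i (\<pi> l') j) :: real)"
    by (rule K.integrable_bounded[of _ 1]) auto
  have ins: "insert l' (UNIV - {l'}) = (UNIV :: 'd set)" by auto
  have "(\<integral>\<pi>. (of_bool (same_edge n (\<pi> l) i (\<pi> l') j) :: real) \<partial>perm_law T n) =
      (\<integral>\<pi>. (\<integral>p. of_bool (same_edge n ((\<pi>(l' := p)) l) i ((\<pi>(l' := p)) l') j) \<partial>?p) \<partial>PiM (UNIV - {l'}) (\<lambda>_. ?p))"
    using pp.product_integral_insert[of "UNIV - {l'}" l' "\<lambda>\<pi>. of_bool (same_edge n (\<pi> l) i (\<pi> l') j) :: real"] int
    unfolding ins by simp
  also have "\<dots> = (\<integral>\<pi>. (\<integral>p. of_bool (same_edge n (\<pi> l) i p j) \<partial>?p) \<partial>PiM (UNIV - {l'}) (\<lambda>_. ?p))" using l by simp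
  also have "\<dots> \<le> 2 / (real n * (real n - 1))"
  proof -
    have inner: "(\<integral>p. of_bool (same_edge n q i p j) \<partial>?p) \<le> 2 / (real n * (real n - 1))" for q
    proof -
      have "(\<integral>p. of_bool (same_edge n q i p j) \<partial>?p) = measure ?p {p. same_edge n q i p j}"
      proof -
        have "of_bool (same_edge n q i p j) = (indicator {p. same_edge n q i p j} p :: real)" for p by (simp add: indicator_def)
        then show ?thesis by simp
      qed
      also have "{p. same_edge n q i p j} = {p. p j = q i \<and> p (nxt n j) = q (nxt n i)} \<union> {p. p j = q (nxt n i) \<and> p (nxt n j) = q i}"
        by (auto simp: same_edge_iff)
      also have "measure ?p \<dots> \<le> measure ?p {p. p j = q i \<and> p (nxt n j) = q (nxt n i)} + measure ?p {p. p j = q (nxt n i) \<and> p (nxt n j) = q i}"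
        by (rule measure_Un_le) auto
      also have "\<dots> \<le> 1 / (real n * (real n - 1)) + 1 / (real n * (real n - 1))"
        using nxt_neq[OF n j] by (intro add_mono prob_perms_two_values j nxt_in) auto
      finally show ?thesis by simp
    qed
    show ?thesis by (rule K'.integral_le_const) (use n inner in auto)
  qed
  finally show ?thesis .
qed

section \<open>Sums over the edges of several cycles\<close>

lemma card_inj_fiber: "inj_on f A \<Longrightarrow> card {u \<in> A. f u = j} \<le> 1"
proof -
  assume "inj_on f A"
  then have "{u \<in> A. f u = j} \<subseteq> {inv_into A f j}" by (auto simp: inv_into_f_f)
  then show ?thesis using card_mono[of "{inv_into A f j}"] by fastforce
qed

lemma card_edges_at:
  assumes "p \<in> perms n"
  shows "card {i \<in> {1..n}. j \<in> {p i, p (nxt n i)}} \<le> 2"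
proof -
  have "{i \<in> {1..n}. j \<in> {p i, p (nxt n i)}} = {i \<in> {1..n}. p i = j} \<union> {i \<in> {1..n}. p (nxt n i) = j}" by auto
  then have "card {i \<in> {1..n}. j \<in> {p i, p (nxt n i)}} \<le> card {i \<in> {1..n}. p i = j} + card {i \<in> {1..n}. p (nxt n i) = j}"
    by (simp add: card_Un_le)
  also have "\<dots> \<le> 1 + 1"
  proof (intro add_mono card_inj_fiber)
    show inj: "inj_on p S" for S using perms_eq_iff[OF assms] by (intro inj_onI) simp
    show "inj_on (\<lambda>i. p (nxt n i)) {1..n}"
      using comp_inj_on[OF nxt_inj inj] by (simp add: o_def)
  qed
  finally show ?thesis by simp
qed

locale sampling =
  fixes P :: "(real^'q) measure"
  assumes probdist_P: "probdist P"
begin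

declare One_nat_def [simp del]

lemma prob_P: "prob_space P" and sets_P [measurable_cong]: "sets P = sets borel"
  using probdist_P by (auto simp: probdist_def)

sublocale P: prob_space P by (rule prob_P)
sublocale PP: pair_prob_space P P ..

abbreviation "data n \<equiv> PiM {1..n} (\<lambda>_. P)"

lemma prob_data: "prob_space (data n)"
  by (rule prob_space_PiM) (rule prob_P)

lemma coord_measurable: "i \<in> {1..n} \<Longrightarrow> (\<lambda>x. x i) \<in> borel_measurable (data n)"
proof -
  assume "i \<in> {1..n}"
  then have "(\<lambda>x. x i) \<in> measurable (data n) P" by (rule measurable_component_singleton)
  then show ?thesis by (simp add: measurable_cong_sets[OF refl sets_P])
qed

lemma pair_measurable:
  fixes g :: "real^'q \<Rightarrow> real^'q \<Rightarrow> 'b::topological_space"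
  assumes "(\<lambda>(x, y). g x y) \<in> borel_measurable (P \<Otimes>\<^sub>M P)" "f \<in> borel_measurable N" "h \<in> borel_measurable N"
  shows "(\<lambda>x. g (f x) (h x)) \<in> borel_measurable N"
proof -
  have "(\<lambda>x. (f x, h x)) \<in> measurable N (P \<Otimes>\<^sub>M P)" using assms(2,3) by measurable
  from measurable_compose[OF this assms(1)] show ?thesis by simp
qed

text \<open>The degree 4 arises from two endpoints with at most two edges each. The kernel
  \<open>g\<close> is centered but not degenerate, as befits \<open>J\<close> and the test functions
  for weak convergence.\<close>

lemma dependent_terms_cycle:
  fixes g :: "real^'q \<Rightarrow> real^'q \<Rightarrow> real"
  assumes p: "p \<in> perms n" and n: "2 \<le> n"
    and g: "(\<lambda>(x, y). g x y) \<in> borel_measurable (P \<Otimes>\<^sub>M P)" "\<And>x y. \<bar>g x y\<bar> \<le> C"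
    and g0: "(\<integral>z. g (fst z) (snd z) \<partial>(P \<Otimes>\<^sub>M P)) = 0"
  shows "dependent_terms P {1..n} {1..n} (\<lambda>i. {p i, p (nxt n i)}) (\<lambda>i x. g (x (p i)) (x (p (nxt n i)))) C 4"
proof
  have in1: "p i \<in> {1..n}" "p (nxt n i) \<in> {1..n}" if "i \<in> {1..n}" for i
    using that perms_in[OF p] nxt_in by blast+
  fix i assume i: "i \<in> {1..n}"
  show "{p i, p (nxt n i)} \<subseteq> {1..n}" using in1[OF i] by simp
  show "(\<lambda>x. g (x (p i)) (x (p (nxt n i)))) \<in> borel_measurable (data n)"
    using in1[OF i] by (intro pair_measurable[OF g(1)] coord_measurable)
  show "depends_on {p i, p (nxt n i)} (\<lambda>x. g (x (p i)) (x (p (nxt n i))))"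
    by (auto simp: depends_on_def)
  show "\<bar>g (x (p i)) (x (p (nxt n i)))\<bar> \<le> C" for x :: "nat \<Rightarrow> _" by (rule g)
  have "p i \<noteq> p (nxt n i)" using nxt_neq[OF n i] perms_eq_iff[OF p] by auto
  then show "(\<integral>x. g (x (p i)) (x (p (nxt n i))) \<partial>data n) = 0"
    using PiM_integral_coord2[OF prob_P _ in1[OF i], of g C] g g0 by simp
  let ?S = "\<lambda>j. {u \<in> {1..n}. j \<in> {p u, p (nxt n u)}}"
  have "{u \<in> {1..n}. {p u, p (nxt n u)} \<inter> {p i, p (nxt n i)} \<noteq> {}} \<subseteq> ?S (p i) \<union> ?S (p (nxt n i))" by auto
  then have "card {u \<in> {1..n}. {p u, p (nxt n u)} \<inter> {p i, p (nxt n i)} \<noteq> {}} \<le> card (?S (p i) \<union> ?S (p (nxt n i)))"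
    by (intro card_mono) auto
  also have "\<dots> \<le> card (?S (p i)) + card (?S (p (nxt n i)))" by (rule card_Un_le)
  also have "\<dots> \<le> 2 + 2" using card_edges_at[OF p] by (intro add_mono)
  finally show "card {u \<in> {1..n}. {p u, p (nxt n u)} \<inter> {p i, p (nxt n i)} \<noteq> {}} \<le> 4" by simp
next
  show "0 \<le> C" using g(2)[of 0 0] by linarith
qed (use prob_P in auto)

lemma cycle_second_moment:
  fixes g :: "real^'q \<Rightarrow> real^'q \<Rightarrow> real"
  assumes p: "p \<in> perms n" and n: "2 \<le> n"
    and g: "(\<lambda>(x, y). g x y) \<in> borel_measurable (P \<Otimes>\<^sub>M P)" "\<And>x y. \<bar>g x y\<bar> \<le> C"
    and g0: "(\<integral>z. g (fst z) (snd z) \<partial>(P \<Otimes>\<^sub>M P)) = 0"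
  shows "(\<integral>x. (\<Sum>i=1..n. g (x (p i)) (x (p (nxt n i))))\<^sup>2 \<partial>data n) \<le> 4 * real n * C\<^sup>2"
proof -
  interpret dependent_terms P "{1..n}" "{1..n}" "\<lambda>i. {p i, p (nxt n i)}" "\<lambda>i x. g (x (p i)) (x (p (nxt n i)))" C 4
    by (rule dependent_terms_cycle[OF assms])
  show ?thesis using second_moment var_le by (simp add: W_def mult.commute)
qed

text \<open>Each coincidence of edges from two different cycles is counted in both orders, matching
  the double sum of covariances.\<close>

definition coinc :: "nat \<Rightarrow> ('d::finite \<Rightarrow> nat \<Rightarrow> nat) \<Rightarrow> real" where
  "coinc n \<pi> = (\<Sum>e\<in>UNIV \<times> {1..n}. \<Sum>e'\<in>UNIV \<times> {1..n}.
     of_bool (fst e \<noteq> fst e' \<and> same_edge n (\<pi> (fst e)) (snd e) (\<pi> (fst e')) (snd e')))"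

section \<open>Normal approximation for fixed permutations\<close>

context
  fixes n :: nat and a :: "real^'q \<Rightarrow> real" and h :: "'d::finite \<Rightarrow> real^'q \<Rightarrow> real^'q \<Rightarrow> real"
    and C :: real and \<pi> :: "'d \<Rightarrow> nat \<Rightarrow> nat"
  assumes n: "3 \<le> n" and \<pi>: "\<And>l. \<pi> l \<in> perms n"
    and a: "a \<in> borel_measurable borel" "\<And>x. \<bar>a x\<bar> \<le> C" "(\<integral>x. a x \<partial>P) = 0"
    and h: "\<And>l. (\<lambda>(x, y). h l x y) \<in> borel_measurable (P \<Otimes>\<^sub>M P)" "\<And>l x y. \<bar>h l x y\<bar> \<le> C"
      "\<And>l x y. h l x y = h l y x" "\<And>l x. (\<integral>y. h l x y \<partial>P) = 0"
begin

definition "terms = {1..n} <+> ((UNIV :: 'd set) \<times> {1..n})"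

lemma in_terms: "Inl i \<in> terms \<longleftrightarrow> i \<in> {1..n}" "Inr (l, i) \<in> terms \<longleftrightarrow> i \<in> {1..n}"
  by (auto simp: terms_def)

lemma sum_terms: "(\<Sum>v\<in>terms. f v) = (\<Sum>i=1..n. f (Inl i)) + (\<Sum>e\<in>UNIV \<times> {1..n}. f (Inr e))"
  unfolding terms_def by (simp add: sum.Plus o_def)

fun supp :: "nat + 'd \<times> nat \<Rightarrow> nat set" where
  "supp (Inl i) = {i}"
| "supp (Inr (l, i)) = {\<pi> l i, \<pi> l (nxt n i)}"

fun trm :: "nat + 'd \<times> nat \<Rightarrow> (nat \<Rightarrow> real^'q) \<Rightarrow> real" where
  "trm (Inl i) x = a (x i) / sqrt (real n)"
| "trm (Inr (l, i)) x = h l (x (\<pi> l i)) (x (\<pi> l (nxt n i))) / sqrt (real n)"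

lemma trm_Inl: "trm (Inl i) = (\<lambda>x. a (x i) / sqrt (real n))"
  and trm_Inr: "trm (Inr (l, i)) = (\<lambda>x. h l (x (\<pi> l i)) (x (\<pi> l (nxt n i))) / sqrt (real n))"
  by auto

lemma edge_in: "i \<in> {1..n} \<Longrightarrow> \<pi> l i \<in> {1..n} \<and> \<pi> l (nxt n i) \<in> {1..n} \<and> \<pi> l i \<noteq> \<pi> l (nxt n i)"
  using perms_in[OF \<pi>, of i l] perms_in[OF \<pi> nxt_in, of i l] perms_eq_iff[OF \<pi>] nxt_neq[of n i] n by auto

lemma C_nonneg: "0 \<le> C" using a(2)[of 0] by linarith

lemma trm_measurable: "v \<in> terms \<Longrightarrow> trm v \<in> borel_measurable (data n)"
proof (cases v rule: supp.cases)
  case (1 i)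
  assume "v \<in> terms"
  then have "i \<in> {1..n}" using 1 by (auto simp: terms_def)
  from measurable_compose[OF coord_measurable[OF this] a(1)]
  show ?thesis unfolding 1 trm_Inl by simp
next
  case (2 l i)
  assume "v \<in> terms"
  then have "i \<in> {1..n}" using 2 by (auto simp: terms_def)
  then have "(\<lambda>x. h l (x (\<pi> l i)) (x (\<pi> l (nxt n i)))) \<in> borel_measurable (data n)"
    using edge_in[of i l] by (intro pair_measurable[OF h(1)[of l]] coord_measurable) auto
  then show ?thesis unfolding 2 trm_Inr by simp
qed

lemma trm_bound: "\<bar>trm v x\<bar> \<le> C / sqrt (real n)"
  by (cases v rule: supp.cases) (simp_all add: abs_divide divide_right_mono a(2) h(2))

text \<open>Some endpoint of the edge lies outside \<open>S\<close>, and integrating out that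
  observation gives 0. Symmetry of \<open>h\<close> allows it to be the second argument in either
  case.\<close>

lemma degenerate_product:
  assumes F: "F \<in> borel_measurable (data n)" "\<And>x. \<bar>F x\<bar> \<le> B" "depends_on S F"
    and i: "i \<in> {1..n}" and S: "S \<subseteq> {1..n}" "\<not> {\<pi> l i, \<pi> l (nxt n i)} \<subseteq> S"
  shows "(\<integral>x. F x * h l (x (\<pi> l i)) (x (\<pi> l (nxt n i))) \<partial>data n) = 0"
proof -
  note e = edge_in[OF i, of l]
  interpret D: prob_space "data n" by (rule prob_data)
  have int: "integrable (data n) (\<lambda>x. F x * h l (x b) (x c))" if "b \<in> {1..n}" "c \<in> {1..n}" for b c
  proof (rule D.integrable_bounded[of _ "B * C"])
    show "(\<lambda>x. F x * h l (x b) (x c)) \<in> borel_measurable (data n)"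
      by (intro borel_measurable_times F pair_measurable[OF h(1)] coord_measurable that)
    show "norm (F x * h l (x b) (x c)) \<le> B * C" for x
      unfolding real_norm_def abs_mult using F(2)[of x] h(2)[of l "x b" "x c"] by (intro mult_mono) auto
  qed
  have key: "(\<integral>x. F x * h l (x b) (x c) \<partial>data n) = 0" if "b \<in> {1..n}" "c \<in> {1..n}" "b \<noteq> c" "c \<notin> S" for b c
    by (rule PiM_integral_degenerate[OF prob_P]) (use that int S in \<open>auto intro!: h(4) depends_on_mono[OF F(3)] simp del: atLeastAtMost_iff\<close>)
  show ?thesis
  proof (cases "\<pi> l (nxt n i) \<in> S")
    case False
    then show ?thesis using key e by auto
  next
    case True
    then have "\<pi> l i \<notin> S" using S by auto
    then have "(\<integral>x. F x * h l (x (\<pi> l (nxt n i))) (x (\<pi> l i)) \<partial>data n) = 0" using key e by auto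
    then show ?thesis by (simp add: h(3)[of l "_ (\<pi> l i)"])
  qed
qed

lemma card_terms_at: "card {u \<in> terms. j \<in> supp u} \<le> 1 + 2 * CARD('d)"
proof -
  let ?E = "\<lambda>l. Inr ` Pair l ` {i \<in> {1..n}. j \<in> {\<pi> l i, \<pi> l (nxt n i)}} :: (nat + 'd \<times> nat) set"
  have "{u \<in> terms. j \<in> supp u} \<subseteq> {Inl j} \<union> (\<Union>l\<in>UNIV. ?E l)"
  proof
    fix u assume "u \<in> {u \<in> terms. j \<in> supp u}"
    then show "u \<in> {Inl j} \<union> (\<Union>l\<in>UNIV. ?E l)" by (cases u rule: supp.cases) (fastforce simp: terms_def)+
  qed
  then have "card {u \<in> terms. j \<in> supp u} \<le> card ({Inl j} \<union> (\<Union>l\<in>UNIV. ?E l))" by (intro card_mono) auto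
  also have "\<dots> \<le> card {Inl j :: nat + 'd \<times> nat} + card (\<Union>l\<in>UNIV. ?E l)" by (rule card_Un_le)
  also have "card (\<Union>l\<in>UNIV. ?E l) \<le> (\<Sum>l\<in>UNIV. card (?E l))" by (rule card_UN_le) simp
  also have "\<dots> \<le> (\<Sum>l\<in>(UNIV :: 'd set). 2)"
  proof (rule sum_mono)
    fix l :: 'd
    have "card (?E l) = card {i \<in> {1..n}. j \<in> {\<pi> l i, \<pi> l (nxt n i)}}"
      by (simp add: card_image inj_on_def image_image)
    also have "\<dots> \<le> 2" using card_edges_at[OF \<pi>] .
    finally show "card (?E l) \<le> 2" .
  qed
  finally show ?thesis by simp
qed

lemma dependent_terms_all:
  "dependent_terms P {1..n} terms supp trm (C / sqrt (real n)) (2 * (1 + 2 * CARD('d)))"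
proof
  show "finite terms" by (auto simp: terms_def)
  fix v assume v: "v \<in> terms"
  show "supp v \<subseteq> {1..n}" using v edge_in by (cases v rule: supp.cases) (auto simp: terms_def)
  show "trm v \<in> borel_measurable (data n)" using v by (rule trm_measurable)
  show "depends_on (supp v) (trm v)" by (cases v rule: supp.cases) (auto simp: depends_on_def)
  show "\<bar>trm v x\<bar> \<le> C / sqrt (real n)" for x by (rule trm_bound)
  show "integral\<^sup>L (data n) (trm v) = 0"
  proof (cases v rule: supp.cases)
    case (1 i)
    then have i: "i \<in> {1..n}" using v by (auto simp: terms_def)
    have "(\<integral>x. a (x i) \<partial>data n) = (\<integral>y. a y \<partial>distr (data n) P (\<lambda>x. x i))"
      using i a(1) by (intro integral_distr[symmetric] measurable_component_singleton) (auto simp: measurable_cong_sets[OF sets_P refl])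
    also have "distr (data n) P (\<lambda>x. x i) = P" using i prob_P by (intro distr_PiM_component) auto
    finally show ?thesis using a(3) by (simp add: 1 trm_Inl)
  next
    case (2 l i)
    then have i: "i \<in> {1..n}" using v by (auto simp: terms_def)
    \<comment> \<open>Centering is the special case of a constant factor, which depends on no
      coordinate.\<close>
    have "(\<integral>x. 1 * h l (x (\<pi> l i)) (x (\<pi> l (nxt n i))) \<partial>data n) = 0"
      by (rule degenerate_product[where S = "{}" and B = 1]) (use i in \<open>auto simp: depends_on_def\<close>)
    then show ?thesis by (simp add: 2 trm_Inr)
  qed
  \<comment> \<open>A vertex term fits this form with \<open>b = c\<close>. At most two coordinates
    per support account for the factor 2 in the degree.\<close>
  obtain b c where bc: "supp v = {b, c}"
    by (cases v rule: supp.cases) auto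
  have "{u \<in> terms. supp u \<inter> supp v \<noteq> {}} \<subseteq> {u \<in> terms. b \<in> supp u} \<union> {u \<in> terms. c \<in> supp u}" by (auto simp: bc)
  then have "card {u \<in> terms. supp u \<inter> supp v \<noteq> {}} \<le> card ({u \<in> terms. b \<in> supp u} \<union> {u \<in> terms. c \<in> supp u})"
    by (intro card_mono) (auto simp: terms_def)
  also have "\<dots> \<le> card {u \<in> terms. b \<in> supp u} + card {u \<in> terms. c \<in> supp u}" by (rule card_Un_le)
  also have "\<dots> \<le> (1 + 2 * CARD('d)) + (1 + 2 * CARD('d))" by (intro add_mono card_terms_at)
  finally show "card {u \<in> terms. supp u \<inter> supp v \<noteq> {}} \<le> 2 * (1 + 2 * CARD('d))" by simp
next
  show "0 \<le> C / sqrt (real n)" using C_nonneg by simp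
qed (use prob_P in auto)

interpretation dt: dependent_terms P "{1..n}" terms supp trm "C / sqrt (real n)" "2 * (1 + 2 * CARD('d))"
  by (rule dependent_terms_all)

definition "va = (\<integral>x. (a x)\<^sup>2 \<partial>P)"
definition "vh l = (\<integral>z. (h l (fst z) (snd z))\<^sup>2 \<partial>(P \<Otimes>\<^sub>M P))"

lemma pcov_II:
  assumes "i \<in> {1..n}" "j \<in> {1..n}"
  shows "dt.pcov (Inl i) (Inl j) = (if i = j then va / n else 0)"
proof (cases "i = j")
  case True
  have "(\<integral>x. (a (x i))\<^sup>2 \<partial>data n) = (\<integral>y. (a y)\<^sup>2 \<partial>distr (data n) P (\<lambda>x. x i))"
    using assms a(1) by (intro integral_distr[symmetric] measurable_component_singleton) (auto simp: measurable_cong_sets[OF sets_P refl])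
  also have "distr (data n) P (\<lambda>x. x i) = P" using assms prob_P by (intro distr_PiM_component) auto
  finally show ?thesis using True by (simp add: dt.pcov_def va_def power2_eq_square)
next
  case False
  then show ?thesis using dt.pcov_zero[of "Inl i" "Inl j"] assms by (auto simp: in_terms)
qed

lemma pcov_scale: "dt.pcov v (Inr (l, i)) = (\<integral>x. trm v x * h l (x (\<pi> l i)) (x (\<pi> l (nxt n i))) \<partial>data n) / sqrt (real n)"
  by (simp add: dt.pcov_def)

text \<open>The other term serves as the bounded factor \<open>F\<close>. A vertex term can never
  contain an edge in its support, and an edge term does so only if both edges have the same
  endpoints.\<close>

lemma pcov_zero_of_supp:
  assumes "v \<in> terms" "i \<in> {1..n}" "\<not> {\<pi> l i, \<pi> l (nxt n i)} \<subseteq> supp v"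
  shows "dt.pcov v (Inr (l, i)) = 0"
  unfolding pcov_scale
  using degenerate_product[OF trm_measurable[OF assms(1)] trm_bound dt.dep[OF assms(1)] assms(2) dt.s_sub[OF assms(1)] assms(3)]
  by simp

lemma pcov_sym: "dt.pcov u v = dt.pcov v u"
  by (simp add: dt.pcov_def mult.commute)

lemma pcov_IE:
  assumes "i \<in> {1..n}" "e \<in> UNIV \<times> {1..n}"
  shows "dt.pcov (Inl i) (Inr e) = 0"
proof -
  obtain l j where e: "e = (l, j)" "j \<in> {1..n}" using assms(2) by (cases e) auto
  show ?thesis unfolding e(1)
    by (rule pcov_zero_of_supp) (use assms(1) e edge_in[OF e(2), of l] in \<open>auto simp: terms_def\<close>)
qed

lemma pcov_EE_diag:
  assumes "i \<in> {1..n}" shows "dt.pcov (Inr (l, i)) (Inr (l, i)) = vh l / n"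
proof -
  have "(\<integral>x. (h l (x (\<pi> l i)) (x (\<pi> l (nxt n i))))\<^sup>2 \<partial>data n) = vh l"
    unfolding vh_def
  proof (rule PiM_integral_coord2[OF prob_P, of _ _ _ "\<lambda>x y. (h l x y)\<^sup>2" "C\<^sup>2"])
    show "(\<lambda>(x, y). (h l x y)\<^sup>2) \<in> borel_measurable (P \<Otimes>\<^sub>M P)" using h(1)[of l] by (simp add: split_beta')
    show "norm ((h l x y)\<^sup>2) \<le> C\<^sup>2" for x y using h(2)[of l x y] by (simp add: abs_le_square_iff[symmetric] C_nonneg)
  qed (use edge_in[OF assms, of l] in auto)
  then show ?thesis by (simp add: dt.pcov_def power2_eq_square)
qed

text \<open>Edges sharing a single vertex are dependent but uncorrelated, by degeneracy. Distinct
  positions of one cycle carry distinct edges for \<open>n \<ge> 3\<close>, so only coincidences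
  between different cycles remain.\<close>

lemma pcov_EE_off:
  assumes i: "i \<in> {1..n}" "j \<in> {1..n}" and ne: "(l, i) \<noteq> (l', j)"
  shows "\<bar>dt.pcov (Inr (l, i)) (Inr (l', j))\<bar> \<le> C\<^sup>2 / n * of_bool (l \<noteq> l' \<and> same_edge n (\<pi> l) i (\<pi> l') j)"
proof (cases "same_edge n (\<pi> l) i (\<pi> l') j")
  case True
  have "l \<noteq> l'"
  proof
    assume l: "l = l'"
    then have "\<pi> l ` {i, nxt n i} = \<pi> l ` {j, nxt n j}" using True by (simp add: same_edge_def)
    moreover have "inj (\<pi> l)" using perms_eq_iff[OF \<pi>] by (auto simp: inj_def)
    ultimately have "{i, nxt n i} = {j, nxt n j}" by (simp only: inj_image_eq_iff)
    then show False using edge_eq_imp_eq[OF n i] ne l by auto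
  qed
  then show ?thesis using True dt.pcov_bound[of "Inr (l, i)" "Inr (l', j)"] i by (auto simp: in_terms power_divide)
next
  case False
  have "\<not> {\<pi> l' j, \<pi> l' (nxt n j)} \<subseteq> {\<pi> l i, \<pi> l (nxt n i)}"
  proof
    assume "{\<pi> l' j, \<pi> l' (nxt n j)} \<subseteq> {\<pi> l i, \<pi> l (nxt n i)}"
    then have "{\<pi> l' j, \<pi> l' (nxt n j)} = {\<pi> l i, \<pi> l (nxt n i)}"
      using edge_in[OF i(1), of l] edge_in[OF i(2), of l'] by auto
    then show False using False by (simp add: same_edge_def)
  qed
  then have "dt.pcov (Inr (l, i)) (Inr (l', j)) = 0" using i by (intro pcov_zero_of_supp) (auto simp: terms_def)
  then show ?thesis by simp
qed

text \<open>The \<open>n\<close> diagonal entries of each kind sum exactly to the limiting variance;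
  every coincidence adds an error of at most \<open>C\<^sup>2 / n\<close>.\<close>

lemma var_approx: "\<bar>dt.var - (va + (\<Sum>l\<in>UNIV. vh l))\<bar> \<le> C\<^sup>2 / n * coinc n \<pi>"
proof -
  let ?E = "(UNIV :: 'd set) \<times> {1..n}"
  have n0: "real n \<noteq> 0" using n by simp
  have "dt.var = (\<Sum>i=1..n. \<Sum>j=1..n. dt.pcov (Inl i) (Inl j)) + (\<Sum>i=1..n. \<Sum>e\<in>?E. dt.pcov (Inl i) (Inr e))
      + ((\<Sum>e\<in>?E. \<Sum>i=1..n. dt.pcov (Inr e) (Inl i)) + (\<Sum>e\<in>?E. \<Sum>e'\<in>?E. dt.pcov (Inr e) (Inr e')))"
    unfolding dt.var_def sum_terms by (simp add: sum.distrib)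
  also have "(\<Sum>i=1..n. \<Sum>j=1..n. dt.pcov (Inl i) (Inl j)) = va"
    using n0 by (simp add: pcov_II)
  also have "(\<Sum>i=1..n. \<Sum>e\<in>?E. dt.pcov (Inl i) (Inr e)) = 0" by (intro sum.neutral ballI pcov_IE)
  also have "(\<Sum>e\<in>?E. \<Sum>i=1..n. dt.pcov (Inr e) (Inl i)) = 0"
    unfolding pcov_sym[of "Inr _" "Inl _"] by (intro sum.neutral ballI pcov_IE)
  finally have v: "dt.var = va + (\<Sum>e\<in>?E. \<Sum>e'\<in>?E. dt.pcov (Inr e) (Inr e'))" by simp
  have "(\<Sum>l\<in>UNIV. vh l) = (\<Sum>e\<in>?E. vh (fst e) / n)"
    using n0 by (simp add: sum.cartesian_product')
  also have "\<dots> = (\<Sum>e\<in>?E. \<Sum>e'\<in>?E. if e = e' then vh (fst e) / n else 0)" by simp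
  finally have "dt.var - (va + (\<Sum>l\<in>UNIV. vh l)) =
      (\<Sum>e\<in>?E. \<Sum>e'\<in>?E. dt.pcov (Inr e) (Inr e') - (if e = e' then vh (fst e) / n else 0))"
    unfolding v sum_subtractf by simp
  also have "\<bar>\<dots>\<bar> \<le> (\<Sum>e\<in>?E. \<Sum>e'\<in>?E. \<bar>dt.pcov (Inr e) (Inr e') - (if e = e' then vh (fst e) / n else 0)\<bar>)"
    by (rule order_trans[OF sum_abs]) (intro sum_mono sum_abs)
  also have "\<dots> \<le> (\<Sum>e\<in>?E. \<Sum>e'\<in>?E. C\<^sup>2 / n * of_bool (fst e \<noteq> fst e' \<and> same_edge n (\<pi> (fst e)) (snd e) (\<pi> (fst e')) (snd e')))"
  proof (intro sum_mono)
    fix e e' assume e: "e \<in> ?E" "e' \<in> ?E"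
    obtain l i l' j where ll: "e = (l, i)" "e' = (l', j)" by (cases e; cases e') auto
    have ij: "i \<in> {1..n}" "j \<in> {1..n}" using e ll by auto
    show "\<bar>dt.pcov (Inr e) (Inr e') - (if e = e' then vh (fst e) / n else 0)\<bar> \<le> C\<^sup>2 / n * of_bool (fst e \<noteq> fst e' \<and> same_edge n (\<pi> (fst e)) (snd e) (\<pi> (fst e')) (snd e'))"
    proof (cases "e = e'")
      case True
      then show ?thesis using pcov_EE_diag[OF ij(1), of l] ll by simp
    next
      case False
      then show ?thesis using pcov_EE_off[OF ij, of l l'] by (auto simp: ll)
    qed
  qed
  also have "\<dots> = C\<^sup>2 / n * coinc n \<pi>" by (simp only: coinc_def sum_distrib_left)
  finally show ?thesis .
qed

text \<open>The normal approximation at the actual variance is combined with the replacement of that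
  variance by its limit. With \<open>n * (1 + CARD('d))\<close> terms, degree
  \<open>2 * (1 + 2 * CARD('d))\<close> and bound \<open>C / sqrt n\<close>, the first error becomes
  the stated multiple of \<open>1 / sqrt n\<close>.\<close>

lemma conditional_char_approx:
  "cmod ((\<integral>x. iexp ((\<Sum>i=1..n. a (x i)) / sqrt n + (\<Sum>l\<in>UNIV. (\<Sum>i=1..n. h l (x (\<pi> l i)) (x (\<pi> l (nxt n i)))) / sqrt n)) \<partial>data n)
     - exp (- ((\<integral>x. (a x)\<^sup>2 \<partial>P) + (\<Sum>l\<in>UNIV. \<integral>z. (h l (fst z) (snd z))\<^sup>2 \<partial>(P \<Otimes>\<^sub>M P))) / 2))
   \<le> 16 * (1 + CARD('d)) * (1 + 2 * CARD('d))\<^sup>2 * C ^ 3 / sqrt n + C\<^sup>2 / n * coinc n \<pi>"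
proof -
  have W: "dt.W x = (\<Sum>i=1..n. a (x i)) / sqrt n + (\<Sum>l\<in>UNIV. (\<Sum>i=1..n. h l (x (\<pi> l i)) (x (\<pi> l (nxt n i)))) / sqrt n)" for x
    unfolding dt.W_def sum_terms by (simp add: sum_divide_distrib sum.cartesian_product')
  have v0: "0 \<le> va + (\<Sum>l\<in>UNIV. vh l)" by (auto simp: va_def vh_def intro!: add_nonneg_nonneg sum_nonneg)
  \<comment> \<open>Lipschitz continuity of \<open>exp (- s / 2)\<close> on the nonnegative
    half-line, which transfers the variance error to the characteristic function.\<close>
  have ex: "\<bar>exp (- s / 2) - exp (- t / 2)\<bar> \<le> \<bar>s - t\<bar>" if "0 \<le> s" "0 \<le> t" for s t :: real
  proof -
    have *: "\<bar>exp (- s / 2) - exp (- t / 2)\<bar> \<le> \<bar>s - t\<bar>" if "0 \<le> s" "s \<le> t" for s t :: real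
    proof -
      have "exp (- s / 2) - exp (- t / 2) = exp (- s / 2) * (1 - exp (- (t - s) / 2))"
        by (simp add: right_diff_distrib exp_add[symmetric] field_simps)
      also have "\<dots> \<le> 1 * (1 - exp (- (t - s) / 2))" using that by (intro mult_right_mono) auto
      also have "\<dots> \<le> (t - s) / 2" using exp_ge_add_one_self[of "(s - t) / 2"] by (simp add: field_simps)
      finally show ?thesis using that by simp
    qed
    show ?thesis using *[of s t] *[of t s] that by (cases "s \<le> t") (auto simp: abs_minus_commute)
  qed
  have cardV: "card terms = n * (1 + CARD('d))" by (simp add: terms_def card_Plus algebra_simps)
  have "cmod ((\<integral>x. iexp (dt.W x) \<partial>data n) - exp (- (va + (\<Sum>l\<in>UNIV. vh l)) / 2))
    \<le> cmod ((\<integral>x. iexp (dt.W x) \<partial>data n) - exp (- dt.var / 2)) + \<bar>exp (- dt.var / 2) - exp (- (va + (\<Sum>l\<in>UNIV. vh l)) / 2)\<bar>"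
    unfolding norm_of_real[symmetric, where 'a = complex] of_real_diff by (rule norm_diff_triangle_le[OF order_refl order_refl])
  also have "\<dots> \<le> 4 * real (card terms) * (real (2 * (1 + 2 * CARD('d))))\<^sup>2 * (C / sqrt n) ^ 3 + \<bar>dt.var - (va + (\<Sum>l\<in>UNIV. vh l))\<bar>"
    by (intro add_mono dt.char_normal_approx ex dt.var_nonneg v0)
  also have "\<dots> \<le> 16 * (1 + CARD('d)) * (1 + 2 * CARD('d))\<^sup>2 * C ^ 3 / sqrt n + C\<^sup>2 / n * coinc n \<pi>"
  proof (rule add_mono[OF _ var_approx])
    have s3: "sqrt n ^ 3 = n * sqrt n" by (simp add: power3_eq_cube)
    have r2: "(real (2 * (1 + 2 * CARD('d))))\<^sup>2 = 4 * (real (1 + 2 * CARD('d)))\<^sup>2"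
      by (simp add: power2_eq_square algebra_simps)
    have "4 * real (card terms) * (real (2 * (1 + 2 * CARD('d))))\<^sup>2 * (C / sqrt n) ^ 3 =
        4 * (real n * real (1 + CARD('d))) * (4 * (real (1 + 2 * CARD('d)))\<^sup>2) * (C ^ 3 / (n * sqrt n))"
      by (simp only: cardV r2 power_divide s3) (simp only: of_nat_mult)
    also have "\<dots> = 16 * (1 + CARD('d)) * (1 + 2 * CARD('d))\<^sup>2 * C ^ 3 / sqrt n" using n by simp
    finally show "4 * real (card terms) * (real (2 * (1 + 2 * CARD('d))))\<^sup>2 * (C / sqrt n) ^ 3 \<le> 16 * (1 + CARD('d)) * (1 + 2 * CARD('d))\<^sup>2 * C ^ 3 / sqrt n"
      by simp
  qed
  finally show ?thesis unfolding W va_def vh_def .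
qed

end

end

section \<open>Random permutations and empirical measures\<close>

lemma pair_integral_mult:
  fixes f :: "'a \<Rightarrow> complex" and g :: "'b \<Rightarrow> complex"
  assumes M: "prob_space M1" "prob_space M2"
    and f: "f \<in> borel_measurable M1" "\<And>x. norm (f x) \<le> 1" and g: "g \<in> borel_measurable M2" "\<And>x. norm (g x) \<le> 1"
  shows "(\<integral>z. f (fst z) * g (snd z) \<partial>(M1 \<Otimes>\<^sub>M M2)) = integral\<^sup>L M1 f * integral\<^sup>L M2 g"
proof -
  interpret M1: prob_space M1 by fact
  interpret M2: prob_space M2 by fact
  interpret pair_prob_space M1 M2 ..
  note [measurable] = f(1) g(1)
  have "integrable (M1 \<Otimes>\<^sub>M M2) (\<lambda>(x, y). f x * g y)"
    by (rule integrable_bounded[of _ 1]) (auto simp: norm_mult intro!: mult_le_one f g)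
  from integral_fst[OF this] show ?thesis by (simp add: split_beta')
qed

lemma (in prob_space) integrable_iexp_real:
  fixes f :: "'a \<Rightarrow> real"
  assumes [measurable]: "f \<in> borel_measurable M"
  shows "integrable M (\<lambda>x. iexp (f x))"
  by (rule integrable_bounded[of _ 1]) auto

text \<open>Slutsky's theorem at the level of characteristic functions: the exponentials differ by
  at most \<open>\<bar>Y n \<omega> - Z n \<omega>\<bar>\<close>, and by at most 2 on the
  exceptional event.\<close>

lemma integral_iexp_diff_tendsto_0:
  fixes M :: "nat \<Rightarrow> 'w measure" and Y Z :: "nat \<Rightarrow> 'w \<Rightarrow> real"
  assumes prob: "\<And>n. prob_space (M n)"
    and meas: "\<And>n. Y n \<in> borel_measurable (M n)" "\<And>n. Z n \<in> borel_measurable (M n)"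
    and conv: "\<And>\<epsilon>. 0 < \<epsilon> \<Longrightarrow> (\<lambda>n. measure (M n) {\<omega> \<in> space (M n). \<epsilon> < \<bar>Y n \<omega> - Z n \<omega>\<bar>}) \<longlonglongrightarrow> 0"
  shows "(\<lambda>n. (\<integral>\<omega>. iexp (Y n \<omega>) \<partial>M n) - (\<integral>\<omega>. iexp (Z n \<omega>) \<partial>M n)) \<longlonglongrightarrow> 0"
  unfolding tendsto_iff dist_0_norm
proof (intro allI impI)
  fix r :: real assume r: "0 < r"
  have "eventually (\<lambda>n. measure (M n) {\<omega> \<in> space (M n). r / 4 < \<bar>Y n \<omega> - Z n \<omega>\<bar>} < r / 4) sequentially"
    using conv[of "r / 4"] r by (intro order_tendstoD) auto
  then show "eventually (\<lambda>n. dist ((\<integral>\<omega>. iexp (Y n \<omega>) \<partial>M n) - (\<integral>\<omega>. iexp (Z n \<omega>) \<partial>M n)) 0 < r) sequentially"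
  proof eventually_elim
    case (elim n)
    interpret prob_space "M n" by (rule prob)
    note [measurable] = meas[of n]
    define A where "A = {\<omega> \<in> space (M n). r / 4 < \<bar>Y n \<omega> - Z n \<omega>\<bar>}"
    have A: "A \<in> sets (M n)" unfolding A_def by measurable
    have iA: "integrable (M n) (indicator A :: 'w \<Rightarrow> real)" using A by (simp add: emeasure_finite less_top[symmetric])
    have i: "integrable (M n) (\<lambda>\<omega>. iexp (Y n \<omega>))" "integrable (M n) (\<lambda>\<omega>. iexp (Z n \<omega>))"
      by (auto intro!: integrable_bounded[of _ 1])
    have "norm ((\<integral>\<omega>. iexp (Y n \<omega>) \<partial>M n) - (\<integral>\<omega>. iexp (Z n \<omega>) \<partial>M n)) = norm (\<integral>\<omega>. iexp (Y n \<omega>) - iexp (Z n \<omega>) \<partial>M n)"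
      using i by simp
    also have "\<dots> \<le> (\<integral>\<omega>. norm (iexp (Y n \<omega>) - iexp (Z n \<omega>)) \<partial>M n)" by (rule integral_norm_bound)
    also have "\<dots> \<le> (\<integral>\<omega>. r / 4 + 2 * indicator A \<omega> \<partial>M n)"
    proof (rule integral_mono)
      show "integrable (M n) (\<lambda>\<omega>. norm (iexp (Y n \<omega>) - iexp (Z n \<omega>)))" using i by (intro integrable_norm Bochner_Integration.integrable_diff)
      show "integrable (M n) (\<lambda>\<omega>. r / 4 + 2 * indicator A \<omega>)" using iA by auto
      fix \<omega> assume \<omega>: "\<omega> \<in> space (M n)"
      show "norm (iexp (Y n \<omega>) - iexp (Z n \<omega>)) \<le> r / 4 + 2 * indicator A \<omega>"
      proof (cases "\<omega> \<in> A")
        case True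
        have "norm (iexp (Y n \<omega>) - iexp (Z n \<omega>)) \<le> norm (iexp (Y n \<omega>)) + norm (iexp (Z n \<omega>))" by (rule norm_triangle_ineq4)
        also have "\<dots> = 2" by simp
        finally show ?thesis using True r by simp
      next
        case False
        then have "\<bar>Y n \<omega> - Z n \<omega>\<bar> \<le> r / 4" using \<omega> by (auto simp: A_def)
        then show ?thesis using norm_iexp_diff_le[of "Y n \<omega>" "Z n \<omega>"] False by simp
      qed
    qed
    also have "\<dots> = r / 4 + 2 * measure (M n) A" using iA A by (simp add: prob_space)
    also have "\<dots> < r" using elim r by (simp add: A_def)
    finally show ?case by (simp add: dist_norm)
  qed
qed

lemma conv_distr_of_char:
  fixes Y :: "nat \<Rightarrow> 'w \<Rightarrow> 'b::euclidean_space"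
  assumes M: "\<And>n. prob_space (M n)" and Y: "\<And>n. Y n \<in> borel_measurable (M n)"
    and L: "prob_space L" "sets L = sets borel"
    and conv: "\<And>t. (\<lambda>n. \<integral>\<omega>. iexp (t \<bullet> Y n \<omega>) \<partial>M n) \<longlonglongrightarrow> (\<integral>y. iexp (t \<bullet> y) \<partial>L)"
  shows "conv_distr M Y L"
proof -
  have e: "(\<integral>y. f y \<partial>distr (M n) borel (Y n)) = (\<integral>\<omega>. f (Y n \<omega>) \<partial>M n)" if "continuous_on UNIV f" for n and f :: "'b \<Rightarrow> real"
    by (intro integral_distr Y borel_measurable_continuous_onI that)
  have "weak_conv (\<lambda>n. distr (M n) borel (Y n)) L"
  proof (rule weak_conv_of_char)
    show "prob_space (distr (M n) borel (Y n))" for n using M Y by (rule prob_space.prob_space_distr)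
    fix t
    have "(\<integral>y. iexp (t \<bullet> y) \<partial>distr (M n) borel (Y n)) = (\<integral>\<omega>. iexp (t \<bullet> Y n \<omega>) \<partial>M n)" for n
      by (intro integral_distr Y borel_measurable_continuous_onI continuous_intros)
    then show "(\<lambda>n. \<integral>y. iexp (t \<bullet> y) \<partial>distr (M n) borel (Y n)) \<longlonglongrightarrow> (\<integral>y. iexp (t \<bullet> y) \<partial>L)" using conv by simp
  qed (use L in auto)
  then show ?thesis using L Y e unfolding conv_distr_def weak_conv_def by auto
qed

text \<open>Needed because ties among the differences are atoms of higher weight: the mass function
  is summed over distinct points, while empirical averages run over indices.\<close>

lemma sum_count_scaleR_mset:
  fixes f :: "'a \<Rightarrow> 'b::real_vector"
  assumes "finite A" "set_mset B \<subseteq> A"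
  shows "(\<Sum>a\<in>A. real (count B a) *\<^sub>R f a) = (\<Sum>a\<in>#B. f a)"
  using assms(2)
proof (induction B)
  case (add x B)
  have "(\<Sum>a\<in>A. real (count (add_mset x B) a) *\<^sub>R f a) = (\<Sum>a\<in>A. (if x = a then f a else 0) + real (count B a) *\<^sub>R f a)"
    by (intro sum.cong refl) (auto simp: scaleR_add_left)
  also have "\<dots> = f x + (\<Sum>a\<in>#B. f a)" using add assms(1) by (simp add: sum.distrib sum.delta)
  finally show ?case by simp
qed simp

lemma sym_emp_integral:
  fixes f :: "real^'q \<Rightarrow> 'b::{banach,second_countable_topology}"
  assumes n: "1 \<le> n" and f: "f \<in> borel_measurable borel"
  shows "integral\<^sup>L (sym_emp n z) f = (1 / (2 * real n)) *\<^sub>R (\<Sum>i=1..n. f (z i) + f (- z i))"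
proof -
  define B where "B = image_mset z (mset_set {1..n}) + image_mset (\<lambda>i. - z i) (mset_set {1..n})"
  have B: "B \<noteq> {#}" "size B = 2 * n" using n by (auto simp: B_def mset_set_empty_iff)
  have "integral\<^sup>L (sym_emp n z) f = (\<integral>x. f x \<partial>measure_pmf (pmf_of_multiset B))"
    unfolding sym_emp_def B_def[symmetric] by (rule integral_distr) (use f in auto)
  also have "\<dots> = (\<Sum>a\<in>set_mset B. pmf (pmf_of_multiset B) a *\<^sub>R f a)"
    by (rule integral_measure_pmf) (auto simp: set_pmf_of_multiset[OF B(1)])
  also have "\<dots> = (1 / (2 * real n)) *\<^sub>R (\<Sum>a\<in>set_mset B. real (count B a) *\<^sub>R f a)"
    by (simp add: pmf_of_multiset[OF B(1)] B(2) scaleR_sum_right)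
  also have "(\<Sum>a\<in>set_mset B. real (count B a) *\<^sub>R f a) = (\<Sum>a\<in>#B. f a)" by (rule sum_count_scaleR_mset) auto
  also have "\<dots> = (\<Sum>i=1..n. f (z i) + f (- z i))"
    unfolding B_def by (simp add: sum.distrib sum_unfold_sum_mset image_mset.compositionality o_def)
  finally show ?thesis .
qed

lemma probdist_sym_emp: "probdist (sym_emp n z)"
  unfolding probdist_def sym_emp_def
  by (auto intro!: prob_space.prob_space_distr prob_space_measure_pmf)

lemma sym_emp_atom_zero:
  assumes n: "1 \<le> n" and z: "\<And>i. i \<in> {1..n} \<Longrightarrow> z i \<noteq> 0"
  shows "emeasure (sym_emp n z) {0} = 0"
proof -
  define B where "B = image_mset z (mset_set {1..n}) + image_mset (\<lambda>i. - z i) (mset_set {1..n})"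
  have B: "B \<noteq> {#}" using n by (auto simp: B_def mset_set_empty_iff)
  have "0 \<notin> set_mset B" using z by (auto simp: B_def)
  then have "pmf (pmf_of_multiset B) 0 = 0" using B by (simp add: pmf_of_multiset not_in_iff)
  then show ?thesis unfolding sym_emp_def B_def[symmetric]
    by (subst emeasure_distr) (auto simp: emeasure_pmf_single)
qed

context sampling
begin

section \<open>Averaging over the permutations\<close>

lemma pair_prob_sample: "pair_prob_space (data n) (perm_law T n)"
  unfolding pair_prob_space_def pair_sigma_finite_def
  by (auto intro!: prob_space_imp_sigma_finite prob_data prob_space_perm_law)

lemma prob_sample: "prob_space (sample P T n)"
proof -
  interpret S: pair_prob_space "data n" "perm_law T n" by (rule pair_prob_sample)
  show ?thesis unfolding sample_def by (rule S.P.prob_space_axioms)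
qed

lemma sample_coord_measurable: "(\<lambda>\<omega>. fst \<omega> k) \<in> borel_measurable (sample P T n)"
proof (cases "k \<in> {1..n}")
  case True
  show ?thesis unfolding sample_def
    by (rule measurable_compose[OF measurable_fst coord_measurable[OF True]])
next
  \<comment> \<open>Outside \<open>{1..n}\<close> a point of the product space takes the fixed value
    \<open>undefined\<close>. Measurability for every index is required because the index will be a
    random natural number.\<close>
  case False
  have "(\<lambda>\<omega>. fst \<omega> k) \<in> borel_measurable (sample P T n) \<longleftrightarrow> (\<lambda>\<omega>. undefined :: real^'q) \<in> borel_measurable (sample P T n)"
    by (rule measurable_cong) (use False in \<open>auto simp: sample_def space_pair_measure space_PiM PiE_def extensional_def\<close>)
  then show ?thesis by simp
qed

lemma sample_perm_measurable: "(\<lambda>\<omega>. snd \<omega> l i) \<in> measurable (sample P (T :: 'd::finite itself) n) (count_space UNIV)"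
  unfolding sample_def by (rule measurable_compose[OF measurable_snd perm_law_value_measurable])

lemma sample_value_measurable [measurable]:
  "(\<lambda>\<omega>. fst \<omega> (snd \<omega> l i)) \<in> borel_measurable (sample P (T :: 'd::finite itself) n)"
  by (rule measurable_compose_countable[OF sample_coord_measurable sample_perm_measurable])

text \<open>Conditioning on the permutations through Fubini. The bound is asked for genuine
  permutations only; they are drawn almost surely, although the sample space contains all
  functions.\<close>

lemma sample_integral_le:
  fixes f :: "_ \<Rightarrow> 'b::{banach,second_countable_topology}" and T :: "'d::finite itself"
  assumes f: "integrable (sample P T n) f" and b: "integrable (perm_law T n) b"
    and le: "\<And>\<pi>. (\<And>l. \<pi> l \<in> perms n) \<Longrightarrow> norm (\<integral>x. f (x, \<pi>) \<partial>data n) \<le> b \<pi>"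
  shows "norm (integral\<^sup>L (sample P T n) f) \<le> integral\<^sup>L (perm_law T n) b"
proof -
  interpret S: pair_prob_space "data n" "perm_law T n" by (rule pair_prob_sample)
  have f': "integrable (data n \<Otimes>\<^sub>M perm_law T n) (\<lambda>(x, y). f (x, y))" using f by (simp add: sample_def)
  have "integral\<^sup>L (sample P T n) f = (\<integral>\<pi>. (\<integral>x. f (x, \<pi>) \<partial>data n) \<partial>perm_law T n)"
    using S.integral_snd[OF f'] by (simp add: sample_def)
  also have "norm \<dots> \<le> (\<integral>\<pi>. norm (\<integral>x. f (x, \<pi>) \<partial>data n) \<partial>perm_law T n)" by (rule integral_norm_bound)
  also have "\<dots> \<le> integral\<^sup>L (perm_law T n) b"
  proof (rule integral_mono_AE)
    show "integrable (perm_law T n) (\<lambda>\<pi>. norm (\<integral>x. f (x, \<pi>) \<partial>data n))" using S.integrable_snd[OF f'] by (rule integrable_norm)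
    show "AE \<pi> in perm_law T n. norm (\<integral>x. f (x, \<pi>) \<partial>data n) \<le> b \<pi>" using AE_perm_law by eventually_elim (rule le, simp)
  qed (rule b)
  finally show ?thesis .
qed

lemma AE_sample_perms: "AE \<omega> in sample P (T :: 'd::finite itself) n. \<forall>l. snd \<omega> l \<in> perms n"
proof -
  interpret S: pair_prob_space "data n" "perm_law T n" by (rule pair_prob_sample)
  have D: "distr (sample P T n) (perm_law T n) snd = perm_law T n"
  proof (rule measure_eqI)
    fix A assume "A \<in> sets (distr (sample P T n) (perm_law T n) snd)"
    then have A: "A \<in> sets (perm_law T n)" by simp
    have "snd -` A \<inter> space (sample P T n) = space (data n) \<times> A"
      using sets.sets_into_space[OF A] by (auto simp: sample_def space_pair_measure)
    then show "emeasure (distr (sample P T n) (perm_law T n) snd) A = emeasure (perm_law T n) A"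
      using A by (simp add: emeasure_distr sample_def S.M2.emeasure_pair_measure_Times S.M1.emeasure_space_1)
  qed simp
  have m: "snd \<in> measurable (sample P T n) (perm_law T n)" unfolding sample_def by (rule measurable_snd)
  show ?thesis by (rule AE_distrD[OF m]) (unfold D, rule AE_perm_law)
qed

lemma coinc_integrable:
  fixes T :: "'d::finite itself"
  shows "integrable (perm_law T n) (coinc n)"
proof -
  interpret K: prob_space "perm_law T n" by (rule prob_space_perm_law)
  let ?E = "(UNIV :: 'd set) \<times> {1..n}"
  let ?f = "\<lambda>e e' \<pi>. of_bool (fst e \<noteq> fst e' \<and> same_edge n (\<pi> (fst e)) (snd e) (\<pi> (fst e')) (snd e')) :: real"
  have i: "integrable (perm_law T n) (?f e e')" for e e'
    by (rule K.integrable_bounded[of _ 1]) auto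
  show "integrable (perm_law T n) (coinc n)"
    unfolding coinc_def[abs_def] using i by (intro Bochner_Integration.integrable_sum)
qed

text \<open>There are at most \<open>(CARD('d) * n)\<^sup>2\<close> ordered pairs of edges, each
  coinciding with probability at most \<open>2 / (n * (n - 1))\<close>, and
  \<open>2 * n / (n - 1) \<le> 4\<close> for \<open>n \<ge> 2\<close>.\<close>

lemma integral_coinc_le:
  fixes T :: "'d::finite itself"
  assumes n: "2 \<le> n"
  shows "integral\<^sup>L (perm_law T n) (coinc n) \<le> 4 * (real CARD('d))\<^sup>2"
proof -
  interpret K: prob_space "perm_law T n" by (rule prob_space_perm_law)
  let ?E = "(UNIV :: 'd set) \<times> {1..n}"
  let ?f = "\<lambda>e e' \<pi>. of_bool (fst e \<noteq> fst e' \<and> same_edge n (\<pi> (fst e)) (snd e) (\<pi> (fst e')) (snd e')) :: real"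
  have i: "integrable (perm_law T n) (?f e e')" for e e'
    by (rule K.integrable_bounded[of _ 1]) auto
  have "integral\<^sup>L (perm_law T n) (coinc n) = (\<Sum>e\<in>?E. \<Sum>e'\<in>?E. integral\<^sup>L (perm_law T n) (?f e e'))"
  proof -
    have "integral\<^sup>L (perm_law T n) (coinc n) = (\<Sum>e\<in>?E. integral\<^sup>L (perm_law T n) (\<lambda>\<pi>. \<Sum>e'\<in>?E. ?f e e' \<pi>))"
      unfolding coinc_def[abs_def] by (intro Bochner_Integration.integral_sum Bochner_Integration.integrable_sum i)
    also have "\<dots> = (\<Sum>e\<in>?E. \<Sum>e'\<in>?E. integral\<^sup>L (perm_law T n) (?f e e'))"
      by (intro sum.cong refl Bochner_Integration.integral_sum i)
    finally show ?thesis .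
  qed
  also have "\<dots> \<le> (\<Sum>e\<in>?E. \<Sum>e'\<in>?E. 2 / (real n * (real n - 1)))"
  proof (intro sum_mono)
    fix e e' assume e: "e \<in> ?E" "e' \<in> ?E"
    show "integral\<^sup>L (perm_law T n) (?f e e') \<le> 2 / (real n * (real n - 1))"
    proof (cases "fst e = fst e'")
      case True
      then show ?thesis using n by simp
    next
      case False
      then show ?thesis using integral_same_edge_le[OF n _ False, of "snd e'" "snd e"] e by auto
    qed
  qed
  also have "\<dots> = (real CARD('d))\<^sup>2 * (2 * real n / (real n - 1))"
    using n by (simp add: card_cartesian_product power2_eq_square field_simps)
  also have "\<dots> \<le> (real CARD('d))\<^sup>2 * 4"
    using n by (intro mult_left_mono) (simp_all add: field_simps)
  finally show ?thesis by (simp only: mult.commute)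
qed

text \<open>The limit does not involve the permutations, so subtracting it before integrating
  reduces everything to the conditional bound. Its only random part is \<open>coinc\<close>, of
  bounded mean and with weight \<open>C\<^sup>2 / n\<close>.\<close>

lemma joint_char_limit:
  fixes a :: "real^'q \<Rightarrow> real" and h :: "'d::finite \<Rightarrow> real^'q \<Rightarrow> real^'q \<Rightarrow> real"
  assumes a: "a \<in> borel_measurable borel" "\<And>x. \<bar>a x\<bar> \<le> C" "(\<integral>x. a x \<partial>P) = 0"
    and h: "\<And>l. (\<lambda>(x, y). h l x y) \<in> borel_measurable (P \<Otimes>\<^sub>M P)" "\<And>l x y. \<bar>h l x y\<bar> \<le> C"
      "\<And>l x y. h l x y = h l y x" "\<And>l x. (\<integral>y. h l x y \<partial>P) = 0"
  shows "(\<lambda>n. \<integral>\<omega>. iexp ((\<Sum>i=1..n. a (fst \<omega> i)) / sqrt n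
            + (\<Sum>l\<in>UNIV. (\<Sum>i=1..n. h l (fst \<omega> (snd \<omega> l i)) (fst \<omega> (snd \<omega> l (nxt n i)))) / sqrt n)) \<partial>sample P TYPE('d) n)
       \<longlonglongrightarrow> exp (- ((\<integral>x. (a x)\<^sup>2 \<partial>P) + (\<Sum>l\<in>UNIV. \<integral>z. (h l (fst z) (snd z))\<^sup>2 \<partial>(P \<Otimes>\<^sub>M P))) / 2)"
    (is "(\<lambda>n. \<integral>\<omega>. iexp (?T n \<omega>) \<partial>?M n) \<longlonglongrightarrow> ?L")
proof (rule Lim_null_comparison[THEN Lim_null[THEN iffD2]])
  define k where "k = 16 * (1 + CARD('d)) * (1 + 2 * CARD('d))\<^sup>2 * C ^ 3"
  define B where "B n = k / sqrt n + C\<^sup>2 / n * (4 * (real CARD('d))\<^sup>2)" for n :: nat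
  show "B \<longlonglongrightarrow> 0" unfolding B_def[abs_def] by real_asymp
  have T: "(\<lambda>\<omega>. ?T n \<omega>) \<in> borel_measurable (?M n)" for n
    by (intro borel_measurable_add borel_measurable_sum borel_measurable_divide borel_measurable_const
        measurable_compose[OF sample_coord_measurable a(1)] pair_measurable[OF h(1)] sample_value_measurable)
  show "eventually (\<lambda>n. norm ((\<integral>\<omega>. iexp (?T n \<omega>) \<partial>?M n) - ?L) \<le> B n) sequentially"
    using eventually_ge_at_top[of 3]
  proof eventually_elim
    case (elim n)
    interpret M: prob_space "?M n" by (rule prob_sample)
    interpret K: prob_space "perm_law TYPE('d) n" by (rule prob_space_perm_law)
    interpret D: prob_space "data n" by (rule prob_data)
    let ?b = "\<lambda>\<pi>. k / sqrt n + C\<^sup>2 / n * coinc n \<pi>"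
    have lin: "(\<integral>\<pi>. r + s * coinc n \<pi> \<partial>perm_law TYPE('d) n) = r + s * integral\<^sup>L (perm_law TYPE('d) n) (coinc n)" for r s :: real
    proof -
      have "integrable (perm_law TYPE('d) n) (\<lambda>\<pi>. s * coinc n \<pi>)" by (intro integrable_mult_right coinc_integrable)
      then show ?thesis by (simp add: K.prob_space)
    qed
    have i: "integrable (?M n) (\<lambda>\<omega>. iexp (?T n \<omega>))"
      using T by (rule M.integrable_iexp_real)
    have d: "(\<integral>\<omega>. iexp (?T n \<omega>) \<partial>?M n) - ?L = (\<integral>\<omega>. iexp (?T n \<omega>) - ?L \<partial>?M n)"
      using i by (simp add: M.prob_space)
    have "norm (\<integral>\<omega>. iexp (?T n \<omega>) - ?L \<partial>?M n) \<le> integral\<^sup>L (perm_law TYPE('d) n) ?b"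
    proof (rule sample_integral_le)
      show "integrable (?M n) (\<lambda>\<omega>. iexp (?T n \<omega>) - ?L)" using i by simp
      show "integrable (perm_law TYPE('d) n) ?b"
        by (intro Bochner_Integration.integrable_add integrable_mult_right coinc_integrable K.integrable_const)
      fix \<pi> :: "'d \<Rightarrow> nat \<Rightarrow> nat" assume \<pi>: "\<And>l. \<pi> l \<in> perms n"
      have eq: "(\<integral>x. iexp (?T n (x, \<pi>)) - ?L \<partial>data n) = (\<integral>x. iexp (?T n (x, \<pi>)) \<partial>data n) - ?L"
      proof -
        have "(\<lambda>x. ?T n (x, \<pi>)) \<in> borel_measurable (data n)"
        proof -
          have "\<pi> l i \<in> {1..n} \<and> \<pi> l (nxt n i) \<in> {1..n}" if "i \<in> {1..n}" for l i
            using that perms_in[OF \<pi>] nxt_in by blast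
          then show ?thesis unfolding fst_conv snd_conv
            by (intro borel_measurable_add borel_measurable_sum borel_measurable_divide borel_measurable_const
              measurable_compose[OF coord_measurable a(1)] pair_measurable[OF h(1)] coord_measurable) blast+
        qed
        then have "integrable (data n) (\<lambda>x. iexp (?T n (x, \<pi>)))" by (rule D.integrable_iexp_real)
        then show ?thesis by (simp add: D.prob_space)
      qed
      show "norm (\<integral>x. iexp (?T n (x, \<pi>)) - ?L \<partial>data n) \<le> ?b \<pi>"
        unfolding eq using conditional_char_approx[where n = n and \<pi> = \<pi> and a = a and h = h and C = C, OF elim \<pi> a h]
        unfolding fst_conv snd_conv k_def .
    qed
    also have "integral\<^sup>L (perm_law TYPE('d) n) ?b = k / sqrt n + C\<^sup>2 / n * integral\<^sup>L (perm_law TYPE('d) n) (coinc n)"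
      by (rule lin)
    also have "\<dots> \<le> B n" unfolding B_def
      using integral_coinc_le[where n = n] elim by (intro add_left_mono mult_left_mono) auto
    finally show ?case unfolding d .
  qed
qed

lemma cycle_average_moment:
  fixes g :: "real^'q \<Rightarrow> real^'q \<Rightarrow> real" and T :: "'d::finite itself" and l :: 'd
  assumes n: "2 \<le> n"
    and g: "(\<lambda>(x, y). g x y) \<in> borel_measurable (P \<Otimes>\<^sub>M P)" "\<And>x y. \<bar>g x y\<bar> \<le> C"
    and g0: "(\<integral>z. g (fst z) (snd z) \<partial>(P \<Otimes>\<^sub>M P)) = 0"
  defines "S \<equiv> \<lambda>\<omega>. (\<Sum>i=1..n. g (fst \<omega> (snd \<omega> l i)) (fst \<omega> (snd \<omega> l (nxt n i)))) / n"
  shows "S \<in> borel_measurable (sample P T n)" "integrable (sample P T n) (\<lambda>\<omega>. (S \<omega>)\<^sup>2)"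
    "(\<integral>\<omega>. (S \<omega>)\<^sup>2 \<partial>sample P T n) \<le> 4 * C\<^sup>2 / n"
proof -
  interpret M: prob_space "sample P T n" by (rule prob_sample)
  interpret K: prob_space "perm_law T n" by (rule prob_space_perm_law)
  show m: "S \<in> borel_measurable (sample P T n)" unfolding S_def
    by (intro borel_measurable_sum borel_measurable_divide borel_measurable_const pair_measurable[OF g(1)] sample_value_measurable)
  have Sb: "\<bar>S \<omega>\<bar> \<le> C" for \<omega>
  proof -
    have "\<bar>S \<omega>\<bar> \<le> (\<Sum>i=1..n. C) / n" unfolding S_def abs_divide abs_of_nat
      by (intro divide_right_mono order_trans[OF sum_abs] sum_mono g) auto
    then show ?thesis using n by simp
  qed
  have b: "norm ((S \<omega>)\<^sup>2) \<le> C\<^sup>2" for \<omega> using power_mono[OF Sb[of \<omega>], of 2] by simp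
  show i: "integrable (sample P T n) (\<lambda>\<omega>. (S \<omega>)\<^sup>2)" using m b by (intro M.integrable_bounded[of _ "C\<^sup>2"]) auto
  have "norm (\<integral>\<omega>. (S \<omega>)\<^sup>2 \<partial>sample P T n) \<le> (\<integral>\<pi>. 4 * C\<^sup>2 / n \<partial>perm_law T n)"
  proof (rule sample_integral_le[OF i])
    fix \<pi> :: "'d \<Rightarrow> nat \<Rightarrow> nat" assume \<pi>: "\<And>l. \<pi> l \<in> perms n"
    have "(\<integral>x. (S (x, \<pi>))\<^sup>2 \<partial>data n) = (\<integral>x. (\<Sum>i=1..n. g (x (\<pi> l i)) (x (\<pi> l (nxt n i))))\<^sup>2 \<partial>data n) / (real n)\<^sup>2"
      by (simp add: S_def power_divide)
    also have "\<dots> \<le> (4 * real n * C\<^sup>2) / (real n)\<^sup>2"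
      by (intro divide_right_mono cycle_second_moment[OF \<pi> n g g0]) auto
    also have "\<dots> = 4 * C\<^sup>2 / n" using n by (simp add: power2_eq_square)
    finally show "norm (\<integral>x. (S (x, \<pi>))\<^sup>2 \<partial>data n) \<le> 4 * C\<^sup>2 / n" by simp
  qed simp
  then show "(\<integral>\<omega>. (S \<omega>)\<^sup>2 \<partial>sample P T n) \<le> 4 * C\<^sup>2 / n" by (simp add: K.prob_space)
qed

text \<open>A law of large numbers along one random cycle, by Chebyshev's inequality; it shows that
  the integrals of finitely many test functions are close to their limits.\<close>

lemma cycle_average_small:
  fixes g :: "real^'q \<Rightarrow> real^'q \<Rightarrow> real" and l :: "'d::finite"
  assumes g: "(\<lambda>(x, y). g x y) \<in> borel_measurable (P \<Otimes>\<^sub>M P)" "\<And>x y. \<bar>g x y\<bar> \<le> C"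
    and g0: "(\<integral>z. g (fst z) (snd z) \<partial>(P \<Otimes>\<^sub>M P)) = 0" and \<delta>: "0 < \<delta>"
  shows "(\<lambda>n. measure (sample P TYPE('d) n) {\<omega> \<in> space (sample P TYPE('d) n).
      \<delta> \<le> \<bar>(\<Sum>i=1..n. g (fst \<omega> (snd \<omega> l i)) (fst \<omega> (snd \<omega> l (nxt n i)))) / n\<bar>}) \<longlonglongrightarrow> 0"
proof (rule Lim_null_comparison)
  show "(\<lambda>n::nat. 4 * C\<^sup>2 / n / \<delta>\<^sup>2) \<longlonglongrightarrow> 0" using \<delta> by real_asymp
  show "eventually (\<lambda>n. norm (measure (sample P TYPE('d) n) {\<omega> \<in> space (sample P TYPE('d) n).
      \<delta> \<le> \<bar>(\<Sum>i=1..n. g (fst \<omega> (snd \<omega> l i)) (fst \<omega> (snd \<omega> l (nxt n i)))) / n\<bar>}) \<le> 4 * C\<^sup>2 / n / \<delta>\<^sup>2) sequentially"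
    using eventually_ge_at_top[of 2]
  proof eventually_elim
    case (elim n)
    define S where "S \<omega> = (\<Sum>i=1..n. g (fst \<omega> (snd \<omega> l i)) (fst \<omega> (snd \<omega> l (nxt n i)))) / n" for \<omega> :: "(nat \<Rightarrow> real^'q) \<times> ('d \<Rightarrow> nat \<Rightarrow> nat)"
    note mom = cycle_average_moment[OF elim g g0, where T = "TYPE('d)" and l = l, folded S_def]
    have "{\<omega> \<in> space (sample P TYPE('d) n). \<delta> \<le> \<bar>S \<omega>\<bar>} = {\<omega> \<in> space (sample P TYPE('d) n). \<delta>\<^sup>2 \<le> (S \<omega>)\<^sup>2}"
      using \<delta> by (auto simp: abs_le_square_iff[symmetric])
    also have "measure (sample P TYPE('d) n) \<dots> \<le> (\<integral>\<omega>. (S \<omega>)\<^sup>2 \<partial>sample P TYPE('d) n) / \<delta>\<^sup>2"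
      using \<delta> by (intro integral_Markov_inequality_measure[where A = "{}"] mom(2)) auto
    also have "\<dots> \<le> 4 * C\<^sup>2 / n / \<delta>\<^sup>2" using mom(3) by (intro divide_right_mono) auto
    finally show ?case by (simp add: S_def)
  qed
qed

end

section \<open>Linearisation along the empirical measures\<close>

lemma bounded_linear_transpose: "bounded_linear (transpose :: real^'n^'n \<Rightarrow> real^'n^'n)"
  unfolding linear_conv_bounded_linear[symmetric]
  by (rule linearI) (simp_all add: transpose_def vec_eq_iff)

lemma symm_diff: "symm A \<Longrightarrow> symm B \<Longrightarrow> symm (A - B)"
  by (simp add: symm_def transpose_def vec_eq_iff)

context sampling
begin

lemma diff_law_integral:
  fixes f :: "real^'q \<Rightarrow> 'b::{banach,second_countable_topology}"
  assumes "f \<in> borel_measurable borel"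
  shows "integral\<^sup>L (diff_law P) f = (\<integral>z. f (fst z - snd z) \<partial>(P \<Otimes>\<^sub>M P))"
proof -
  have "(\<lambda>(x, y). x - y) \<in> borel_measurable (P \<Otimes>\<^sub>M P)" by measurable
  from integral_distr[OF this assms] show ?thesis by (simp add: diff_law_def split_beta')
qed

lemma diff_law_integral_swap:
  fixes f :: "real^'q \<Rightarrow> 'b::{banach,second_countable_topology}"
  assumes [measurable]: "f \<in> borel_measurable borel"
  shows "(\<integral>z. f (snd z - fst z) \<partial>(P \<Otimes>\<^sub>M P)) = integral\<^sup>L (diff_law P) f"
proof -
  have "(\<lambda>z. f (fst z - snd z)) \<in> borel_measurable (P \<Otimes>\<^sub>M P)" by measurable
  from PP.integral_product_swap[OF this] show ?thesis
    by (simp add: diff_law_integral split_beta')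
qed

text \<open>For fixed permutations the two observations have joint law
  \<open>P \<Otimes>\<^sub>M P\<close>, and the diagonal has there the mass that
  \<open>diff_law P\<close> gives to 0.\<close>

lemma AE_distinct_edges:
  fixes l :: "'d::finite"
  assumes Q: "emeasure (diff_law P) {0} = 0" and n: "2 \<le> n" and i: "i \<in> {1..n}"
  shows "AE \<omega> in sample P TYPE('d) n. fst \<omega> (snd \<omega> l i) \<noteq> fst \<omega> (snd \<omega> l (nxt n i))"
proof -
  interpret M: prob_space "sample P TYPE('d) n" by (rule prob_sample)
  let ?e = "\<lambda>x y :: real^'q. of_bool (x - y = 0) :: real"
  have zero: "(\<integral>z. ?e (fst z) (snd z) \<partial>(P \<Otimes>\<^sub>M P)) = 0"
  proof -
    have "(\<integral>z. ?e (fst z) (snd z) \<partial>(P \<Otimes>\<^sub>M P)) = (\<integral>y. of_bool (y = 0) \<partial>diff_law P)"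
      by (rule diff_law_integral[symmetric]) measurable
    also have "\<dots> = (\<integral>y. indicator {0} y \<partial>diff_law P)"
      by (intro Bochner_Integration.integral_cong refl) (simp add: indicator_def)
    also have "\<dots> = 0" using Q by (simp add: diff_law_def measure_def)
    finally show ?thesis .
  qed
  let ?f = "\<lambda>\<omega>. ?e (fst \<omega> (snd \<omega> l i)) (fst \<omega> (snd \<omega> l (nxt n i)))"
  have em: "(\<lambda>(x, y). ?e x y) \<in> borel_measurable (P \<Otimes>\<^sub>M P)" by measurable
  have int: "integrable (sample P TYPE('d) n) ?f"
    by (rule M.integrable_bounded[of _ 1], rule pair_measurable[OF em sample_value_measurable sample_value_measurable]) auto
  have "norm (integral\<^sup>L (sample P TYPE('d) n) ?f) \<le> (\<integral>\<pi>. 0 \<partial>perm_law TYPE('d) n)"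
  proof (rule sample_integral_le[OF int])
    fix \<pi> :: "'d \<Rightarrow> nat \<Rightarrow> nat" assume \<pi>: "\<And>l. \<pi> l \<in> perms n"
    have "(\<integral>x. ?e (x (\<pi> l i)) (x (\<pi> l (nxt n i))) \<partial>data n) = (\<integral>z. ?e (fst z) (snd z) \<partial>(P \<Otimes>\<^sub>M P))"
    proof (rule PiM_integral_coord2[OF prob_P, where B = 1])
      show "\<pi> l i \<in> {1..n}" "\<pi> l (nxt n i) \<in> {1..n}" using perms_in[OF \<pi>] nxt_in i by blast+
      show "\<pi> l i \<noteq> \<pi> l (nxt n i)" using perms_eq_iff[OF \<pi>] nxt_neq[OF n i] by simp
      show "(\<lambda>(x, y). ?e x y) \<in> borel_measurable (P \<Otimes>\<^sub>M P)" by (rule em)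
    qed auto
    then show "norm (\<integral>x. ?f (x, \<pi>) \<partial>data n) \<le> 0" unfolding zero fst_conv snd_conv by simp
  qed simp
  then have "integral\<^sup>L (sample P TYPE('d) n) ?f = 0"
    by (simp only: Bochner_Integration.integral_zero norm_le_zero_iff)
  then have "AE \<omega> in sample P TYPE('d) n. ?f \<omega> = 0"
    using int by (subst (asm) integral_nonneg_eq_0_iff_AE) auto
  then show ?thesis by eventually_elim auto
qed

end

section \<open>Hoeffding decomposition of the kernel\<close>

locale kernel = sampling P for P :: "(real^'q) measure" +
  fixes J :: "real^'q \<Rightarrow> real^'q^'q" and CJ :: real
  assumes J_meas [measurable]: "J \<in> borel_measurable borel"
    and J_bound: "norm (J x) \<le> CJ" and J_even: "J (- x) = J x" and J_symm: "symm (J x)"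
    and J_centered: "integral\<^sup>L (diff_law P) J = 0"
begin

lemma J_pair_meas [measurable]: "(\<lambda>(x, y). J (x - y)) \<in> borel_measurable (P \<Otimes>\<^sub>M P)"
  by measurable

lemma J_swap: "J (x - y) = J (y - x)"
  using J_even[of "x - y"] by simp

lemma J_int: "integrable P (\<lambda>y. J (x - y))"
  by (rule P.integrable_bounded[of _ CJ]) (measurable, rule J_bound)

lemma H1_meas [measurable]: "H1 P J \<in> borel_measurable borel"
proof -
  have "(\<lambda>(x, y). J (x - y)) \<in> borel_measurable (borel \<Otimes>\<^sub>M P)" by measurable
  then show ?thesis unfolding H1_def[abs_def] by (rule P.borel_measurable_lebesgue_integral)
qed

lemma H1_bound: "norm (H1 P J x) \<le> CJ"
  unfolding H1_def by (rule P.norm_integral_le_bound) (measurable, rule J_bound)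

lemma H1_int: "integrable P (H1 P J)"
  by (rule P.integrable_bounded[of _ CJ]) (measurable, rule H1_bound)

lemma H1_centered: "integral\<^sup>L P (H1 P J) = 0"
proof -
  have "integrable (P \<Otimes>\<^sub>M P) (\<lambda>(x, y). J (x - y))"
    by (rule PP.integrable_bounded[of _ CJ]) (measurable, use J_bound in auto)
  from PP.integral_fst[OF this] show ?thesis
    using J_centered diff_law_integral[OF J_meas] by (simp add: H1_def[abs_def] split_beta')
qed

lemma H1_symm: "symm (H1 P J x)"
  unfolding symm_def H1_def
  using integral_bounded_linear[OF bounded_linear_transpose J_int[of x]] J_symm by (simp add: symm_def)

lemma H2_meas: "(\<lambda>(x, y). H2 P J x y) \<in> borel_measurable (P \<Otimes>\<^sub>M P)"
  unfolding H2_def by measurable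

lemma H2_bound: "norm (H2 P J x y) \<le> 3 * CJ"
proof -
  have "norm (H2 P J x y) \<le> norm (J (x - y)) + norm (H1 P J x) + norm (H1 P J y)"
    unfolding H2_def by (intro order_trans[OF norm_triangle_ineq4] add_right_mono norm_triangle_ineq4)
  then show ?thesis using J_bound[of "x - y"] H1_bound[of x] H1_bound[of y] by linarith
qed

lemma H2_swap: "H2 P J x y = H2 P J y x"
  unfolding H2_def using J_swap[of x y] by simp

lemma H2_symm: "symm (H2 P J x y)"
  unfolding H2_def by (intro symm_diff J_symm H1_symm)

text \<open>\<open>H2\<close> is the second order part in the Hoeffding decomposition of
  \<open>J (x - y)\<close>: the projection \<open>H1\<close> is removed for either argument, and the
  constant term is 0 because \<open>J\<close> is centered. Together with \<open>H2_swap\<close> this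
  gives degeneracy in both arguments.\<close>

lemma H2_degenerate: "(\<integral>y. H2 P J x y \<partial>P) = 0" and H2_int: "integrable P (H2 P J x)"
proof -
  show "integrable P (H2 P J x)" unfolding H2_def using J_int H1_int by simp
  have "(\<integral>y. H2 P J x y \<partial>P) = (\<integral>y. J (x - y) \<partial>P) - H1 P J x - integral\<^sup>L P (H1 P J)"
    unfolding H2_def using J_int[of x] H1_int by (simp add: P.prob_space)
  then show "(\<integral>y. H2 P J x y \<partial>P) = 0" by (simp add: H1_centered H1_def)
qed

lemma kernel_char_limit:
  fixes A :: "real^'q^'q" and B :: "'d::finite \<Rightarrow> real^'q^'q"
  shows "(\<lambda>n. \<integral>\<omega>. iexp ((\<Sum>i=1..n. A \<bullet> H1 P J (fst \<omega> i)) / sqrt n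
            + (\<Sum>l\<in>UNIV. (\<Sum>i=1..n. B l \<bullet> H2 P J (fst \<omega> (snd \<omega> l i)) (fst \<omega> (snd \<omega> l (nxt n i)))) / sqrt n)) \<partial>sample P TYPE('d) n)
       \<longlonglongrightarrow> exp (- ((\<integral>x. (A \<bullet> H1 P J x)\<^sup>2 \<partial>P) + (\<Sum>l\<in>UNIV. \<integral>z. (B l \<bullet> H2 P J (fst z) (snd z))\<^sup>2 \<partial>(P \<Otimes>\<^sub>M P))) / 2)"
proof -
  \<comment> \<open>One bound for all linear combinations at once: \<open>H1\<close> is bounded by
    \<open>CJ\<close> and \<open>H2\<close> by \<open>3 * CJ\<close>.\<close>
  define C where "C = (norm A + (\<Sum>l\<in>UNIV. norm (B l))) * (3 * CJ)"
  have CJ: "0 \<le> CJ" using J_bound[of 0] norm_ge_zero order_trans by blast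
  show ?thesis
  proof (rule joint_char_limit[where a = "\<lambda>x. A \<bullet> H1 P J x" and h = "\<lambda>l x y. B l \<bullet> H2 P J x y" and C = C])
    show "(\<lambda>x. A \<bullet> H1 P J x) \<in> borel_measurable borel" by measurable
    show "\<bar>A \<bullet> H1 P J x\<bar> \<le> C" for x
    proof -
      have "\<bar>A \<bullet> H1 P J x\<bar> \<le> norm A * norm (H1 P J x)" by (rule Cauchy_Schwarz_ineq2)
      also have "\<dots> \<le> C" unfolding C_def
        using H1_bound[of x] CJ by (intro mult_mono) (auto simp: sum_nonneg)
      finally show ?thesis .
    qed
    show "(\<integral>x. A \<bullet> H1 P J x \<partial>P) = 0" using H1_centered H1_int by simp
    fix l
    show "(\<lambda>(x, y). B l \<bullet> H2 P J x y) \<in> borel_measurable (P \<Otimes>\<^sub>M P)"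
      using H2_meas by (simp add: split_beta')
    show "\<bar>B l \<bullet> H2 P J x y\<bar> \<le> C" for x y
    proof -
      have "\<bar>B l \<bullet> H2 P J x y\<bar> \<le> norm (B l) * norm (H2 P J x y)" by (rule Cauchy_Schwarz_ineq2)
      also have "\<dots> \<le> C" unfolding C_def
      proof (intro mult_mono)
        have "norm (B l) \<le> (\<Sum>l\<in>UNIV. norm (B l))" by (rule member_le_sum) auto
        then show "norm (B l) \<le> norm A + (\<Sum>l\<in>UNIV. norm (B l))" by (simp add: add_increasing)
      qed (use H2_bound CJ in \<open>auto intro!: add_nonneg_nonneg sum_nonneg\<close>)
      finally show ?thesis .
    qed
    show "B l \<bullet> H2 P J x y = B l \<bullet> H2 P J y x" for x y by (simp add: H2_swap[of x y])
    show "(\<integral>y. B l \<bullet> H2 P J x y \<partial>P) = 0" for x using H2_degenerate H2_int by simp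
  qed
qed

section \<open>The linear term and the remainder of the functional\<close>

definition avg :: "nat \<Rightarrow> (nat \<Rightarrow> real^'q) \<Rightarrow> (nat \<Rightarrow> nat) \<Rightarrow> real^'q^'q" where
  "avg n x p = (1 / real n) *\<^sub>R (\<Sum>i=1..n. J (x (p i) - x (p (nxt n i))))"

text \<open>Evenness of \<open>J\<close> merges the atoms at a difference and at its negative, so
  symmetrisation leaves a plain cycle average.\<close>

lemma Qhat_integral_J: "1 \<le> n \<Longrightarrow> integral\<^sup>L (Qhat n x p) J = avg n x p"
  unfolding Qhat_def avg_def by (subst sym_emp_integral)
    (simp_all add: J_even J_swap[of "x (p _)" "x (p (nxt n _))"] scaleR_2[symmetric] scaleR_sum_right)

text \<open>An exact identity: in a cycle every observation is once the start and once the end of an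
  edge, so both sums of \<open>H1\<close> equal the sum over the sample. Hence the factor 2.\<close>

lemma avg_decomposition:
  assumes "p \<in> perms n"
  shows "avg n x p = 2 *\<^sub>R ((1 / real n) *\<^sub>R (\<Sum>i=1..n. H1 P J (x i)))
     + (1 / real n) *\<^sub>R (\<Sum>i=1..n. H2 P J (x (p i)) (x (p (nxt n i))))"
proof -
  have "(\<Sum>i=1..n. J (x (p i) - x (p (nxt n i)))) =
      (\<Sum>i=1..n. H1 P J (x (p i))) + (\<Sum>i=1..n. H1 P J (x (p (nxt n i)))) + (\<Sum>i=1..n. H2 P J (x (p i)) (x (p (nxt n i))))"
    by (simp add: H2_def sum.distrib[symmetric])
  also have "(\<Sum>i=1..n. H1 P J (x (p (nxt n i)))) = (\<Sum>i=1..n. H1 P J (x (p i)))" by (rule sum_nxt[of "\<lambda>i. H1 P J (x (p i))"])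
  also have "(\<Sum>i=1..n. H1 P J (x (p i))) = (\<Sum>i=1..n. H1 P J (x i))" using assms by (rule sum_perm)
  finally show ?thesis unfolding avg_def by (simp only: scaleR_2 scaleR_add_right)
qed

lemma avg_meas: "(\<lambda>\<omega>. avg n (fst \<omega>) (snd \<omega> l)) \<in> borel_measurable (sample P (T :: 'd::finite itself) n)"
  unfolding avg_def by measurable

text \<open>Chebyshev's inequality with the second moments added over an orthonormal basis. It keeps
  \<open>sqrt n\<close> times the linear term bounded in probability, by which the relative
  remainder is multiplied.\<close>

lemma avg_tail:
  fixes l :: "'d::finite"
  assumes n: "2 \<le> n" and L: "0 < L"
  shows "measure (sample P TYPE('d) n) {\<omega> \<in> space (sample P TYPE('d) n). L \<le> norm (sqrt n *\<^sub>R avg n (fst \<omega>) (snd \<omega> l))}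
     \<le> 4 * CJ\<^sup>2 * DIM(real^'q^'q) / L\<^sup>2"
proof -
  let ?M = "sample P TYPE('d) n"
  interpret M: prob_space ?M by (rule prob_sample)
  define S where "S b \<omega> = (\<Sum>i=1..n. J (fst \<omega> (snd \<omega> l i) - fst \<omega> (snd \<omega> l (nxt n i))) \<bullet> b) / n"
    for b and \<omega> :: "(nat \<Rightarrow> real^'q) \<times> ('d \<Rightarrow> nat \<Rightarrow> nat)"
  have mom: "integrable ?M (\<lambda>\<omega>. (S b \<omega>)\<^sup>2)" "(\<integral>\<omega>. (S b \<omega>)\<^sup>2 \<partial>?M) \<le> 4 * CJ\<^sup>2 / n" if b: "b \<in> Basis" for b
  proof -
    have g1: "(\<lambda>(x, y). J (x - y) \<bullet> b) \<in> borel_measurable (P \<Otimes>\<^sub>M P)" by measurable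
    have g2: "\<bar>J (x - y) \<bullet> b\<bar> \<le> CJ" for x y using Basis_le_norm[OF b, of "J (x - y)"] J_bound[of "x - y"] by simp
    have g3: "(\<integral>z. J (fst z - snd z) \<bullet> b \<partial>(P \<Otimes>\<^sub>M P)) = 0"
    proof -
      have "integrable (P \<Otimes>\<^sub>M P) (\<lambda>z. J (fst z - snd z))"
        by (rule PP.integrable_bounded[of _ CJ]) (measurable, rule J_bound)
      then show ?thesis using J_centered diff_law_integral[OF J_meas] by simp
    qed
    show "integrable ?M (\<lambda>\<omega>. (S b \<omega>)\<^sup>2)" "(\<integral>\<omega>. (S b \<omega>)\<^sup>2 \<partial>?M) \<le> 4 * CJ\<^sup>2 / n"
      unfolding S_def by (rule cycle_average_moment(2,3)[OF n g1 g2 g3])+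
  qed
  have nrm: "(norm (sqrt n *\<^sub>R avg n (fst \<omega>) (snd \<omega> l)))\<^sup>2 = n * (\<Sum>b\<in>Basis. (S b \<omega>)\<^sup>2)" for \<omega> :: "(nat \<Rightarrow> real^'q) \<times> ('d \<Rightarrow> nat \<Rightarrow> nat)"
  proof -
    have "(norm (avg n (fst \<omega>) (snd \<omega> l)))\<^sup>2 = (\<Sum>b\<in>Basis. (S b \<omega>)\<^sup>2)"
      unfolding power2_norm_eq_inner by (subst euclidean_inner) (simp add: S_def avg_def inner_sum_left power2_eq_square)
    then show ?thesis by (simp add: power_mult_distrib)
  qed
  have int: "integrable ?M (\<lambda>\<omega>. (norm (sqrt n *\<^sub>R avg n (fst \<omega>) (snd \<omega> l)))\<^sup>2)"
    unfolding nrm using mom(1) by (intro integrable_mult_right Bochner_Integration.integrable_sum)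
  have "{\<omega> \<in> space ?M. L \<le> norm (sqrt n *\<^sub>R avg n (fst \<omega>) (snd \<omega> l))} =
      {\<omega> \<in> space ?M. L\<^sup>2 \<le> (norm (sqrt n *\<^sub>R avg n (fst \<omega>) (snd \<omega> l)))\<^sup>2}"
    using L by (intro Collect_cong conj_cong refl) (simp add: abs_le_square_iff[symmetric])
  also have "measure ?M \<dots> \<le> (\<integral>\<omega>. (norm (sqrt n *\<^sub>R avg n (fst \<omega>) (snd \<omega> l)))\<^sup>2 \<partial>?M) / L\<^sup>2"
    using L by (intro integral_Markov_inequality_measure[where A = "{}"] int) auto
  also have "\<dots> \<le> 4 * CJ\<^sup>2 * DIM(real^'q^'q) / L\<^sup>2"
  proof (rule divide_right_mono)
    have "(\<integral>\<omega>. (norm (sqrt n *\<^sub>R avg n (fst \<omega>) (snd \<omega> l)))\<^sup>2 \<partial>?M) = n * (\<Sum>b\<in>Basis. \<integral>\<omega>. (S b \<omega>)\<^sup>2 \<partial>?M)"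
      unfolding nrm using mom(1) by (simp add: Bochner_Integration.integral_sum)
    also have "\<dots> \<le> n * (\<Sum>b\<in>(Basis :: (real^'q^'q) set). 4 * CJ\<^sup>2 / n)" by (intro mult_left_mono sum_mono mom(2)) auto
    also have "\<dots> = 4 * CJ\<^sup>2 * DIM(real^'q^'q)" using n by simp
    finally show "(\<integral>\<omega>. (norm (sqrt n *\<^sub>R avg n (fst \<omega>) (snd \<omega> l)))\<^sup>2 \<partial>?M) \<le> 4 * CJ\<^sup>2 * DIM(real^'q^'q)" .
  qed simp
  finally show ?thesis .
qed

text \<open>The remainder can exceed \<open>\<epsilon>\<close> only if one of \<open>N\<close> test
  integrals is off by at least \<open>1 / (N + 1)\<close>, or if the scaled linear term is at least
  \<open>L\<close>; otherwise relative accuracy \<open>\<epsilon> / L\<close> times \<open>L\<close>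
  bounds it. The sizes of these two events are controlled separately.\<close>

lemma functional_expansion_in_prob:
  fixes l :: "'d::finite" and \<Sigma> :: "(real^'q) measure \<Rightarrow> real^'q^'q" and f :: "nat \<Rightarrow> real^'q \<Rightarrow> real"
  assumes near: "\<And>\<epsilon>. 0 < \<epsilon> \<Longrightarrow> \<exists>N. \<forall>Q'. probdist Q' \<and> adm Q' \<and>
        (\<forall>k<N. \<bar>integral\<^sup>L Q' (f k) - integral\<^sup>L (diff_law P) (f k)\<bar> < 1 / real (Suc N)) \<longrightarrow>
        norm (\<Sigma> Q' - \<Sigma> (diff_law P) - integral\<^sup>L Q' J) \<le> \<epsilon> * norm (integral\<^sup>L Q' J)"
    and f: "\<And>k. continuous_on UNIV (f k)" "\<And>k x. \<bar>f k x\<bar> \<le> 1"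
    and adm: "\<And>n. 2 \<le> n \<Longrightarrow> AE \<omega> in sample P TYPE('d) n. adm (Qhat n (fst \<omega>) (snd \<omega> l))"
    and meas: "\<And>n. (\<lambda>\<omega>. \<Sigma> (Qhat n (fst \<omega>) (snd \<omega> l))) \<in> borel_measurable (sample P TYPE('d) n)"
    and \<epsilon>: "0 < \<epsilon>"
  shows "(\<lambda>n. measure (sample P TYPE('d) n) {\<omega> \<in> space (sample P TYPE('d) n). \<epsilon> < norm (sqrt n *\<^sub>R
       (\<Sigma> (Qhat n (fst \<omega>) (snd \<omega> l)) - \<Sigma> (diff_law P) - 2 *\<^sub>R ((1 / real n) *\<^sub>R (\<Sum>i=1..n. H1 P J (fst \<omega> i)))
        - (1 / real n) *\<^sub>R (\<Sum>i=1..n. H2 P J (fst \<omega> (snd \<omega> l i)) (fst \<omega> (snd \<omega> l (nxt n i))))))}) \<longlonglongrightarrow> 0"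
    (is "(\<lambda>n. measure (?M n) {\<omega> \<in> space (?M n). \<epsilon> < norm (?R n \<omega>)}) \<longlonglongrightarrow> 0")
  unfolding tendsto_iff dist_0_norm
proof (intro allI impI)
  fix r :: real assume r: "0 < r"
  define K where "K = 4 * CJ\<^sup>2 * DIM(real^'q^'q)"
  have K: "0 \<le> K" by (simp add: K_def)
  \<comment> \<open>Makes the Chebyshev bound \<open>K / L\<^sup>2\<close> smaller than
    \<open>r / 2\<close>; the summand 1 keeps \<open>L\<close> positive even if
    \<open>K = 0\<close>.\<close>
  define L where "L = sqrt (2 * (K + 1) / r)"
  have L: "0 < L" using K r by (simp add: L_def)
  have KL: "K / L\<^sup>2 < r / 2"
  proof -
    have L2: "L\<^sup>2 = 2 * (K + 1) / r" using K r by (simp add: L_def)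
    have "K / L\<^sup>2 = r / 2 * (K / (K + 1))" unfolding L2 using K r by (simp add: field_simps)
    also have "\<dots> < r / 2 * 1" using K r by (intro mult_strict_left_mono) auto
    finally show ?thesis by simp
  qed
  have "0 < \<epsilon> / L" using \<epsilon> L by simp
  from near[OF this] obtain N where N0: "\<forall>Q'. probdist Q' \<and> adm Q' \<and>
        (\<forall>k<N. \<bar>integral\<^sup>L Q' (f k) - integral\<^sup>L (diff_law P) (f k)\<bar> < 1 / real (Suc N)) \<longrightarrow>
        norm (\<Sigma> Q' - \<Sigma> (diff_law P) - integral\<^sup>L Q' J) \<le> (\<epsilon> / L) * norm (integral\<^sup>L Q' J)" ..
  have N: "norm (\<Sigma> Q' - \<Sigma> (diff_law P) - integral\<^sup>L Q' J) \<le> (\<epsilon> / L) * norm (integral\<^sup>L Q' J)"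
    if "probdist Q'" "adm Q'" "\<And>k. k < N \<Longrightarrow> \<bar>integral\<^sup>L Q' (f k) - integral\<^sup>L (diff_law P) (f k)\<bar> < 1 / real (Suc N)" for Q'
    by (rule N0[rule_format]) (use that in auto)
  have fm [measurable]: "f k \<in> borel_measurable borel" for k using f(1) by (rule borel_measurable_continuous_onI)
  define m where "m k = integral\<^sup>L (diff_law P) (f k)" for k
  \<comment> \<open>The test function averaged over both signs of the difference and centered, so
    that its cycle average is the error of the integral against the symmetrised empirical
    measure.\<close>
  define g where "g k x y = (f k (y - x) + f k (x - y)) / 2 - m k" for k and x y :: "real^'q"
  have mb: "\<bar>m k\<bar> \<le> 1" for k
  proof -
    have "norm (\<integral>z. f k (fst z - snd z) \<partial>(P \<Otimes>\<^sub>M P)) \<le> 1"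
      by (rule PP.norm_integral_le_bound) (measurable, simp add: f(2))
    then show ?thesis by (simp add: m_def diff_law_integral)
  qed
  have g1: "(\<lambda>(x, y). g k x y) \<in> borel_measurable (P \<Otimes>\<^sub>M P)" for k unfolding g_def by measurable
  have g2: "\<bar>g k x y\<bar> \<le> 2" for k x y
    using f(2)[of k "y - x"] f(2)[of k "x - y"] mb[of k] unfolding g_def abs_le_iff by (simp add: field_simps)
  have g3: "(\<integral>z. g k (fst z) (snd z) \<partial>(P \<Otimes>\<^sub>M P)) = 0" for k
  proof -
    have i: "integrable (P \<Otimes>\<^sub>M P) (\<lambda>z. f k (fst z - snd z))" "integrable (P \<Otimes>\<^sub>M P) (\<lambda>z. f k (snd z - fst z))"
      by (rule PP.integrable_bounded[of _ 1], measurable, simp add: f(2))+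
    have "(\<integral>z. g k (fst z) (snd z) \<partial>(P \<Otimes>\<^sub>M P)) = ((\<integral>z. f k (snd z - fst z) \<partial>(P \<Otimes>\<^sub>M P)) + (\<integral>z. f k (fst z - snd z) \<partial>(P \<Otimes>\<^sub>M P))) / 2 - m k"
      unfolding g_def using i by (simp add: PP.prob_space)
    then show ?thesis by (simp add: diff_law_integral_swap diff_law_integral m_def)
  qed
  define S where "S k n \<omega> = (\<Sum>i=1..n. g k (fst \<omega> (snd \<omega> l i)) (fst \<omega> (snd \<omega> l (nxt n i)))) / n"
    for k n and \<omega> :: "(nat \<Rightarrow> real^'q) \<times> ('d \<Rightarrow> nat \<Rightarrow> nat)"
  have Sm [measurable]: "S k n \<in> borel_measurable (?M n)" for k n unfolding S_def[abs_def]
    by (intro borel_measurable_sum borel_measurable_divide borel_measurable_const pair_measurable[OF g1] sample_value_measurable)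
  have S_eq: "integral\<^sup>L (Qhat n (fst \<omega>) (snd \<omega> l)) (f k) - m k = S k n \<omega>" if "1 \<le> n" for n k \<omega>
    using that unfolding Qhat_def S_def g_def
    by (subst sym_emp_integral) (simp_all add: sum_subtractf sum_divide_distrib[symmetric] diff_divide_distrib)
  define A where "A k n = {\<omega> \<in> space (?M n). 1 / real (Suc N) \<le> \<bar>S k n \<omega>\<bar>}" for k n
  have "(\<lambda>n. \<Sum>k<N. measure (?M n) (A k n)) \<longlonglongrightarrow> (\<Sum>k<N. 0)"
    unfolding A_def S_def by (intro tendsto_sum cycle_average_small[OF g1 g2 g3]) simp
  then have "eventually (\<lambda>n. (\<Sum>k<N. measure (?M n) (A k n)) < r / 2) sequentially"
    using r by (intro order_tendstoD) auto
  then show "eventually (\<lambda>n. dist (measure (?M n) {\<omega> \<in> space (?M n). \<epsilon> < norm (?R n \<omega>)}) 0 < r) sequentially"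
    using eventually_ge_at_top[of 2]
  proof eventually_elim
    case (elim n)
    interpret M: prob_space "?M n" by (rule prob_sample)
    define B where "B = {\<omega> \<in> space (?M n). L \<le> norm (sqrt n *\<^sub>R avg n (fst \<omega>) (snd \<omega> l))}"
    note [measurable] = avg_meas meas sample_coord_measurable
    have As: "A k n \<in> sets (?M n)" for k unfolding A_def by measurable
    have Bs: "B \<in> sets (?M n)" unfolding B_def by measurable
    \<comment> \<open>The inclusion of events holds almost surely only: admissibility and the
      permutation property may fail on a null set.\<close>
    have "AE \<omega> in ?M n. \<omega> \<in> {\<omega> \<in> space (?M n). \<epsilon> < norm (?R n \<omega>)} \<longrightarrow> \<omega> \<in> (\<Union>k<N. A k n) \<union> B"
      using adm[OF elim(2)] AE_sample_perms
    proof eventually_elim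
      case (elim \<omega>)
      show ?case
      proof (intro impI, rule ccontr)
        assume bad: "\<omega> \<in> {\<omega> \<in> space (?M n). \<epsilon> < norm (?R n \<omega>)}" and nin: "\<omega> \<notin> (\<Union>k<N. A k n) \<union> B"
        let ?Q = "Qhat n (fst \<omega>) (snd \<omega> l)" and ?a = "avg n (fst \<omega>) (snd \<omega> l)"
        have n1: "1 \<le> n" using \<open>2 \<le> n\<close> by simp
        have "\<bar>integral\<^sup>L ?Q (f k) - integral\<^sup>L (diff_law P) (f k)\<bar> < 1 / real (Suc N)" if "k < N" for k
          using nin bad that S_eq[OF n1, of \<omega> k] by (auto simp: A_def m_def not_le)
        then have "norm (\<Sigma> ?Q - \<Sigma> (diff_law P) - integral\<^sup>L ?Q J) \<le> (\<epsilon> / L) * norm (integral\<^sup>L ?Q J)"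
          using elim(1) by (intro N) (auto simp: Qhat_def probdist_sym_emp)
        then have le: "norm (\<Sigma> ?Q - \<Sigma> (diff_law P) - ?a) \<le> (\<epsilon> / L) * norm ?a" using Qhat_integral_J[OF n1] by simp
        have R: "?R n \<omega> = sqrt n *\<^sub>R (\<Sigma> ?Q - \<Sigma> (diff_law P) - ?a)"
          using avg_decomposition[OF elim(2)[rule_format, of l], of "fst \<omega>"] by (simp only: diff_diff_eq add.assoc)
        have "norm (?R n \<omega>) = sqrt n * norm (\<Sigma> ?Q - \<Sigma> (diff_law P) - ?a)" unfolding R by simp
        also have "\<dots> \<le> sqrt n * ((\<epsilon> / L) * norm ?a)" using le by (intro mult_left_mono) auto
        also have "\<dots> = (\<epsilon> / L) * norm (sqrt n *\<^sub>R ?a)" by simp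
        also have "\<dots> \<le> (\<epsilon> / L) * L" using nin bad \<epsilon> L by (intro mult_left_mono) (auto simp: B_def)
        finally show False using bad L by simp
      qed
    qed
    then have "measure (?M n) {\<omega> \<in> space (?M n). \<epsilon> < norm (?R n \<omega>)} \<le> measure (?M n) ((\<Union>k<N. A k n) \<union> B)"
      by (rule M.finite_measure_mono_AE) (use As Bs in auto)
    also have "\<dots> \<le> measure (?M n) (\<Union>k<N. A k n) + measure (?M n) B" using As Bs by (intro measure_Un_le) auto
    also have "\<dots> \<le> (\<Sum>k<N. measure (?M n) (A k n)) + K / L\<^sup>2"
      using As avg_tail[OF elim(2) L, of l] by (intro add_mono M.finite_measure_subadditive_finite) (auto simp: B_def K_def)
    also have "\<dots> < r" using elim(1) KL by linarith
    finally show ?case by (simp add: dist_norm)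
  qed
qed

end

section \<open>Joint limit law\<close>

text \<open>Sequential differentiability becomes a neighbourhood statement by contradiction. A
  single \<open>N\<close> gives both the number of test functions and their precision, so
  counterexamples for all \<open>N\<close> form a sequence whose tested integrals converge.\<close>

lemma local_linearization:
  fixes \<Sigma> :: "(real^'q) measure \<Rightarrow> real^'q^'q" and f :: "nat \<Rightarrow> real^'q \<Rightarrow> real"
  assumes J: "is_deriv \<QQ> \<Sigma> Q J" and Q: "probdist Q"
    and adm: "\<And>Qs. (\<And>n. probdist (Qs n)) \<Longrightarrow> (\<And>n. adm (Qs n)) \<Longrightarrow> weak_conv Qs Q \<Longrightarrow>
        eventually (\<lambda>n. Qs n \<in> \<QQ>) sequentially"
    and f: "\<And>\<mu> \<nu>. (\<And>n. probdist (\<mu> n)) \<Longrightarrow> probdist \<nu> \<Longrightarrow>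
        (\<And>k. (\<lambda>n. integral\<^sup>L (\<mu> n) (f k)) \<longlonglongrightarrow> integral\<^sup>L \<nu> (f k)) \<Longrightarrow> weak_conv \<mu> \<nu>"
    and \<epsilon>: "0 < \<epsilon>"
  shows "\<exists>N. \<forall>Q'. probdist Q' \<and> adm Q' \<and>
        (\<forall>k<N. \<bar>integral\<^sup>L Q' (f k) - integral\<^sup>L Q (f k)\<bar> < 1 / real (Suc N)) \<longrightarrow>
        norm (\<Sigma> Q' - \<Sigma> Q - integral\<^sup>L Q' J) \<le> \<epsilon> * norm (integral\<^sup>L Q' J)"
proof (rule ccontr)
  assume "\<not> ?thesis"
  then have "\<forall>N. \<exists>Q'. probdist Q' \<and> adm Q' \<and>
      (\<forall>k<N. \<bar>integral\<^sup>L Q' (f k) - integral\<^sup>L Q (f k)\<bar> < 1 / real (Suc N)) \<and>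
      \<not> norm (\<Sigma> Q' - \<Sigma> Q - integral\<^sup>L Q' J) \<le> \<epsilon> * norm (integral\<^sup>L Q' J)" by simp
  from choice[OF this] obtain Qs where Qs: "\<And>N. probdist (Qs N)" "\<And>N. adm (Qs N)"
      "\<And>N k. k < N \<Longrightarrow> \<bar>integral\<^sup>L (Qs N) (f k) - integral\<^sup>L Q (f k)\<bar> < 1 / real (Suc N)"
      "\<And>N. \<not> norm (\<Sigma> (Qs N) - \<Sigma> Q - integral\<^sup>L (Qs N) J) \<le> \<epsilon> * norm (integral\<^sup>L (Qs N) J)" by auto
  have wc: "weak_conv Qs Q"
  proof (rule f[OF Qs(1) Q])
    fix k
    have "(\<lambda>N. integral\<^sup>L (Qs N) (f k) - integral\<^sup>L Q (f k)) \<longlonglongrightarrow> 0"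
    proof (rule Lim_null_comparison)
      show "eventually (\<lambda>N. norm (integral\<^sup>L (Qs N) (f k) - integral\<^sup>L Q (f k)) \<le> 1 / real (Suc N)) sequentially"
        using eventually_gt_at_top[of k] by eventually_elim (use Qs(3) in \<open>auto intro: less_imp_le\<close>)
      show "(\<lambda>N. 1 / real (Suc N)) \<longlonglongrightarrow> 0" by real_asymp
    qed
    then show "(\<lambda>N. integral\<^sup>L (Qs N) (f k)) \<longlonglongrightarrow> integral\<^sup>L Q (f k)" by (rule LIM_zero_cancel)
  qed
  from adm[OF Qs(1,2) wc] obtain N0 where N0: "\<And>n. N0 \<le> n \<Longrightarrow> Qs n \<in> \<QQ>"
    by (auto simp: eventually_sequentially)
  \<comment> \<open>Differentiability is formulated for sequences lying entirely in the domain,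
    hence the shift past \<open>N0\<close>.\<close>
  have "weak_conv (\<lambda>n. Qs (n + N0)) Q" unfolding weak_conv_def
  proof (intro allI impI)
    fix g :: "real^'q \<Rightarrow> real" assume "continuous_on UNIV g \<and> bounded (range g)"
    then have "(\<lambda>n. integral\<^sup>L (Qs n) g) \<longlonglongrightarrow> integral\<^sup>L Q g" using wc unfolding weak_conv_def by blast
    then show "(\<lambda>n. integral\<^sup>L (Qs (n + N0)) g) \<longlonglongrightarrow> integral\<^sup>L Q g" by (rule LIMSEQ_ignore_initial_segment)
  qed
  moreover have "\<forall>n. Qs (n + N0) \<in> \<QQ>" using N0 by simp
  moreover have dv: "\<forall>Qs. (\<forall>n. Qs n \<in> \<QQ>) \<and> weak_conv Qs Q \<longrightarrow>
      (\<forall>\<epsilon>>0. eventually (\<lambda>n. norm (\<Sigma> (Qs n) - \<Sigma> Q - integral\<^sup>L (Qs n) J) \<le> \<epsilon> * norm (integral\<^sup>L (Qs n) J)) sequentially)"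
    using J unfolding is_deriv_def by (elim conjE)
  ultimately have "eventually (\<lambda>n. norm (\<Sigma> (Qs (n + N0)) - \<Sigma> Q - integral\<^sup>L (Qs (n + N0)) J)
      \<le> \<epsilon> * norm (integral\<^sup>L (Qs (n + N0)) J)) sequentially"
    using dv[rule_format, of "\<lambda>n. Qs (n + N0)" \<epsilon>] \<epsilon> by simp
  then show False using Qs(4) by (auto simp: eventually_sequentially)
qed

lemma borel_measurable_vec_lambda:
  fixes F :: "'w \<Rightarrow> 'd::finite \<Rightarrow> 'b::euclidean_space"
  assumes "\<And>l. (\<lambda>\<omega>. F \<omega> l) \<in> borel_measurable M"
  shows "(\<lambda>\<omega>. \<chi> l. F \<omega> l) \<in> borel_measurable M"
proof (rule borel_measurable_euclidean_space[THEN iffD2], rule ballI)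
  fix b :: "'b^'d" assume "b \<in> Basis"
  then obtain l u where b: "b = axis l u" by (auto simp: Basis_vec_def)
  have "(\<lambda>\<omega>. F \<omega> l \<bullet> u) \<in> borel_measurable M" using assms[of l] by measurable
  then show "(\<lambda>\<omega>. (\<chi> l. F \<omega> l) \<bullet> b) \<in> borel_measurable M" by (simp add: b inner_axis)
qed

theorem theorem2:
  fixes P :: "(real^'q::finite) measure"
    and \<QQ> :: "(real^'q) measure set"
    and \<Sigma> :: "(real^'q) measure \<Rightarrow> real^'q^'q"
    and J :: "real^'q \<Rightarrow> real^'q^'q"
    and dtype :: "'d::finite itself"
  defines "Q \<equiv> diff_law P"
    and "M \<equiv> sample P TYPE('d)"
    and "S1 \<equiv> (\<lambda>n (\<omega> :: (nat \<Rightarrow> real^'q) \<times> ('d \<Rightarrow> nat \<Rightarrow> nat)).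
                 (1 / real n) *\<^sub>R (\<Sum>i=1..n. H1 P J (fst \<omega> i)))"
    and "Mn \<equiv> (\<lambda>(l::'d) n (\<omega> :: (nat \<Rightarrow> real^'q) \<times> ('d \<Rightarrow> nat \<Rightarrow> nat)).
                 (1 / real n) *\<^sub>R (\<Sum>i=1..n. H2 P J (fst \<omega> (snd \<omega> l i))
                                                   (fst \<omega> (snd \<omega> l (nxt n i)))))"
    and "Sh \<equiv> (\<lambda>(l::'d) n (\<omega> :: (nat \<Rightarrow> real^'q) \<times> ('d \<Rightarrow> nat \<Rightarrow> nat)).
                 \<Sigma> (Qhat n (fst \<omega>) (snd \<omega> l)))"
  assumes P: "probdist P"
    and setting: "case_a \<QQ> \<Sigma> \<or>
         ((\<forall>x. emeasure P {x} = 0) \<and> \<QQ> = Q0 \<and> (\<forall>Q'\<in>Q0. \<Sigma> Q' = tyler Q') \<and>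
          continuous_on (- {0}) J \<and> J 0 = 0)"
    and Q_in: "Q \<in> \<QQ>"
    and J: "is_deriv \<QQ> \<Sigma> Q J"
    and meas: "\<forall>l n. Sh l n \<in> borel_measurable (M n)"
  shows
    "(\<forall>l::'d. op_zero M (\<lambda>n \<omega>. sqrt (real n) *\<^sub>R
          (Sh l n \<omega> - \<Sigma> Q - 2 *\<^sub>R S1 n \<omega> - Mn l n \<omega>))) \<and>
     (\<exists>G1 G2.
        centered_gaussian_sym G1 (\<lambda>A. \<integral>x. (A \<bullet> H1 P J x)\<^sup>2 \<partial>P) \<and>
        centered_gaussian_sym G2 (\<lambda>A. \<integral>z. (A \<bullet> H2 P J (fst z) (snd z))\<^sup>2 \<partial>(P \<Otimes>\<^sub>M P)) \<and>
        conv_distr M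
          (\<lambda>n \<omega>. (sqrt (real n) *\<^sub>R S1 n \<omega>, \<chi> l. sqrt (real n) *\<^sub>R Mn l n \<omega>))
          (distr (G1 \<Otimes>\<^sub>M (\<Pi>\<^sub>M l\<in>(UNIV::'d set). G2)) borel
             (\<lambda>(a, g). (a, vec_lambda g))) \<and>
        conv_distr M
          (\<lambda>n \<omega>. sqrt (real n) *\<^sub>R
             ((1 / real CARD('d)) *\<^sub>R (\<Sum>l\<in>UNIV. Sh l n \<omega>) - \<Sigma> Q))
          (distr (G1 \<Otimes>\<^sub>M G2) borel
             (\<lambda>(a, b). 2 *\<^sub>R a + (1 / sqrt (real CARD('d))) *\<^sub>R b)))"
proof -
  have J': "bounded (range J)" "J \<in> borel_measurable borel" "\<And>x. J (- x) = J x" "\<And>x. symm (J x)" "integral\<^sup>L Q J = 0"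
    using J by (auto simp: is_deriv_def)
  obtain CJ where CJ: "\<And>x. norm (J x) \<le> CJ" using J'(1) by (auto simp: bounded_iff)
  interpret kernel P J CJ
    by standard (use P J' CJ in \<open>auto simp: Q_def\<close>)
  have pM: "prob_space (M n)" for n unfolding M_def by (rule prob_sample)
  have Sh_m: "Sh l n \<in> borel_measurable (M n)" for l n using meas by blast
  have S1_m: "S1 n \<in> borel_measurable (M n)" for n
    unfolding S1_def M_def by (intro borel_measurable_scaleR borel_measurable_const borel_measurable_sum
        measurable_compose[OF sample_coord_measurable H1_meas])
  have Mn_m: "Mn l n \<in> borel_measurable (M n)" for l n
    unfolding Mn_def M_def by (intro borel_measurable_scaleR borel_measurable_const borel_measurable_sum
        pair_measurable[OF H2_meas] sample_value_measurable)
  have dQ: "diff_law P \<in> \<QQ>" "is_deriv \<QQ> \<Sigma> (diff_law P) J" using Q_in J by (auto simp: Q_def)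
  \<comment> \<open>Vacuous in case (a), where the domain is open. In Tyler's case it excludes an
    atom at 0, the one obstruction to membership in \<open>Q0\<close> that weak convergence does not
    remove.\<close>
  define adm where "adm Q' \<longleftrightarrow> case_a \<QQ> \<Sigma> \<or> emeasure Q' {0} = 0" for Q' :: "(real^'q) measure"
  have pQ: "probdist (diff_law P)"
    using setting dQ(1) by (auto simp: case_a_def weakly_open_def Q0_def)
  obtain f :: "nat \<Rightarrow> real^'q \<Rightarrow> real" where f: "\<And>k. continuous_on UNIV (f k)" "\<And>k x. \<bar>f k x\<bar> \<le> 1"
    "\<And>\<mu> \<nu>. (\<And>n. probdist (\<mu> n)) \<Longrightarrow> probdist \<nu> \<Longrightarrow>
        (\<And>k. (\<lambda>n. integral\<^sup>L (\<mu> n) (f k)) \<longlonglongrightarrow> integral\<^sup>L \<nu> (f k)) \<Longrightarrow> weak_conv \<mu> \<nu>"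
    using countable_weak_conv_determining[where 'a = "real^'q"] unfolding probdist_def by metis
  have adm_open: "eventually (\<lambda>n. Qs n \<in> \<QQ>) sequentially"
    if Qs: "\<And>n. probdist (Qs n)" "\<And>n. adm (Qs n)" and wc: "weak_conv Qs (diff_law P)" for Qs
  proof (cases "case_a \<QQ> \<Sigma>")
    case True
    then show ?thesis using Qs(1) wc dQ(1) unfolding case_a_def weakly_open_def by blast
  next
    case False
    then have "\<QQ> = Q0" using setting by blast
    then show ?thesis using Q0_relatively_weakly_open[of "diff_law P" Qs] Qs wc dQ(1) False by (simp add: adm_def)
  qed
  define R where "R l n \<omega> = sqrt (real n) *\<^sub>R (Sh l n \<omega> - \<Sigma> Q - 2 *\<^sub>R S1 n \<omega> - Mn l n \<omega>)" for l n \<omega>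
  have R_m: "R l n \<in> borel_measurable (M n)" for l n
    unfolding R_def[abs_def] using Sh_m S1_m Mn_m by simp
  have R_small: "(\<lambda>n. measure (M n) {\<omega> \<in> space (M n). \<epsilon> < norm (R l n \<omega>)}) \<longlonglongrightarrow> 0" if \<epsilon>: "0 < \<epsilon>" for \<epsilon> l
    unfolding R_def Sh_def S1_def Mn_def M_def Q_def
  proof (rule functional_expansion_in_prob[OF _ f(1,2) _ _ \<epsilon>])
    show "\<exists>N. \<forall>Q'. probdist Q' \<and> adm Q' \<and>
        (\<forall>k<N. \<bar>integral\<^sup>L Q' (f k) - integral\<^sup>L (diff_law P) (f k)\<bar> < 1 / real (Suc N)) \<longrightarrow>
        norm (\<Sigma> Q' - \<Sigma> (diff_law P) - integral\<^sup>L Q' J) \<le> \<epsilon> * norm (integral\<^sup>L Q' J)" if "0 < \<epsilon>" for \<epsilon>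
      by (rule local_linearization[OF dQ(2) pQ adm_open f(3) that])
    show "(\<lambda>\<omega>. \<Sigma> (Qhat n (fst \<omega>) (snd \<omega> l))) \<in> borel_measurable (sample P TYPE('d) n)" for n
      using Sh_m[of l n] unfolding Sh_def M_def .
    fix n :: nat assume n: "2 \<le> n"
    show "AE \<omega> in sample P TYPE('d) n. adm (Qhat n (fst \<omega>) (snd \<omega> l))"
    proof (cases "case_a \<QQ> \<Sigma>")
      case True
      then show ?thesis by (simp add: adm_def)
    next
      case False
      then have "diff_law P \<in> Q0" using setting dQ(1) by auto
      then have z: "emeasure (diff_law P) {0} = 0" by (simp add: Q0_def)
      have "AE \<omega> in sample P TYPE('d) n. \<forall>i\<in>{1..n}. fst \<omega> (snd \<omega> l i) \<noteq> fst \<omega> (snd \<omega> l (nxt n i))"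
        by (rule AE_finite_allI) (auto intro!: AE_distinct_edges[OF z n])
      then show ?thesis
      proof eventually_elim
        case (elim \<omega>)
        have "fst \<omega> (snd \<omega> l (nxt n i)) - fst \<omega> (snd \<omega> l i) \<noteq> 0" if "i \<in> {1..n}" for i
          using elim[rule_format, OF that] by auto
        then show ?case unfolding adm_def Qhat_def using n by (intro disjI2 sym_emp_atom_zero) auto
      qed
    qed
  qed
  define v1 where "v1 A = (\<integral>x. (A \<bullet> H1 P J x)\<^sup>2 \<partial>P)" for A
  define v2 where "v2 A = (\<integral>z. (A \<bullet> H2 P J (fst z) (snd z))\<^sup>2 \<partial>(P \<Otimes>\<^sub>M P))" for A
  have H1P: "H1 P J \<in> borel_measurable P" using H1_meas by (simp add: measurable_cong_sets[OF sets_P refl])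
  obtain G1 where G1: "centered_gaussian_sym G1 v1" "\<And>A. (\<integral>x. iexp (A \<bullet> x) \<partial>G1) = exp (- v1 A / 2)"
    using centered_gaussian_sym_exists[OF prob_P H1P H1_bound H1_symm] unfolding v1_def[symmetric] by blast
  have H2m: "(\<lambda>z. H2 P J (fst z) (snd z)) \<in> borel_measurable (P \<Otimes>\<^sub>M P)" using H2_meas by (simp add: split_beta')
  obtain G2 where G2: "centered_gaussian_sym G2 v2" "\<And>A. (\<integral>x. iexp (A \<bullet> x) \<partial>G2) = exp (- v2 A / 2)"
    using centered_gaussian_sym_exists[OF PP.prob_space_axioms H2m H2_bound H2_symm] unfolding v2_def[symmetric] by blast
  have pG: "prob_space G1" "prob_space G2" and sG [measurable_cong]: "sets G1 = sets borel" "sets G2 = sets borel"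
    using G1(1) G2(1) by (auto simp: centered_gaussian_sym_def)
  let ?d = "real CARD('d)"
  let ?Y = "\<lambda>n \<omega>. (sqrt (real n) *\<^sub>R S1 n \<omega>, \<chi> l. sqrt (real n) *\<^sub>R Mn l n \<omega>)"
  let ?Pi = "PiM (UNIV :: 'd set) (\<lambda>_. G2)"
  have pPi: "prob_space ?Pi" using pG(2) by (intro prob_space_PiM)
  \<comment> \<open>\<open>A\<close> tests the first component and \<open>B l\<close> the component
    of cycle \<open>l\<close>; arbitrary choices give the full joint characteristic
    function.\<close>
  have char_lim: "(\<lambda>n. \<integral>\<omega>. iexp (A \<bullet> (sqrt n *\<^sub>R S1 n \<omega>) + (\<Sum>l\<in>UNIV. B l \<bullet> (sqrt n *\<^sub>R Mn l n \<omega>))) \<partial>M n)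
      \<longlonglongrightarrow> exp (- (v1 A + (\<Sum>l\<in>UNIV. v2 (B l))) / 2)" for A and B :: "'d \<Rightarrow> real^'q^'q"
  proof -
    \<comment> \<open>At \<open>n = 0\<close> both sides are 0 by the convention on
      division.\<close>
    have c: "sqrt (real n) * s / real n = s / sqrt (real n)" for n s
      by (cases "n = 0") (simp_all add: field_simps flip: power2_eq_square)
    have "A \<bullet> (sqrt n *\<^sub>R S1 n \<omega>) + (\<Sum>l\<in>UNIV. B l \<bullet> (sqrt n *\<^sub>R Mn l n \<omega>)) =
       (\<Sum>i=1..n. A \<bullet> H1 P J (fst \<omega> i)) / sqrt n
            + (\<Sum>l\<in>UNIV. (\<Sum>i=1..n. B l \<bullet> H2 P J (fst \<omega> (snd \<omega> l i)) (fst \<omega> (snd \<omega> l (nxt n i)))) / sqrt n)" for n \<omega>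
      unfolding S1_def Mn_def by (simp add: inner_sum_right c)
    then show ?thesis using kernel_char_limit[of A B] unfolding M_def v1_def v2_def by simp
  qed
  have joint: "conv_distr M ?Y (distr (G1 \<Otimes>\<^sub>M ?Pi) borel (\<lambda>(a, g). (a, vec_lambda g)))"
  proof (rule conv_distr_of_char[OF pM])
    show "?Y n \<in> borel_measurable (M n)" for n
      using S1_m Mn_m by (intro borel_measurable_Pair borel_measurable_vec_lambda) simp_all
    have comp: "(\<lambda>z. snd z l) \<in> borel_measurable (G1 \<Otimes>\<^sub>M ?Pi)" for l
    proof -
      have "(\<lambda>z. snd z l) \<in> measurable (G1 \<Otimes>\<^sub>M ?Pi) G2"
        by (rule measurable_compose[OF measurable_snd measurable_component_singleton]) simp
      then show ?thesis by (simp add: measurable_cong_sets[OF refl sG(2)])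
    qed
    have "(\<lambda>z. (fst z, \<chi> l. snd z l)) \<in> borel_measurable (G1 \<Otimes>\<^sub>M ?Pi)"
      by (intro borel_measurable_Pair borel_measurable_vec_lambda comp) measurable
    then have lm: "(\<lambda>(a, g). (a, vec_lambda g)) \<in> borel_measurable (G1 \<Otimes>\<^sub>M ?Pi)" by (simp add: split_beta')
    have pp: "prob_space (G1 \<Otimes>\<^sub>M ?Pi)"
    proof -
      interpret G: pair_prob_space G1 ?Pi
        using pG pPi by (simp add: pair_prob_space_def pair_sigma_finite_def prob_space_imp_sigma_finite)
      show ?thesis by (rule G.P.prob_space_axioms)
    qed
    show "prob_space (distr (G1 \<Otimes>\<^sub>M ?Pi) borel (\<lambda>(a, g). (a, vec_lambda g)))"
      by (rule prob_space.prob_space_distr[OF pp lm])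
    fix t :: "(real^'q^'q) \<times> ((real^'q^'q)^'d)"
    have e1: "t \<bullet> ?Y n \<omega> = fst t \<bullet> (sqrt n *\<^sub>R S1 n \<omega>) + (\<Sum>l\<in>UNIV. (snd t $ l) \<bullet> (sqrt n *\<^sub>R Mn l n \<omega>))" for n \<omega>
      by (simp add: inner_prod_def inner_vec_def[of "snd t"])
    interpret p2: product_prob_space "\<lambda>_::'d. G2" using pG(2) by (rule product_prob_space_const)
    have i2: "integrable G2 (\<lambda>x. iexp (A \<bullet> x))" for A
      by (rule prob_space.integrable_iexp_real[OF pG(2)]) measurable
    have "(\<integral>y. iexp (t \<bullet> y) \<partial>distr (G1 \<Otimes>\<^sub>M ?Pi) borel (\<lambda>(a, g). (a, vec_lambda g)))
        = (\<integral>z. iexp (t \<bullet> (case z of (a, g) \<Rightarrow> (a, vec_lambda g))) \<partial>(G1 \<Otimes>\<^sub>M ?Pi))"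
      by (intro integral_distr lm borel_measurable_continuous_onI continuous_intros)
    also have "\<dots> = (\<integral>z. iexp (fst t \<bullet> fst z) * (\<Prod>l\<in>UNIV. iexp (snd t $ l \<bullet> snd z l)) \<partial>(G1 \<Otimes>\<^sub>M ?Pi))"
      by (intro Bochner_Integration.integral_cong refl)
        (simp add: split_beta' inner_prod_def inner_vec_def[of "snd t"] exp_add distrib_left sum_distrib_left exp_sum)
    also have "\<dots> = (\<integral>x. iexp (fst t \<bullet> x) \<partial>G1) * (\<integral>g. (\<Prod>l\<in>UNIV. iexp (snd t $ l \<bullet> g l)) \<partial>?Pi)"
    proof (rule pair_integral_mult[OF pG(1) pPi, where f = "\<lambda>x. iexp (fst t \<bullet> x)" and g = "\<lambda>g. \<Prod>l\<in>UNIV. iexp (snd t $ l \<bullet> g l)"])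
      show "(\<lambda>g. \<Prod>l\<in>UNIV. iexp (snd t $ l \<bullet> g l)) \<in> borel_measurable ?Pi"
      proof (rule borel_measurable_prod)
        fix l :: 'd
        have "(\<lambda>g. g l) \<in> measurable ?Pi G2" by (rule measurable_component_singleton) simp
        then show "(\<lambda>g. iexp (snd t $ l \<bullet> g l)) \<in> borel_measurable ?Pi"
          using borel_measurable_integrable[OF i2] by (rule measurable_compose)
      qed
    qed (auto simp: prod_norm[symmetric])
    also have "\<dots> = exp (- v1 (fst t) / 2) * (\<Prod>l\<in>UNIV. complex_of_real (exp (- v2 (snd t $ l) / 2)))"
      using p2.product_integral_prod[of UNIV "\<lambda>l x. iexp (snd t $ l \<bullet> x)"] i2 by (simp only: G1(2) G2(2) finite)
    also have "\<dots> = exp (- (v1 (fst t) + (\<Sum>l\<in>UNIV. v2 (snd t $ l))) / 2)"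
      by (simp only: of_real_prod[symmetric] of_real_mult[symmetric] exp_sum[symmetric, OF finite] exp_add[symmetric])
        (simp add: sum_negf sum_divide_distrib[symmetric] diff_divide_distrib)
    finally show "(\<lambda>n. \<integral>\<omega>. iexp (t \<bullet> ?Y n \<omega>) \<partial>M n) \<longlonglongrightarrow> (\<integral>y. iexp (t \<bullet> y) \<partial>distr (G1 \<Otimes>\<^sub>M ?Pi) borel (\<lambda>(a, g). (a, vec_lambda g)))"
      unfolding e1 using char_lim[of "fst t" "\<lambda>l. snd t $ l"] by simp
  qed simp
  let ?Z = "\<lambda>n \<omega>. sqrt (real n) *\<^sub>R ((1 / ?d) *\<^sub>R (\<Sum>l\<in>UNIV. Sh l n \<omega>) - \<Sigma> Q)"
  have averaged: "conv_distr M ?Z (distr (G1 \<Otimes>\<^sub>M G2) borel (\<lambda>(a, b). 2 *\<^sub>R a + (1 / sqrt ?d) *\<^sub>R b))"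
  proof (rule conv_distr_of_char[OF pM])
    show Z_m: "?Z n \<in> borel_measurable (M n)" for n using Sh_m by simp
    have lm: "(\<lambda>(a, b). 2 *\<^sub>R a + (1 / sqrt ?d) *\<^sub>R b) \<in> borel_measurable (G1 \<Otimes>\<^sub>M G2)" by measurable
    have pp: "prob_space (G1 \<Otimes>\<^sub>M G2)"
    proof -
      interpret G: pair_prob_space G1 G2
        using pG by (simp add: pair_prob_space_def pair_sigma_finite_def prob_space_imp_sigma_finite)
      show ?thesis by (rule G.P.prob_space_axioms)
    qed
    show "prob_space (distr (G1 \<Otimes>\<^sub>M G2) borel (\<lambda>(a, b). 2 *\<^sub>R a + (1 / sqrt ?d) *\<^sub>R b))"
      by (rule prob_space.prob_space_distr[OF pp lm])
    fix t :: "real^'q^'q"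
    \<comment> \<open>The linearisation of \<open>t \<bullet> ?Z n \<omega>\<close>: all cycles
      share the same term \<open>2 *\<^sub>R S1\<close>, while their degenerate parts are averaged
      with weight \<open>1 / ?d\<close>.\<close>
    define T where "T n \<omega> = (2 *\<^sub>R t) \<bullet> (sqrt n *\<^sub>R S1 n \<omega>) + (\<Sum>l\<in>UNIV. ((1 / ?d) *\<^sub>R t) \<bullet> (sqrt n *\<^sub>R Mn l n \<omega>))" for n \<omega>
    have T_m: "T n \<in> borel_measurable (M n)" for n unfolding T_def[abs_def] using S1_m Mn_m by simp
    have diff: "t \<bullet> ?Z n \<omega> - T n \<omega> = t \<bullet> ((1 / ?d) *\<^sub>R (\<Sum>l\<in>UNIV. R l n \<omega>))" for n \<omega>
    proof -
      have "(\<Sum>l\<in>UNIV. R l n \<omega>) = sqrt n *\<^sub>R ((\<Sum>l\<in>UNIV. Sh l n \<omega>) - ?d *\<^sub>R \<Sigma> Q - ?d *\<^sub>R (2 *\<^sub>R S1 n \<omega>) - (\<Sum>l\<in>UNIV. Mn l n \<omega>))"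
        by (simp add: R_def scaleR_sum_right[symmetric] sum_subtractf sum_constant_scaleR del: sum_constant)
      moreover have "T n \<omega> = (2 *\<^sub>R t) \<bullet> (sqrt n *\<^sub>R S1 n \<omega>) + ((1 / ?d) *\<^sub>R t) \<bullet> (sqrt n *\<^sub>R (\<Sum>l\<in>UNIV. Mn l n \<omega>))"
        by (simp only: T_def inner_sum_right[symmetric] scaleR_sum_right[symmetric])
      moreover have "?d \<noteq> 0" by simp
      ultimately show ?thesis
        by (simp only: inner_diff_right inner_scaleR_right inner_scaleR_left) (simp add: field_simps)
    qed
    have "(\<lambda>n. (\<integral>\<omega>. iexp (t \<bullet> ?Z n \<omega>) \<partial>M n) - (\<integral>\<omega>. iexp (T n \<omega>) \<partial>M n)) \<longlonglongrightarrow> 0"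
    proof (rule integral_iexp_diff_tendsto_0[OF pM _ T_m])
      show "(\<lambda>\<omega>. t \<bullet> ?Z n \<omega>) \<in> borel_measurable (M n)" for n using Z_m[of n] by (rule borel_measurable_inner[OF borel_measurable_const])
      fix \<epsilon> :: real assume \<epsilon>: "0 < \<epsilon>"
      \<comment> \<open>The summand 1 covers \<open>t = 0\<close>. The average of the remainders has
        norm at most \<open>\<eta>\<close> if each of them has.\<close>
      define \<eta> where "\<eta> = \<epsilon> / (norm t + 1)"
      have \<eta>: "0 < \<eta>" "norm t * \<eta> \<le> \<epsilon>" using \<epsilon> by (auto simp: \<eta>_def field_simps add_pos_nonneg)
      show "(\<lambda>n. measure (M n) {\<omega> \<in> space (M n). \<epsilon> < \<bar>t \<bullet> ?Z n \<omega> - T n \<omega>\<bar>}) \<longlonglongrightarrow> 0"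
      proof (rule Lim_null_comparison[OF always_eventually, OF allI])
        have "(\<lambda>n. \<Sum>l\<in>UNIV. measure (M n) {\<omega> \<in> space (M n). \<eta> < norm (R l n \<omega>)}) \<longlonglongrightarrow> (\<Sum>l\<in>(UNIV :: 'd set). 0)"
          by (intro tendsto_sum R_small \<eta>)
        then show "(\<lambda>n. \<Sum>l\<in>UNIV. measure (M n) {\<omega> \<in> space (M n). \<eta> < norm (R l n \<omega>)}) \<longlonglongrightarrow> 0" by simp
        fix n
        interpret Mn': prob_space "M n" by (rule pM)
        have s: "{\<omega> \<in> space (M n). \<eta> < norm (R l n \<omega>)} \<in> sets (M n)" for l using R_m[of l n] by measurable
        have "{\<omega> \<in> space (M n). \<epsilon> < \<bar>t \<bullet> ?Z n \<omega> - T n \<omega>\<bar>} \<subseteq> (\<Union>l\<in>UNIV. {\<omega> \<in> space (M n). \<eta> < norm (R l n \<omega>)})"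
        proof (rule subsetI, rule ccontr)
          fix \<omega> assume bad: "\<omega> \<in> {\<omega> \<in> space (M n). \<epsilon> < \<bar>t \<bullet> ?Z n \<omega> - T n \<omega>\<bar>}"
            and "\<omega> \<notin> (\<Union>l\<in>UNIV. {\<omega> \<in> space (M n). \<eta> < norm (R l n \<omega>)})"
          then have R: "norm (R l n \<omega>) \<le> \<eta>" for l by (auto simp: not_less)
          have "norm (\<Sum>l\<in>UNIV. R l n \<omega>) \<le> ?d * \<eta>" using sum_norm_bound[of UNIV "\<lambda>l. R l n \<omega>" \<eta>] R by simp
          then have "norm ((1 / ?d) *\<^sub>R (\<Sum>l\<in>UNIV. R l n \<omega>)) \<le> \<eta>" by (simp add: field_simps)
          then have "norm t * norm ((1 / ?d) *\<^sub>R (\<Sum>l\<in>UNIV. R l n \<omega>)) \<le> norm t * \<eta>" by (intro mult_left_mono) auto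
          then have "\<bar>t \<bullet> ?Z n \<omega> - T n \<omega>\<bar> \<le> norm t * \<eta>" unfolding diff by (rule order_trans[OF Cauchy_Schwarz_ineq2])
          then show False using bad \<eta> by auto
        qed
        then have "measure (M n) {\<omega> \<in> space (M n). \<epsilon> < \<bar>t \<bullet> ?Z n \<omega> - T n \<omega>\<bar>} \<le> measure (M n) (\<Union>l\<in>UNIV. {\<omega> \<in> space (M n). \<eta> < norm (R l n \<omega>)})"
          using s by (intro Mn'.finite_measure_mono) auto
        also have "\<dots> \<le> (\<Sum>l\<in>UNIV. measure (M n) {\<omega> \<in> space (M n). \<eta> < norm (R l n \<omega>)})"
          using s by (intro Mn'.finite_measure_subadditive_finite) auto
        finally show "norm (measure (M n) {\<omega> \<in> space (M n). \<epsilon> < \<bar>t \<bullet> ?Z n \<omega> - T n \<omega>\<bar>}) \<le> (\<Sum>l\<in>UNIV. measure (M n) {\<omega> \<in> space (M n). \<eta> < norm (R l n \<omega>)})"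
          by simp
      qed
    qed
    moreover have "(\<lambda>n. \<integral>\<omega>. iexp (T n \<omega>) \<partial>M n) \<longlonglongrightarrow> exp (- (v1 (2 *\<^sub>R t) + (\<Sum>l\<in>(UNIV :: 'd set). v2 ((1 / ?d) *\<^sub>R t))) / 2)"
      unfolding T_def by (rule char_lim)
    ultimately have "(\<lambda>n. \<integral>\<omega>. iexp (t \<bullet> ?Z n \<omega>) \<partial>M n) \<longlonglongrightarrow> exp (- (v1 (2 *\<^sub>R t) + (\<Sum>l\<in>(UNIV :: 'd set). v2 ((1 / ?d) *\<^sub>R t))) / 2)"
      by (rule Lim_transform[rotated])
    moreover have "(\<integral>y. iexp (t \<bullet> y) \<partial>distr (G1 \<Otimes>\<^sub>M G2) borel (\<lambda>(a, b). 2 *\<^sub>R a + (1 / sqrt ?d) *\<^sub>R b))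
        = exp (- (v1 (2 *\<^sub>R t) + (\<Sum>l\<in>(UNIV :: 'd set). v2 ((1 / ?d) *\<^sub>R t))) / 2)"
    proof -
      have m: "(\<lambda>x. iexp (A \<bullet> x)) \<in> borel_measurable G1" "(\<lambda>x. iexp (A \<bullet> x)) \<in> borel_measurable G2" for A
        by measurable
      have v2: "v2 (c *\<^sub>R t) = c\<^sup>2 * v2 t" for c by (simp add: v2_def power_mult_distrib)
      have "(\<integral>y. iexp (t \<bullet> y) \<partial>distr (G1 \<Otimes>\<^sub>M G2) borel (\<lambda>(a, b). 2 *\<^sub>R a + (1 / sqrt ?d) *\<^sub>R b))
        = (\<integral>z. iexp (t \<bullet> (case z of (a, b) \<Rightarrow> 2 *\<^sub>R a + (1 / sqrt ?d) *\<^sub>R b)) \<partial>(G1 \<Otimes>\<^sub>M G2))"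
        by (intro integral_distr lm borel_measurable_continuous_onI continuous_intros)
      also have "\<dots> = (\<integral>z. iexp ((2 *\<^sub>R t) \<bullet> fst z) * iexp (((1 / sqrt ?d) *\<^sub>R t) \<bullet> snd z) \<partial>(G1 \<Otimes>\<^sub>M G2))"
        by (intro Bochner_Integration.integral_cong refl) (simp add: split_beta' inner_add_right exp_add distrib_left)
      also have "\<dots> = (\<integral>x. iexp ((2 *\<^sub>R t) \<bullet> x) \<partial>G1) * (\<integral>x. iexp (((1 / sqrt ?d) *\<^sub>R t) \<bullet> x) \<partial>G2)"
        by (rule pair_integral_mult[OF pG]) (simp_all only: m norm_exp_i_times order_refl)
      also have "\<dots> = exp (- (v1 (2 *\<^sub>R t) + v2 ((1 / sqrt ?d) *\<^sub>R t)) / 2)"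
        by (simp only: G1(2) G2(2) of_real_mult[symmetric] exp_add[symmetric]) (simp add: diff_divide_distrib)
      \<comment> \<open>Averaging \<open>?d\<close> independent copies: \<open>v2\<close> is
        quadratic, and \<open>?d\<close> summands of weight \<open>1 / ?d\<^sup>2\<close> give
        \<open>1 / ?d\<close>.\<close>
      also have "v2 ((1 / sqrt ?d) *\<^sub>R t) = (\<Sum>l\<in>(UNIV :: 'd set). v2 ((1 / ?d) *\<^sub>R t))"
        by (simp add: v2 power2_eq_square)
      finally show ?thesis .
    qed
    ultimately show "(\<lambda>n. \<integral>\<omega>. iexp (t \<bullet> ?Z n \<omega>) \<partial>M n) \<longlonglongrightarrow> (\<integral>y. iexp (t \<bullet> y) \<partial>distr (G1 \<Otimes>\<^sub>M G2) borel (\<lambda>(a, b). 2 *\<^sub>R a + (1 / sqrt ?d) *\<^sub>R b))"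
      by simp
  qed simp
  \<comment> \<open>The outer probability in \<open>op_zero\<close> is attained by the event itself,
    which is measurable here.\<close>
  have "op_zero M (R l)" for l unfolding op_zero_def
  proof (intro allI impI)
    fix \<epsilon> :: real assume \<epsilon>: "0 < \<epsilon>"
    show "\<exists>A. (\<forall>n. A n \<in> sets (M n) \<and> {\<omega> \<in> space (M n). \<epsilon> < norm (R l n \<omega>)} \<subseteq> A n) \<and> (\<lambda>n. measure (M n) (A n)) \<longlonglongrightarrow> 0"
    proof (intro exI[of _ "\<lambda>n. {\<omega> \<in> space (M n). \<epsilon> < norm (R l n \<omega>)}"] conjI allI R_small[OF \<epsilon>] subset_refl)
      show "{\<omega> \<in> space (M n). \<epsilon> < norm (R l n \<omega>)} \<in> sets (M n)" for n using R_m[of l n] by measurable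
    qed
  qed
  then show ?thesis
    using G1(1) G2(1) joint averaged unfolding R_def[abs_def] v1_def[abs_def] v2_def[abs_def] by blast
qed

end
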